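(* Let $K=\mathbb{F}_q$ be a finite field of characteristic $p$, let $N\ge 1$ with $p\ge N$, let $\mathfrak{g}$ be a Lie subalgebra (over $K$) of $\mathfrak{ut}(N,K)$, and let $G=\exp(\mathfrak{g})$. Let $\mathfrak{h}$ be a Lie subalgebra of $\mathfrak{g}$ and $H=\exp(\mathfrak{h})$. Let $\Omega$ be a coadjoint orbit of $G$ in $\mathfrak{g}^*$ and $\omega$ a coadjoint orbit of $H$ in $\mathfrak{h}^*$, let $T^\Omega$ and $t^\omega$ be the corresponding irreducible complex representations of $G$ and $H$ respectively, and let $\pi:\mathfrak{g}^*\to\mathfrak{h}^*$ be the natural projection (restriction of linear forms to $\mathfrak{h}$). Let $$m(\omega,\Omega)=\mathrm{mult}\bigl(T^\Omega,\mathrm{ind}(t^\omega,G)\bigr)=\mathrm{mult}\bigl(t^\omega,\mathrm{res}(T^\Omega,H)\bigr),$$ the multiplicity of $T^\Omega$ in the representation of $G$ induced from $t^\omega$, equivalently the multiplicity of $t^\omega$ in the restriction of $T^\Omega$ to $H$. Then $$m(\omega,\Omega)=\frac{|\pi^{-1}(\omega)\cap\Omega|}{\sqrt{|\omega|\cdot|\Omega|}}.$$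
   Context: $\mathfrak{ut}(N,K)$ is the Lie algebra of all $N\times N$ upper triangular matrices over $K$ with zeros on the diagonal. Since $p\ge N$, the exponential map $\exp$ is defined on $\mathfrak{ut}(N,K)$ and maps each Lie subalgebra $\mathfrak{g}$ bijectively onto a subgroup $G=\exp(\mathfrak{g})$ of the unitriangular group $\mathrm{UT}(N,K)$. $\mathfrak{g}^*$ is the dual $K$-vector space. The coadjoint action of $G$ on $\mathfrak{g}^*$ is $(\mathrm{Ad}^*_g\lambda)(x)=\lambda(g^{-1}xg)$; its orbits are the coadjoint orbits. $|S|$ denotes the number of elements of a finite set $S$. Fix a nontrivial additive character $K\to\mathbb{C}^*$, written $x\mapsto e^{x}$ (the same character is used for all groups). For $\lambda\in\mathfrak{g}^*$, a polarization of $\lambda$ is a subalgebra $\mathfrak{p}$ of $\mathfrak{g}$ that is a maximal isotropic subspace for the skew-symmetric form $B_\lambda(x,y)=\lambda([x,y])$ on $\mathfrak{g}$; polarizations always exist. Put $P=\exp(\mathfrak{p})$, let $\xi_\lambda:P\to\mathbb{C}^*$ be the one-dimensional representation $\xi_\lambda(\exp(x))=e^{\lambda(x)}$, and let $T^\lambda=\mathrm{ind}(\xi_\lambda,P,G)$ be the induced complex representation. Up to equivalence, $T^\lambda$ is irreducible, does not depend on the choice of $\mathfrak{p}$, and depends only on the coadjoint orbit $\Omega$ of $\lambda$; its equivalence class is denoted $T^\Omega$. The representation $t^\omega$ of $H$ attached to a coadjoint orbit $\omega\subset\mathfrak{h}^*$ is defined in the same way, with $(\mathfrak{h},H)$ in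 place of $(\mathfrak{g},G)$. *)

theory Defs
  imports
    Complex_Main
    "HOL-Library.Function_Algebras"
    "HOL-Library.FuncSet"
    "HOL-Algebra.Group"
    "Jordan_Normal_Form.Matrix"
begin

section \<open>Lie algebras of strictly upper triangular matrices\<close>

definition ut :: "nat \<Rightarrow> 'k::field mat set" where
  "ut N = {A \<in> carrier_mat N N. \<forall>i<N. \<forall>j<N. j \<le> i \<longrightarrow> A $$ (i, j) = 0}"

definition bracket :: "'k::field mat \<Rightarrow> 'k mat \<Rightarrow> 'k mat" where
  "bracket x y = x * y - y * x"

definition mat_subspace :: "nat \<Rightarrow> 'k::field mat set \<Rightarrow> bool" where
  "mat_subspace N U \<longleftrightarrow>
     U \<subseteq> carrier_mat N N \<and> 0\<^sub>m N N \<in> U \<and>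
     (\<forall>x\<in>U. \<forall>y\<in>U. x + y \<in> U) \<and> (\<forall>c. \<forall>x\<in>U. c \<cdot>\<^sub>m x \<in> U)"

definition lie_subalgebra :: "nat \<Rightarrow> 'k::field mat set \<Rightarrow> 'k mat set \<Rightarrow> bool" where
  "lie_subalgebra N \<aa> \<gg> \<longleftrightarrow>
     mat_subspace N \<aa> \<and> \<aa> \<subseteq> \<gg> \<and> (\<forall>x\<in>\<aa>. \<forall>y\<in>\<aa>. bracket x y \<in> \<aa>)"

text \<open>The exponential series stops at degree \<open>N - 1\<close> because \<open>x ^\<^sub>m N = 0\<close> for strictly upper
  triangular \<open>x\<close>; the denominators are nonzero when the characteristic is at least \<open>N\<close>.\<close>

definition mat_exp :: "nat \<Rightarrow> 'k::field mat \<Rightarrow> 'k mat" where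
  "mat_exp N x = mat N N (\<lambda>(i, j). \<Sum>k<N. (x ^\<^sub>m k) $$ (i, j) / of_nat (fact k))"

definition exp_group :: "nat \<Rightarrow> 'k::field mat set \<Rightarrow> 'k mat monoid" where
  "exp_group N \<gg> = \<lparr>carrier = mat_exp N ` \<gg>, mult = (*), one = 1\<^sub>m N\<rparr>"


section \<open>Coadjoint orbits and polarizations\<close>

text \<open>Linear forms are made \<open>extensional\<close>, so that distinct elements of the dual space are
  distinct functions and cardinalities of orbits are correct.\<close>

definition dual :: "'k::field mat set \<Rightarrow> ('k mat \<Rightarrow> 'k) set" where
  "dual \<gg> = {l \<in> extensional \<gg>.
     (\<forall>x\<in>\<gg>. \<forall>y\<in>\<gg>. l (x + y) = l x + l y) \<and> (\<forall>c. \<forall>x\<in>\<gg>. l (c \<cdot>\<^sub>m x) = c * l x)}"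

definition coadjoint ::
  "nat \<Rightarrow> 'k::field mat set \<Rightarrow> 'k mat \<Rightarrow> ('k mat \<Rightarrow> 'k) \<Rightarrow> ('k mat \<Rightarrow> 'k)" where
  "coadjoint N \<gg> g l = (\<lambda>x\<in>\<gg>. l (inv\<^bsub>exp_group N \<gg>\<^esub> g * x * g))"

definition coadjoint_orbits :: "nat \<Rightarrow> 'k::field mat set \<Rightarrow> ('k mat \<Rightarrow> 'k) set set" where
  "coadjoint_orbits N \<gg> =
     (\<lambda>l. (\<lambda>g. coadjoint N \<gg> g l) ` carrier (exp_group N \<gg>)) ` dual \<gg>"

definition dual_proj :: "'k mat set \<Rightarrow> ('k mat \<Rightarrow> 'k) \<Rightarrow> ('k mat \<Rightarrow> 'k)" where
  "dual_proj \<hh> l = restrict l \<hh>"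

definition isotropic :: "('k::field mat \<Rightarrow> 'k) \<Rightarrow> 'k mat set \<Rightarrow> bool" where
  "isotropic l U \<longleftrightarrow> (\<forall>x\<in>U. \<forall>y\<in>U. l (bracket x y) = 0)"

definition polarization ::
  "nat \<Rightarrow> 'k::field mat set \<Rightarrow> ('k mat \<Rightarrow> 'k) \<Rightarrow> 'k mat set \<Rightarrow> bool" where
  "polarization N \<gg> l \<pp> \<longleftrightarrow>
     lie_subalgebra N \<pp> \<gg> \<and> isotropic l \<pp> \<and>
     (\<forall>U. mat_subspace N U \<and> U \<subseteq> \<gg> \<and> isotropic l U \<and> \<pp> \<subseteq> U \<longrightarrow> U = \<pp>)"


section \<open>Complex representations of groups\<close>

class complex_vector = ab_group_add +
  fixes scaleC :: "complex \<Rightarrow> 'a \<Rightarrow> 'a" (infixr \<open>*\<^sub>C\<close> 75)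
  assumes scaleC_add_right: "a *\<^sub>C (x + y) = a *\<^sub>C x + a *\<^sub>C y"
    and scaleC_add_left: "(a + b) *\<^sub>C x = a *\<^sub>C x + b *\<^sub>C x"
    and scaleC_scaleC: "a *\<^sub>C b *\<^sub>C x = (a * b) *\<^sub>C x"
    and scaleC_one: "1 *\<^sub>C x = x"

interpretation complex_vector:
  vector_space "scaleC :: complex \<Rightarrow> 'v \<Rightarrow> 'v::complex_vector"
  by unfold_locales (simp_all add: scaleC_add_right scaleC_add_left scaleC_scaleC scaleC_one)

instantiation complex :: complex_vector
begin

definition scaleC_complex :: "complex \<Rightarrow> complex \<Rightarrow> complex" where
  "scaleC_complex a z = a * z"

instance
  by standard (simp_all add: scaleC_complex_def algebra_simps)

end

instantiation "fun" :: (type, complex_vector) complex_vector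
begin

definition scaleC_fun :: "complex \<Rightarrow> ('a \<Rightarrow> 'b) \<Rightarrow> 'a \<Rightarrow> 'b" where
  "scaleC_fun a f = (\<lambda>x. a *\<^sub>C f x)"

instance
  by standard
    (simp_all add: scaleC_fun_def fun_eq_iff scaleC_add_right scaleC_add_left
      scaleC_scaleC scaleC_one)

end

text \<open>A representation lives on a subspace of an ambient complex vector space (a type); the values
  of \<open>rep_act\<close> at group elements matter only on that subspace.\<close>

record ('g, 'v) rep =
  rep_space :: "'v set"
  rep_act :: "'g \<Rightarrow> 'v \<Rightarrow> 'v"

definition linear_on :: "'v::complex_vector set \<Rightarrow> ('v \<Rightarrow> 'w::complex_vector) \<Rightarrow> bool" where
  "linear_on V f \<longleftrightarrow>
     (\<forall>v\<in>V. \<forall>w\<in>V. f (v + w) = f v + f w) \<and> (\<forall>c. \<forall>v\<in>V. f (c *\<^sub>C v) = c *\<^sub>C f v)"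

definition is_rep :: "'g monoid \<Rightarrow> ('g, 'v::complex_vector) rep \<Rightarrow> bool" where
  "is_rep G T \<longleftrightarrow>
     complex_vector.subspace (rep_space T) \<and>
     (\<forall>g\<in>carrier G. rep_act T g \<in> rep_space T \<rightarrow> rep_space T \<and>
        linear_on (rep_space T) (rep_act T g)) \<and>
     (\<forall>v\<in>rep_space T. rep_act T \<one>\<^bsub>G\<^esub> v = v) \<and>
     (\<forall>g\<in>carrier G. \<forall>h\<in>carrier G. \<forall>v\<in>rep_space T.
        rep_act T (g \<otimes>\<^bsub>G\<^esub> h) v = rep_act T g (rep_act T h v))"

definition rep_equiv ::
  "'g monoid \<Rightarrow> ('g, 'v::complex_vector) rep \<Rightarrow> ('g, 'w::complex_vector) rep \<Rightarrow> bool" where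
  "rep_equiv G T S \<longleftrightarrow>
     (\<exists>f. linear_on (rep_space T) f \<and> bij_betw f (rep_space T) (rep_space S) \<and>
        (\<forall>g\<in>carrier G. \<forall>v\<in>rep_space T. f (rep_act T g v) = rep_act S g (f v)))"

definition invariant_subspace ::
  "'g monoid \<Rightarrow> ('g, 'v::complex_vector) rep \<Rightarrow> 'v set \<Rightarrow> bool" where
  "invariant_subspace G T W \<longleftrightarrow>
     complex_vector.subspace W \<and> W \<subseteq> rep_space T \<and>
     (\<forall>g\<in>carrier G. \<forall>w\<in>W. rep_act T g w \<in> W)"

definition subrep :: "('g, 'v) rep \<Rightarrow> 'v set \<Rightarrow> ('g, 'v) rep" where
  "subrep T W = T\<lparr>rep_space := W\<rparr>"

definition irreducible_rep :: "'g monoid \<Rightarrow> ('g, 'v::complex_vector) rep \<Rightarrow> bool" where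
  "irreducible_rep G T \<longleftrightarrow>
     is_rep G T \<and> rep_space T \<noteq> {0} \<and>
     (\<forall>W. invariant_subspace G T W \<longrightarrow> W = {0} \<or> W = rep_space T)"

text \<open>Internal direct sum decompositions into irreducible subrepresentations. A set of subspaces
  suffices, as the summands are nonzero and hence pairwise distinct.\<close>

definition irreducible_decomposition ::
  "'g monoid \<Rightarrow> ('g, 'v::complex_vector) rep \<Rightarrow> 'v set set \<Rightarrow> bool" where
  "irreducible_decomposition G V D \<longleftrightarrow>
     finite D \<and>
     (\<forall>W\<in>D. invariant_subspace G V W \<and> irreducible_rep G (subrep V W)) \<and>
     (\<forall>v\<in>rep_space V. \<exists>!f. f \<in> (\<Pi>\<^sub>E W\<in>D. W) \<and> v = (\<Sum>W\<in>D. f W))"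

definition rep_mult ::
  "'g monoid \<Rightarrow> ('g, 'v::complex_vector) rep \<Rightarrow> ('g, 'w::complex_vector) rep \<Rightarrow> nat" where
  "rep_mult G T V =
     (THE m. \<exists>D. irreducible_decomposition G V D \<and>
        m = card {W \<in> D. rep_equiv G T (subrep V W)})"

definition res_rep :: "('g, 'v) rep \<Rightarrow> 'g monoid \<Rightarrow> ('g, 'v) rep" where
  "res_rep T H = \<lparr>rep_space = rep_space T, rep_act = restrict (rep_act T) (carrier H)\<rparr>"

text \<open>The induced representation by left translations on \<open>H\<close>-equivariant functions on \<open>G\<close>
  (extended by \<open>0\<close> off \<open>G\<close>).\<close>

definition ind_rep ::
  "('g, 'v::complex_vector) rep \<Rightarrow> 'g monoid \<Rightarrow> 'g monoid \<Rightarrow> ('g, 'g \<Rightarrow> 'v) rep" where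
  "ind_rep t H G =
     \<lparr>rep_space = {f. (\<forall>x\<in>carrier G. f x \<in> rep_space t) \<and> (\<forall>x. x \<notin> carrier G \<longrightarrow> f x = 0) \<and>
        (\<forall>x\<in>carrier G. \<forall>h\<in>carrier H. f (x \<otimes>\<^bsub>G\<^esub> h) = rep_act t (inv\<^bsub>H\<^esub> h) (f x))},
      rep_act = (\<lambda>g f x. if x \<in> carrier G then f (inv\<^bsub>G\<^esub> g \<otimes>\<^bsub>G\<^esub> x) else 0)\<rparr>"


section \<open>The representations attached to coadjoint orbits\<close>

definition nontrivial_additive_character :: "('k::field \<Rightarrow> complex) \<Rightarrow> bool" where
  "nontrivial_additive_character e \<longleftrightarrow>
     (\<forall>x. e x \<noteq> 0) \<and> (\<forall>x y. e (x + y) = e x * e y) \<and> (\<exists>x. e x \<noteq> 1)"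

definition xi_rep ::
  "nat \<Rightarrow> ('k::field \<Rightarrow> complex) \<Rightarrow> ('k mat \<Rightarrow> 'k) \<Rightarrow> 'k mat set \<Rightarrow> ('k mat, complex) rep" where
  "xi_rep N e l \<pp> =
     \<lparr>rep_space = UNIV, rep_act = (\<lambda>u z. e (l (inv_into \<pp> (mat_exp N) u)) * z)\<rparr>"

definition kirillov_rep ::
  "nat \<Rightarrow> ('k::field \<Rightarrow> complex) \<Rightarrow> 'k mat set \<Rightarrow> ('k mat \<Rightarrow> 'k) \<Rightarrow> 'k mat set \<Rightarrow>
     ('k mat, 'k mat \<Rightarrow> complex) rep" where
  "kirillov_rep N e \<gg> l \<pp> = ind_rep (xi_rep N e l \<pp>) (exp_group N \<pp>) (exp_group N \<gg>)"

text \<open>\<open>T\<close> belongs to the equivalence class of representations attached to the orbit \<open>\<Omega>\<close>.\<close>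

definition orbit_rep ::
  "nat \<Rightarrow> ('k::field \<Rightarrow> complex) \<Rightarrow> 'k mat set \<Rightarrow> ('k mat \<Rightarrow> 'k) set \<Rightarrow>
     ('k mat, 'v::complex_vector) rep \<Rightarrow> bool" where
  "orbit_rep N e \<gg> \<Omega> T \<longleftrightarrow>
     is_rep (exp_group N \<gg>) T \<and>
     (\<exists>l\<in>\<Omega>. \<exists>\<pp>. polarization N \<gg> l \<pp> \<and>
        rep_equiv (exp_group N \<gg>) T (kirillov_rep N e \<gg> l \<pp>))"

end

theory Submission
  imports Defs "HOL-Computational_Algebra.Formal_Power_Series"
begin

text \<open>Realise the representation of a polarization \<open>\<pp>\<close> of \<open>l\<close> as \<open>T = ind\<^sub>P\<^sup>G \<xi>\<close>. If the space of
  \<open>(P, \<xi>)\<close>-eigenvectors of \<open>T\<close> is one-dimensional, then \<open>T\<close> is irreducible, and its multiplicity in a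
  representation \<open>V\<close> is the dimension of the space of \<open>(P, \<xi>)\<close>-eigenvectors of \<open>V\<close>. For the restricted and the
  induced representation in the theorem this is a space of functions on \<open>G\<close> that transform by
  characters under \<open>P\<close> and the corresponding subgroup \<open>Q\<close> of \<open>H\<close>, and its dimension is the trace of the
  averaging projection, a character sum over \<open>\<qq>\<close> and \<open>G\<close>. The \<open>P\<close>-orbit of \<open>l\<close> is the set of all forms that
  agree with \<open>l\<close> on \<open>\<pp>\<close>; this turns the inner sum into a sum over \<open>\<Omega>\<close>, and the same step in \<open>H\<close>, followed by
  orthogonality of the additive characters of \<open>\<hh>\<close>, counts the pairs \<open>(\<kappa>, \<nu>)\<close> in \<open>\<omega> \<times> \<Omega>\<close> with \<open>\<nu>\<close> restricting to \<open>\<kappa>\<close>.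
  All cardinalities of orbits and of \<open>\<pp>\<close> also come from character sums.

  That \<open>exp\<close> maps a subalgebra onto a group is shown without the Campbell--Hausdorff series: the curve
  \<open>exp (t x) exp (t y)\<close> solves a linear differential equation with coefficients in the algebra, and
  the equation for its logarithm is solved inside the algebra coefficient by coefficient; only
  denominators below the characteristic occur.\<close>

section \<open>The exponential map of a nilpotent ring\<close>

no_notation vec_index (infixl "$" 100)
unbundle fps_syntax

text \<open>Irreducibility of \<open>T\<close> has itself to be derived: the dimension of the
  eigenspace of \<open>(P, \<xi>)\<close> in its own induced representation is the case
  \<open>h = g\<close>, \<open>\<omega> = \<Omega>\<close> of the same count, and comes out as 1.
  The square root has its origin in the polarizations. If \<open>rad\<close> is the radical of the
  form \<open>l [x, y]\<close>, then \<open>card p = card rad * sqrt (card \<Omega>)\<close>, while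
  the trace of the averaging projection is the product of the two radical sizes and the number of
  incidences, divided by \<open>card p * card q\<close>. The computation works for arbitrary
  polarizations at arbitrary points of the two orbits, namely those that come with the given
  representations. The exponential needs care because the characteristic may be as small as
  \<open>N\<close>. Every identity of curves is therefore compared in degrees below \<open>N\<close>
  only, and two filtrations, by powers of the nilpotent ideal and by the order of vanishing in
  \<open>t\<close>, decide which terms disappear.\<close>

definition lie :: "'a::ring \<Rightarrow> 'a \<Rightarrow> 'a" where
  "lie x y = x * y - y * x"

text \<open>The two assumptions are the product rule for \<open>S k = D (Z ^ k)\<close> with
  \<open>W = D Z\<close>, where \<open>Z\<close> and \<open>W\<close> need not commute. Carrying
  \<open>W\<close> to the left of the powers of \<open>Z\<close> creates iterated commutators, whose
  coefficients combine by Pascal's rule.\<close>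

lemma power_deriv_expansion:
  fixes Z W :: "'a::ring_1" and S :: "nat \<Rightarrow> 'a"
  assumes S0: "S 0 = 0" and SS: "\<And>k. S (Suc k) = Z * S k + W * Z ^ k"
  shows "S k = (\<Sum>j<k. of_nat (k choose Suc j) * (lie Z ^^ j) W * Z ^ (k - Suc j))"
proof (induction k)
  case 0
  then show ?case by (simp add: S0)
next
  case (Suc k)
  define a where "a j = (lie Z ^^ j) W" for j
  have Za: "Z * a j = a (Suc j) + a j * Z" for j
    by (simp add: a_def lie_def)
  have comm: "Z * (of_nat n * v) = of_nat n * (Z * v)" for n and v :: 'a
    by (metis mult.assoc mult_of_nat_commute)
  have pw: "Z * Z ^ (k - Suc j) = Z ^ (k - j)" if "j < k" for j
    using that by (metis Suc_diff_Suc power_Suc)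
  have 1: "Z * S k = (\<Sum>j<k. of_nat (k choose Suc j) * (a (Suc j) * Z ^ (k - Suc j)))
      + (\<Sum>j<k. of_nat (k choose Suc j) * (a j * Z ^ (k - j)))"
    unfolding Suc.IH a_def[symmetric] sum_distrib_left sum.distrib[symmetric]
  proof (rule sum.cong[OF refl])
    fix j assume "j \<in> {..<k}"
    then have j: "j < k" by simp
    have "Z * (of_nat (k choose Suc j) * a j * Z ^ (k - Suc j))
       = of_nat (k choose Suc j) * ((Z * a j) * Z ^ (k - Suc j))"
      by (simp add: mult.assoc comm)
    also have "\<dots> = of_nat (k choose Suc j) * (a (Suc j) * Z ^ (k - Suc j))
        + of_nat (k choose Suc j) * (a j * Z ^ (k - j))"
      by (simp only: Za distrib_left distrib_right mult.assoc pw[OF j])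
    finally show "Z * (of_nat (k choose Suc j) * a j * Z ^ (k - Suc j)) = \<dots>" .
  qed
  have 2: "(\<Sum>j<k. of_nat (k choose Suc j) * (a (Suc j) * Z ^ (k - Suc j))) + W * Z ^ k
      = (\<Sum>j<Suc k. of_nat (k choose j) * (a j * Z ^ (k - j)))"
    unfolding sum.lessThan_Suc_shift by (simp add: a_def add.commute)
  have 3: "(\<Sum>j<k. of_nat (k choose Suc j) * (a j * Z ^ (k - j)))
      = (\<Sum>j<Suc k. of_nat (k choose Suc j) * (a j * Z ^ (k - j)))"
    by (simp add: binomial_eq_0)
  have "S (Suc k) = (\<Sum>j<Suc k. of_nat (k choose j) * (a j * Z ^ (k - j)))
       + (\<Sum>j<Suc k. of_nat (k choose Suc j) * (a j * Z ^ (k - j)))"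
    unfolding SS 1 2[symmetric] 3[symmetric] by (simp only: ac_simps)
  also have "\<dots> = (\<Sum>j<Suc k. of_nat (Suc k choose Suc j) * a j * Z ^ (Suc k - Suc j))"
    unfolding sum.distrib[symmetric] 
    by (rule sum.cong[OF refl]) (simp add: distrib_right mult.assoc)
  finally show ?case by (simp only: a_def)
qed

text \<open>\<open>J n\<close> stands for the \<open>n\<close>-th power of a nilpotent ideal (with \<open>J 0\<close> a subring containing \<open>1\<close>) and \<open>r m\<close> for
  \<open>1 / m\<close>, which is arbitrary for \<open>m \<ge> N\<close>.\<close>

locale nilpotent_exp =
  fixes N :: nat and J :: "nat \<Rightarrow> 'a::ring_1 set" and r :: "nat \<Rightarrow> 'a"
  assumes J_zero: "0 \<in> J n"
    and J_add: "a \<in> J n \<Longrightarrow> b \<in> J n \<Longrightarrow> a + b \<in> J n"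
    and J_uminus: "a \<in> J n \<Longrightarrow> - a \<in> J n"
    and J_mult: "a \<in> J m \<Longrightarrow> b \<in> J n \<Longrightarrow> a * b \<in> J (m + n)"
    and J_one: "1 \<in> J 0"
    and J_antimono: "m \<le> n \<Longrightarrow> J n \<subseteq> J m"
    and J_top: "a \<in> J n \<Longrightarrow> n \<ge> N \<Longrightarrow> a = 0"
    and r_central: "r m * a = a * r m"
    and r_inverse: "0 < m \<Longrightarrow> m < N \<Longrightarrow> r m * of_nat m = 1"
    and r_J: "r m \<in> J 0"
    and N_pos: "N > 0"
begin

text \<open>The role of \<open>1 / n!\<close>, assembled from the partial inverses
  \<open>r m\<close>; it has this meaning only for \<open>n < N\<close>.\<close>

primrec c :: "nat \<Rightarrow> 'a" where
  "c 0 = 1"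
| "c (Suc n) = r (Suc n) * c n"

definition ex :: "'a \<Rightarrow> 'a" where
  "ex x = (\<Sum>k<N. c k * x ^ k)"

lemma c_central: "c k * a = a * c k"
proof (induction k)
  case (Suc k)
  have "c (Suc k) * a = r (Suc k) * (a * c k)"
    by (simp only: c.simps mult.assoc Suc)
  also have "\<dots> = a * c (Suc k)"
    by (simp only: c.simps mult.assoc[symmetric] r_central[of "Suc k" a])
  finally show ?case .
qed simp

lemma c_J: "c k \<in> J 0"
  by (induction k) (use J_one r_J J_mult[of _ 0 _ 0] in auto)

lemma c_Suc: "Suc n < N \<Longrightarrow> of_nat (Suc n) * c (Suc n) = c n"
  using r_inverse[of "Suc n"]
  by (simp only: c.simps mult.assoc[symmetric] mult_of_nat_commute[symmetric]) simp

lemma c_fact: "n < N \<Longrightarrow> of_nat (fact n) * c n = 1"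
proof (induction n)
  case (Suc n)
  then have "of_nat (fact (Suc n)) * c (Suc n) = of_nat (fact n) * (of_nat (Suc n) * c (Suc n))"
    by (metis fact_Suc mult.assoc mult_of_nat_commute of_nat_id of_nat_mult)
  with Suc c_Suc[of n] show ?case by simp
qed simp

lemma c_choose:
  assumes "j < k" "k < N"
  shows "c k * of_nat (k choose Suc j) = c (Suc j) * c (k - Suc j)"
proof -
  have f: "fact (Suc j) * fact (k - Suc j) * (k choose Suc j) = fact k"
    using binomial_fact_lemma[of "Suc j" k] assms by simp
  \<comment> \<open>Two factors equal to 1 are inserted, so that the two factorials and the binomial
    coefficient assemble to \<open>fact k\<close>, which \<open>c k\<close> cancels.\<close>
  have "c k * of_nat (k choose Suc j)
      = (of_nat (fact (Suc j)) * c (Suc j)) * ((of_nat (fact (k - Suc j)) * c (k - Suc j)) * (c k * of_nat (k choose Suc j)))"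
    using assms by (simp add: c_fact del: fact_Suc c.simps)
  also have "\<dots> = c (Suc j) * (c (k - Suc j) * (of_nat (fact (Suc j)) * (of_nat (fact (k - Suc j)) * (of_nat (k choose Suc j) * c k))))"
    by (metis (no_types, lifting) mult.assoc mult_of_nat_commute)
  also have "\<dots> = c (Suc j) * (c (k - Suc j) * (of_nat (fact k) * c k))"
    by (simp only: mult.assoc[symmetric] of_nat_mult[symmetric] f)
  finally show ?thesis using assms by (simp add: c_fact)
qed

lemma J_diff: "a \<in> J n \<Longrightarrow> b \<in> J n \<Longrightarrow> a - b \<in> J n"
  using J_add[OF _ J_uminus] by (metis diff_conv_add_uminus)

lemma J_sum: "(\<And>i. i \<in> A \<Longrightarrow> f i \<in> J n) \<Longrightarrow> sum f A \<in> J n"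
  by (induction A rule: infinite_finite_induct) (auto intro: J_add J_zero)

lemma J_of_nat: "a \<in> J n \<Longrightarrow> of_nat m * a \<in> J n"
  by (induction m) (auto simp: distrib_right intro: J_add J_zero)

lemma J_mult0: "a \<in> J 0 \<Longrightarrow> b \<in> J n \<Longrightarrow> a * b \<in> J n"
  using J_mult[of a 0 b n] by simp

lemma J_power: "x \<in> J 1 \<Longrightarrow> x ^ k \<in> J k"
  by (induction k) (use J_one J_mult[of _ 1] in auto)

text \<open>Power series are curves in a parameter \<open>t\<close>. Since the coefficient of \<open>t\<^sup>n\<close> lies in \<open>J n\<close>, all curves are
  polynomials of degree below \<open>N\<close>, they are determined by their derivatives although the
  characteristic is positive, and \<open>ev\<close> evaluates them at \<open>t = 1\<close>.\<close>

definition graded :: "nat \<Rightarrow> 'a fps \<Rightarrow> bool" where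
  "graded s f \<longleftrightarrow> (\<forall>n. f $ n \<in> J (n + s))"

definition ev :: "'a fps \<Rightarrow> 'a" where
  "ev f = (\<Sum>n<N. f $ n)"

lemma graded_nth: "graded s f \<Longrightarrow> n + s \<ge> N \<Longrightarrow> f $ n = 0"
  using J_top unfolding graded_def by blast

lemma graded_add: "graded s f \<Longrightarrow> graded s g \<Longrightarrow> graded s (f + g)"
  unfolding graded_def by (simp add: J_add)

lemma graded_diff: "graded s f \<Longrightarrow> graded s g \<Longrightarrow> graded s (f - g)"
  unfolding graded_def by (simp add: J_diff)

lemma graded_mult:
  assumes "graded s f" "graded t g" shows "graded (s + t) (f * g)"
  unfolding graded_def fps_mult_nth
proof (intro allI J_sum)
  fix n i :: nat assume "i \<in> {0..n}"
  then have "(i + s) + ((n - i) + t) = n + (s + t)" by simp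
  with assms J_mult[of "f $ i" "i + s" "g $ (n - i)" "(n - i) + t"]
  show "f $ i * g $ (n - i) \<in> J (n + (s + t))"
    unfolding graded_def by metis
qed

lemma graded_const: "a \<in> J s \<Longrightarrow> graded s (fps_const a)"
  unfolding graded_def using J_zero by auto

lemma graded_one: "graded 0 1"
  unfolding graded_def using J_zero J_one by auto

lemma graded_sum: "(\<And>i. i \<in> A \<Longrightarrow> graded s (f i)) \<Longrightarrow> graded s (sum f A)"
  unfolding graded_def by (auto simp: fps_sum_nth intro: J_sum)

text \<open>Differentiation lowers the exponent of \<open>t\<close> by one and leaves the
  coefficient in its ideal, so one degree is gained. Derivatives thus vanish from the coefficient
  \<open>N - 1\<close> on.\<close>

lemma graded_deriv: "graded 0 f \<Longrightarrow> graded 1 (fps_deriv f)"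
  unfolding graded_def
  by (metis J_of_nat Suc_eq_plus1 add_Suc_shift add.right_neutral fps_deriv_nth)

lemma graded_power: "graded 0 f \<Longrightarrow> graded 0 (f ^ k)"
  by (induction k) (use graded_mult[of 0 _ 0] graded_one in auto)

text \<open>Truncation at \<open>N\<close> does no harm to products: a pair of coefficients with
  \<open>i + j \<ge> N\<close> multiplies into \<open>J (i + j)\<close>, which is zero.\<close>

lemma ev_mult:
  assumes "graded 0 f" "graded 0 g" shows "ev (f * g) = ev f * ev g"
proof -
  have "ev (f * g) = (\<Sum>k<N. \<Sum>i\<le>k. f $ i * g $ (k - i))"
    by (simp add: ev_def fps_mult_nth atMost_atLeast0)
  also have "\<dots> = (\<Sum>(i, j)\<in>{(i, j). i + j < N}. f $ i * g $ j)"
    by (rule sum.triangle_reindex[symmetric])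
  also have "\<dots> = (\<Sum>(i, j)\<in>{..<N} \<times> {..<N}. f $ i * g $ j)"
  proof (rule sum.mono_neutral_left)
    have "f $ i * g $ j = 0" if "\<not> i + j < N" for i j
      using assms J_mult[of "f $ i" i "g $ j" j] J_top[of "f $ i * g $ j" "i + j"] that
      unfolding graded_def by simp
    then show "\<forall>p\<in>{..<N} \<times> {..<N} - {(i, j). i + j < N}. (case p of (i, j) \<Rightarrow> f $ i * g $ j) = 0"
      by auto
  qed auto
  also have "\<dots> = ev f * ev g"
    by (simp add: ev_def sum_product sum.cartesian_product)
  finally show ?thesis .
qed

lemma ev_power: "graded 0 f \<Longrightarrow> ev (f ^ k) = ev f ^ k"
proof (induction k)
  case 0
  show ?case using N_pos
    by (simp add: ev_def sum.delta)
qed (simp add: ev_mult graded_power)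

lemma ev_const: "ev (fps_const a) = a"
  using N_pos by (simp add: ev_def if_distrib sum.delta cong: if_cong)

lemma ev_sum: "ev (sum f A) = (\<Sum>i\<in>A. ev (f i))"
  unfolding ev_def fps_sum_nth by (rule sum.swap)

text \<open>The equation determines \<open>(m + 1)\<close> times the coefficient
  \<open>m + 1\<close> from earlier ones. Division by \<open>m + 1\<close> is possible below
  \<open>N\<close>, and from \<open>N\<close> on the grading makes all coefficients zero.\<close>

lemma ode_unique:
  assumes "graded 0 U" "graded 0 V" "U $ 0 = V $ 0"
    and "fps_deriv U = A * U" "fps_deriv V = A * V"
  shows "U = V"
proof (rule fps_ext)
  fix n show "U $ n = V $ n"
  proof (induction n rule: less_induct)
    case (less n)
    show ?case
    proof (cases n)
      case 0
      then show ?thesis using assms by simp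
    next
      case (Suc m)
      show ?thesis
      proof (cases "n < N")
        case False
        then show ?thesis using graded_nth assms by simp
      next
        case True
        have "of_nat (Suc m) * U $ Suc m = (A * U) $ m"
          using assms(4) by (metis Suc_eq_plus1 fps_deriv_nth)
        also have "\<dots> = (A * V) $ m"
          unfolding fps_mult_nth using less Suc by (intro sum.cong) auto
        also have "\<dots> = of_nat (Suc m) * V $ Suc m"
          using assms(5) by (metis Suc_eq_plus1 fps_deriv_nth)
        finally have "r (Suc m) * of_nat (Suc m) * U $ Suc m = r (Suc m) * of_nat (Suc m) * V $ Suc m"
          by (simp only: mult.assoc)
        then show ?thesis using r_inverse[of "Suc m"] True Suc by simp
      qed
    qed
  qed
qed

section \<open>Exponential curves with a constant generator\<close>

definition exp_t :: "'a \<Rightarrow> 'a fps" where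
  "exp_t x = Abs_fps (\<lambda>n. if n < N then c n * x ^ n else 0)"

lemma exp_t_graded: "x \<in> J 1 \<Longrightarrow> graded 0 (exp_t x)"
  unfolding graded_def exp_t_def using J_zero J_mult0[OF c_J J_power] by simp

lemma ev_exp_t: "ev (exp_t x) = ex x"
  by (simp add: ev_def exp_t_def ex_def)

lemma exp_t_0: "exp_t x $ 0 = 1"
  using N_pos by (simp add: exp_t_def)

lemma deriv_exp_t:
  assumes "x \<in> J 1" shows "fps_deriv (exp_t x) = fps_const x * exp_t x"
proof (rule fps_ext)
  fix n
  consider "Suc n < N" | "Suc n = N" | "Suc n > N" by linarith
  then show "fps_deriv (exp_t x) $ n = (fps_const x * exp_t x) $ n"
  proof cases
    case 1
    then have "of_nat (Suc n) * (c (Suc n) * x ^ Suc n) = c n * x ^ Suc n"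
      by (simp only: mult.assoc[symmetric] c_Suc)
    moreover have "c n * x ^ Suc n = x * (c n * x ^ n)"
      by (metis c_central mult.assoc power_Suc)
    ultimately show ?thesis
      using 1 by (simp add: exp_t_def del: c.simps of_nat_Suc power_Suc)
  next
    \<comment> \<open>The top coefficient: the truncated series has no term of degree
      \<open>N\<close>, so the right-hand side has to vanish there, which it does because it
      contains \<open>x ^ N\<close>.\<close>
    case 2
    have "x * (c n * x ^ n) = 0"
    proof (rule J_top)
      show "x * (c n * x ^ n) \<in> J (1 + n)"
        by (intro J_mult[OF assms] J_mult0[OF c_J] J_power[OF assms])
    qed (use 2 in simp)
    with 2 show ?thesis by (simp add: exp_t_def)
  next
    case 3
    then show ?thesis by (simp add: exp_t_def)
  qed
qed

lemma exp_t_commute: "fps_const x * exp_t x = exp_t x * fps_const x"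
proof -
  have "x * (c n * x ^ n) = c n * x ^ n * x" for n
    by (metis c_central mult.assoc power_commutes)
  then show ?thesis
    by (intro fps_ext) (simp add: exp_t_def)
qed

text \<open>As \<open>x\<close> commutes with its exponential, the derivative of the product is
  zero; uniqueness for the equation with \<open>A = 0\<close> makes the product constant.\<close>

lemma exp_t_uminus:
  assumes "x \<in> J 1" shows "exp_t (- x) * exp_t x = 1"
proof (rule ode_unique[where A = 0])
  have m: "- x \<in> J 1" using assms J_uminus by simp
  show "graded 0 (exp_t (- x) * exp_t x)"
    using graded_mult[OF exp_t_graded[OF m] exp_t_graded[OF assms]] by simp
  have "fps_deriv (exp_t (- x) * exp_t x)
      = exp_t (- x) * (fps_const x * exp_t x) + (fps_const (- x) * exp_t (- x)) * exp_t x"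
    using deriv_exp_t[OF m] deriv_exp_t[OF assms] by (simp del: fps_const_neg)
  also have "\<dots> = exp_t (- x) * fps_const (x + - x) * exp_t x"
    by (simp only: exp_t_commute fps_const_add[symmetric] distrib_left distrib_right mult.assoc)
  finally show "fps_deriv (exp_t (- x) * exp_t x) = 0 * (exp_t (- x) * exp_t x)" by simp
qed (simp_all add: graded_one exp_t_0)

lemma ex_uminus:
  assumes "x \<in> J 1" shows "ex (- x) * ex x = 1"
proof -
  have "ex (- x) * ex x = ev (exp_t (- x) * exp_t x)"
    using assms J_uminus by (simp add: ev_mult exp_t_graded ev_exp_t)
  also have "\<dots> = ev (fps_const 1)"
    using exp_t_uminus[OF assms] by simp
  finally show ?thesis by (simp only: ev_const)
qed

section \<open>Exponentials of curves and their logarithmic derivatives\<close>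

lemma c_one: "N > 1 \<Longrightarrow> c (Suc 0) = 1"
  using r_inverse[of 1] by simp

lemma fps_const_c_central: "fps_const (c k) * f = f * fps_const (c k)"
  by (intro fps_ext) (simp add: c_central)

lemma graded_lie: "graded s f \<Longrightarrow> graded t g \<Longrightarrow> graded (s + t) (lie f g)"
  unfolding lie_def using graded_diff graded_mult by (metis add.commute)

text \<open>Order of vanishing in \<open>t\<close>. This filtration complements
  \<open>graded\<close>: a curve that vanishes to order \<open>N - 1\<close> and has grade 1 is
  zero.\<close>

definition low :: "nat \<Rightarrow> 'a fps \<Rightarrow> bool" where
  "low s f \<longleftrightarrow> (\<forall>n<s. f $ n = 0)"

lemma low_mult:
  assumes "low s f" "low t g" shows "low (s + t) (f * g)"
  unfolding low_def fps_mult_nth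
proof (intro allI impI sum.neutral ballI)
  fix n i assume "n < s + t" "i \<in> {0..n}"
  then have "i < s \<or> n - i < t" by auto
  then show "f $ i * g $ (n - i) = 0" using assms unfolding low_def by auto
qed

lemma low_power: "Z $ 0 = 0 \<Longrightarrow> low k (Z ^ k)"
proof (induction k)
  case (Suc k)
  then have "low 1 Z" by (simp add: low_def)
  with low_mult[OF this Suc.IH[OF Suc.prems]] show ?case by simp
qed (simp add: low_def)

lemma low_lie:
  assumes "low s f" "low t g" shows "low (s + t) (lie f g)"
  using low_mult[OF assms] low_mult[OF assms(2,1)]
  unfolding lie_def low_def by (simp add: add.commute)

lemma low_lie_power:
  assumes "Z $ 0 = 0" shows "low j ((lie Z ^^ j) W)"
proof (induction j)
  case (Suc j)
  have "low 1 Z" using assms by (simp add: low_def)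
  from low_lie[OF this Suc] show ?case by simp
qed (simp add: low_def)

lemma graded_lie_power: "graded 0 Z \<Longrightarrow> graded s W \<Longrightarrow> graded s ((lie Z ^^ j) W)"
  by (induction j) (use graded_lie[of 0 Z s] in auto)

definition ser_exp :: "'a fps \<Rightarrow> 'a fps" where
  "ser_exp Z = (\<Sum>k<N. fps_const (c k) * Z ^ k)"

text \<open>\<open>dlog Z\<close> is the logarithmic derivative \<open>(exp Z)' (exp Z)\<^sup>-\<^sup>1\<close>, that is \<open>(e\<^sup>A - 1) / A\<close> with
  \<open>A = ad Z\<close>, applied to \<open>Z'\<close>.\<close>

definition dlog :: "'a fps \<Rightarrow> 'a fps" where
  "dlog Z = (\<Sum>j<N. fps_const (c (Suc j)) * (lie Z ^^ j) (fps_deriv Z))"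

lemma graded_const_c: "graded s f \<Longrightarrow> graded s (fps_const (c k) * f)"
  using graded_mult[OF graded_const[OF c_J]] by simp

lemma graded_ser_exp: "graded 0 Z \<Longrightarrow> graded 0 (ser_exp Z)"
  unfolding ser_exp_def by (intro graded_sum graded_const_c graded_power)

lemma graded_dlog: "graded 0 Z \<Longrightarrow> graded 1 (dlog Z)"
  unfolding dlog_def by (intro graded_sum graded_const_c graded_lie_power graded_deriv)

lemma ev_ser_exp:
  assumes "graded 0 Z" shows "ev (ser_exp Z) = ex (ev Z)"
  unfolding ser_exp_def ex_def ev_sum
  by (intro sum.cong refl)
     (simp only: ev_mult[OF graded_const[OF c_J] graded_power[OF assms]] ev_const ev_power[OF assms])

lemma ser_exp_0:
  assumes "Z $ 0 = 0" shows "ser_exp Z $ 0 = 1"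
proof -
  have "ser_exp Z $ 0 = (\<Sum>k<N. if k = 0 then 1 else 0)"
    unfolding ser_exp_def fps_sum_nth
    by (intro sum.cong refl) (use assms low_power in \<open>auto simp: low_def\<close>)
  then show ?thesis using N_pos by simp
qed

text \<open>By \<open>power_deriv_expansion\<close> and \<open>c_choose\<close>, the derivative is
  the part \<open>i + j < N - 1\<close> of the double sum for \<open>dlog Z * ser_exp Z\<close>. The
  remaining terms vanish: they have order at least \<open>i + j\<close> in \<open>t\<close>, and
  grade 1 leaves no coefficient from \<open>N - 1\<close> on.\<close>

lemma deriv_ser_exp:
  assumes g: "graded 0 Z" and z: "Z $ 0 = 0"
  shows "fps_deriv (ser_exp Z) = dlog Z * ser_exp Z"
proof -
  define W where "W = fps_deriv Z"
  define A where "A i = fps_const (c (Suc i)) * (lie Z ^^ i) W" for i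
  define B where "B j = fps_const (c j) * Z ^ j" for j
  obtain M where M: "N = Suc M" using N_pos by (cases N) auto
  have D: "fps_deriv (Z ^ k) = (\<Sum>j<k. of_nat (k choose Suc j) * (lie Z ^^ j) W * Z ^ (k - Suc j))" for k
    by (rule power_deriv_expansion[where S = "\<lambda>k. fps_deriv (Z ^ k)"]) (simp_all add: W_def)
  have AB: "fps_const (c k) * (of_nat (k choose Suc j) * (lie Z ^^ j) W * Z ^ (k - Suc j)) = A j * B (k - Suc j)"
    if "j < k" "k < N" for j k
  proof -
    have "fps_const (c k) * (of_nat (k choose Suc j) * (lie Z ^^ j) W * Z ^ (k - Suc j))
        = fps_const (c k * of_nat (k choose Suc j)) * ((lie Z ^^ j) W * Z ^ (k - Suc j))"
      by (simp only: fps_of_nat[symmetric] fps_const_mult[symmetric] mult.assoc)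
    also have "\<dots> = fps_const (c (Suc j)) * (fps_const (c (k - Suc j)) * (lie Z ^^ j) W) * Z ^ (k - Suc j)"
      by (simp only: c_choose[OF that] fps_const_mult[symmetric] mult.assoc)
    also have "\<dots> = A j * B (k - Suc j)"
      by (simp only: fps_const_c_central[of "k - Suc j" "(lie Z ^^ j) W"] A_def B_def mult.assoc)
    finally show ?thesis .
  qed
  have "fps_deriv (ser_exp Z) = (\<Sum>k<N. fps_const (c k) * fps_deriv (Z ^ k))"
    by (simp add: ser_exp_def fps_deriv_sum del: c.simps)
  also have "\<dots> = (\<Sum>k<N. \<Sum>j<k. A j * B (k - Suc j))"
    unfolding D sum_distrib_left by (intro sum.cong refl AB) auto
  also have "\<dots> = (\<Sum>k<M. \<Sum>j\<le>k. A j * B (k - j))"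
    unfolding M by (subst sum.lessThan_Suc_shift) (simp add: lessThan_Suc_atMost)
  also have "\<dots> = (\<Sum>(i, j)\<in>{(i, j). i + j < M}. A i * B j)"
    by (rule sum.triangle_reindex[symmetric])
  also have "\<dots> = (\<Sum>(i, j)\<in>{..<N} \<times> {..<N}. A i * B j)"
  proof (rule sum.mono_neutral_left)
    have "A i * B j = 0" if ij: "\<not> i + j < M" for i j
    proof (rule fps_ext)
      fix n
      have "graded 1 (A i)" "graded 0 (B j)"
        unfolding A_def B_def W_def
        by (intro graded_const_c graded_lie_power graded_deriv graded_power g)+
      from graded_mult[OF this] have gr: "graded 1 (A i * B j)" by simp
      have c0: "low 0 (fps_const (c k))" for k by (simp add: low_def)
      have "low i (A i)" "low j (B j)"
        unfolding A_def B_def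
        using low_mult[OF c0 low_lie_power[OF z]] low_mult[OF c0 low_power[OF z]] by (auto simp del: c.simps)
      from low_mult[OF this] have lo: "low (i + j) (A i * B j)" .
      show "(A i * B j) $ n = 0 $ n"
      proof (cases "n < i + j")
        case True
        with lo show ?thesis by (simp add: low_def)
      next
        case False
        with ij M graded_nth[OF gr, of n] show ?thesis by simp
      qed
    qed
    then show "\<forall>p\<in>{..<N} \<times> {..<N} - {(i, j). i + j < M}. (case p of (i, j) \<Rightarrow> A i * B j) = 0"
      by auto
  qed (use M in auto)
  also have "\<dots> = dlog Z * ser_exp Z"
    unfolding dlog_def ser_exp_def sum_product sum.cartesian_product A_def B_def W_def ..
  finally show ?thesis .
qed

text \<open>A Lie subalgebra of the nilpotent ideal, with closure only under the scalars that occur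
  in the series, namely the inverses \<open>r m\<close>.\<close>

definition lie_closed :: "'a set \<Rightarrow> bool" where
  "lie_closed g \<longleftrightarrow> g \<subseteq> J 1 \<and> 0 \<in> g \<and> (\<forall>x\<in>g. \<forall>y\<in>g. x + y \<in> g \<and> lie x y \<in> g) \<and>
     (\<forall>x\<in>g. - x \<in> g \<and> (\<forall>m. r m * x \<in> g))"

section \<open>Solving for the logarithm inside a Lie subalgebra\<close>

context
  fixes g :: "'a set"
  assumes g: "lie_closed g"
begin

lemma lie_closed_J: "x \<in> g \<Longrightarrow> x \<in> J 1"
  and lie_closed_0: "0 \<in> g"
  and lie_closed_add: "x \<in> g \<Longrightarrow> y \<in> g \<Longrightarrow> x + y \<in> g"
  and lie_closed_lie: "x \<in> g \<Longrightarrow> y \<in> g \<Longrightarrow> lie x y \<in> g"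
  and lie_closed_uminus: "x \<in> g \<Longrightarrow> - x \<in> g"
  and lie_closed_r: "x \<in> g \<Longrightarrow> r m * x \<in> g"
  using g unfolding lie_closed_def by blast+

lemma lie_closed_diff: "x \<in> g \<Longrightarrow> y \<in> g \<Longrightarrow> x - y \<in> g"
  using lie_closed_add[OF _ lie_closed_uminus] by (metis diff_conv_add_uminus)

lemma lie_closed_sum: "(\<And>i. i \<in> A \<Longrightarrow> f i \<in> g) \<Longrightarrow> sum f A \<in> g"
  by (induction A rule: infinite_finite_induct) (auto intro: lie_closed_0 lie_closed_add)

lemma lie_closed_of_nat: "x \<in> g \<Longrightarrow> of_nat m * x \<in> g"
  by (induction m) (auto simp: distrib_right intro: lie_closed_0 lie_closed_add)

lemma lie_closed_c: "x \<in> g \<Longrightarrow> c k * x \<in> g"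
  by (induction k) (auto simp: mult.assoc intro: lie_closed_r)

lemma lie_closed_lie_power: "x \<in> g \<Longrightarrow> y \<in> g \<Longrightarrow> (lie x ^^ k) y \<in> g"
  by (induction k) (auto intro: lie_closed_lie)

lemma fps_lie_nth: "lie Z W $ n = (\<Sum>i=0..n. lie (Z $ i) (W $ (n - i)))"
proof -
  have "(W * Z) $ n = (\<Sum>i=0..n. W $ (n - i) * Z $ i)"
    unfolding fps_mult_nth by (subst sum.atLeastAtMost_rev) simp
  then show ?thesis
    by (simp add: lie_def fps_mult_nth sum_subtractf)
qed

lemma fps_lie_in:
  "(\<And>n. Z $ n \<in> g) \<Longrightarrow> (\<And>n. W $ n \<in> g) \<Longrightarrow> lie Z W $ n \<in> g"
  unfolding fps_lie_nth by (intro lie_closed_sum lie_closed_lie)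

lemma dlog_in:
  assumes "\<And>n. Z $ n \<in> g" shows "dlog Z $ n \<in> g"
proof -
  have "((lie Z ^^ j) (fps_deriv Z)) $ n \<in> g" for j n
  proof (induction j arbitrary: n)
    case 0
    show ?case using assms lie_closed_of_nat[of "Z $ (n + 1)" "n + 1"] by simp
  next
    case (Suc j)
    then show ?case using fps_lie_in assms by simp
  qed
  then show ?thesis
    unfolding dlog_def fps_sum_nth by (auto intro!: lie_closed_sum lie_closed_c simp del: c.simps)
qed

text \<open>Since the constant term of \<open>Z\<close> is zero, the coefficient \<open>n\<close> of
  a bracket with \<open>Z\<close> involves the other argument only below \<open>n\<close>. This
  makes the recursion for \<open>dlog\<close> triangular.\<close>

lemma lie_nth_cong:
  assumes "Z $ 0 = 0" "Z' $ 0 = 0" "\<And>i. i \<le> n \<Longrightarrow> Z' $ i = Z $ i" "\<And>i. i < n \<Longrightarrow> W' $ i = W $ i"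
    and "m \<le> n"
  shows "lie Z' W' $ m = lie Z W $ m"
  unfolding fps_lie_nth
proof (rule sum.cong[OF refl])
  fix i assume i: "i \<in> {0..m}"
  show "lie (Z' $ i) (W' $ (m - i)) = lie (Z $ i) (W $ (m - i))"
  proof (cases "i = 0")
    case True
    then show ?thesis using assms(1,2) by (simp add: lie_def)
  next
    case False
    with i assms(5) have "i \<le> n" "m - i < n" by auto
    then show ?thesis using assms(3,4) by simp
  qed
qed

text \<open>The coefficient of \<open>t\<^sup>n\<close> in \<open>dlog Z\<close> is \<open>(n + 1) Z\<^sub>n\<^sub>+\<^sub>1\<close> plus brackets of earlier coefficients, so \<open>dlog Z = A\<close>
  can be solved recursively within the Lie algebra.\<close>

lemma dlog_surj_aux:
  assumes A: "graded 1 A" "\<And>n. A $ n \<in> g" and "n < N"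
  shows "\<exists>Z. Z $ 0 = 0 \<and> graded 0 Z \<and> (\<forall>i. Z $ i \<in> g) \<and> (\<forall>m<n. dlog Z $ m = A $ m)"
  using \<open>n < N\<close>
proof (induction n)
  case 0
  show ?case
    by (rule exI[of _ 0]) (use lie_closed_0 J_zero in \<open>auto simp: graded_def\<close>)
next
  case (Suc n)
  then obtain Z where Z: "Z $ 0 = 0" "graded 0 Z" "\<And>i. Z $ i \<in> g" "\<And>m. m < n \<Longrightarrow> dlog Z $ m = A $ m"
    by (metis Suc_lessD)
  \<comment> \<open>The correction to the coefficient \<open>n + 1\<close> of \<open>Z\<close>; the
    factor \<open>r (Suc n)\<close> compensates the factor \<open>n + 1\<close> that differentiation
    produces.\<close>
  define d where "d = r (Suc n) * (A $ n - dlog Z $ n)"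
  define Z' where "Z' = Abs_fps (\<lambda>i. if i = Suc n then Z $ i + d else Z $ i)"
  have dJ: "d \<in> J (Suc n)"
    using A(1) graded_dlog[OF Z(2)] unfolding d_def graded_def
    by (intro J_mult0[OF r_J] J_diff) (metis Suc_eq_plus1)+
  have dg: "d \<in> g"
    unfolding d_def by (intro lie_closed_r lie_closed_diff A(2) dlog_in Z(3))
  have Z'0: "Z' $ 0 = 0" using Z by (simp add: Z'_def)
  have eqn: "Z' $ i = Z $ i" if "i \<le> n" for i using that by (simp add: Z'_def)
  have D: "fps_deriv Z' $ m = fps_deriv Z $ m" if "m < n" for m
    using that eqn by simp
  have L: "((lie Z' ^^ j) (fps_deriv Z')) $ m = ((lie Z ^^ j) (fps_deriv Z)) $ m" if "m < n" for j m
    using that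
  proof (induction j arbitrary: m)
    case 0
    with D show ?case by simp
  next
    case (Suc j)
    then show ?case
      using lie_nth_cong[OF Z(1) Z'0 eqn, of n "(lie Z' ^^ j) (fps_deriv Z')" "(lie Z ^^ j) (fps_deriv Z)" m]
      by simp
  qed
  \<comment> \<open>The terms of \<open>dlog\<close> with at least one bracket do not see the
    correction in degree \<open>n\<close>, so only the derivative itself changes there.\<close>
  have Ln: "((lie Z' ^^ Suc j) (fps_deriv Z')) $ n = ((lie Z ^^ Suc j) (fps_deriv Z)) $ n" for j
    using lie_nth_cong[OF Z(1) Z'0 eqn, of n "(lie Z' ^^ j) (fps_deriv Z')" "(lie Z ^^ j) (fps_deriv Z)" n] L
    by simp
  obtain M where M: "N = Suc M" using N_pos by (cases N) auto
  have split: "(\<Sum>i<N. f i) = f 0 + (\<Sum>i<M. f (Suc i))" for f :: "nat \<Rightarrow> 'a"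
    by (simp only: M sum.lessThan_Suc_shift)
  have c1: "c (Suc 0) = 1" using c_one Suc.prems by simp
  have "dlog Z' $ n - dlog Z $ n = fps_deriv Z' $ n - fps_deriv Z $ n"
    unfolding dlog_def fps_sum_nth split
    using Ln c1 by (simp del: funpow.simps(2) c.simps fps_deriv_nth)
  also have "\<dots> = of_nat (Suc n) * d"
    by (simp add: Z'_def distrib_left)
  also have "\<dots> = A $ n - dlog Z $ n"
    unfolding d_def mult.assoc[symmetric]
    using r_inverse[of "Suc n"] Suc.prems r_central[of "Suc n" "of_nat (Suc n)"] by simp
  finally have "dlog Z' $ n = A $ n" by simp
  moreover have "dlog Z' $ m = A $ m" if "m < n" for m
    using L[OF that] Z(4)[OF that] unfolding dlog_def fps_sum_nth by simp
  moreover have "graded 0 Z'"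
    using Z(2) dJ unfolding graded_def Z'_def by (auto intro: J_add)
  moreover have "Z' $ i \<in> g" for i
    using Z(3) dg lie_closed_add unfolding Z'_def by auto
  ultimately show ?case using Z'0 by (metis less_SucE)
qed

text \<open>Both curves have grade 1, hence no coefficients from \<open>N - 1\<close> on; agreement
  below \<open>N - 1\<close> is equality.\<close>

lemma dlog_surj:
  assumes A: "graded 1 A" "\<And>n. A $ n \<in> g"
  obtains Z where "Z $ 0 = 0" "graded 0 Z" "\<And>i. Z $ i \<in> g" "dlog Z = A"
proof -
  obtain M where M: "N = Suc M" using N_pos by (cases N) auto
  obtain Z where Z: "Z $ 0 = 0" "graded 0 Z" "\<And>i. Z $ i \<in> g" "\<And>m. m < M \<Longrightarrow> dlog Z $ m = A $ m"
    using dlog_surj_aux[OF A, of M] M by auto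
  have "dlog Z $ m = A $ m" for m
  proof (cases "m < M")
    case False
    then show ?thesis using graded_nth[OF A(1), of m] graded_nth[OF graded_dlog[OF Z(2)], of m] M by simp
  qed (use Z in auto)
  then have "dlog Z = A" by (intro fps_ext)
  with Z that show ?thesis by metis
qed

section \<open>Conjugation by exponentials\<close>

lemma conj_exp_t_deriv:
  assumes x: "x \<in> J 1"
  shows "fps_deriv (exp_t x * fps_const y * exp_t (- x)) = lie (fps_const x) (exp_t x * fps_const y * exp_t (- x))"
proof -
  have m: "- x \<in> J 1" using x J_uminus by simp
  have *: "fps_deriv (exp_t (- x)) = - (exp_t (- x) * fps_const x)"
    using deriv_exp_t[OF m] exp_t_commute[of "- x"] by (simp flip: fps_const_neg)
  show ?thesis
    by (simp only: fps_deriv_mult fps_deriv_const deriv_exp_t[OF x] * lie_def) (simp add: algebra_simps)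
qed

text \<open>The identity \<open>Ad (exp (t x)) = exp (t ad x)\<close>, read off coefficientwise from
  the equation \<open>B' = [x, B]\<close>.\<close>

lemma conj_exp_t_nth:
  assumes x: "x \<in> J 1" and y: "y \<in> J 1" and "n < N"
  shows "(exp_t x * fps_const y * exp_t (- x)) $ n = c n * (lie x ^^ n) y"
  using \<open>n < N\<close>
proof (induction n)
  case 0
  show ?case by (simp add: exp_t_0)
next
  case (Suc n)
  let ?B = "exp_t x * fps_const y * exp_t (- x)"
  have "of_nat (Suc n) * ?B $ Suc n = lie x (?B $ n)"
    using arg_cong[OF conj_exp_t_deriv[OF x, of y], of "\<lambda>f. f $ n"]
    by (simp add: lie_def del: of_nat_Suc fps_deriv_mult)
  also have "?B $ n = c n * (lie x ^^ n) y" using Suc by simp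
  also have "lie x (c n * (lie x ^^ n) y) = c n * (lie x ^^ Suc n) y"
    unfolding lie_def by (simp add: right_diff_distrib mult.assoc c_central)
  finally have "r (Suc n) * of_nat (Suc n) * ?B $ Suc n = r (Suc n) * (c n * (lie x ^^ Suc n) y)"
    by (simp only: mult.assoc)
  then show ?case
    by (simp only: r_inverse[OF zero_less_Suc Suc.prems] mult_1_left c.simps mult.assoc)
qed

lemma conj_exp_t_in:
  assumes x: "x \<in> g" and y: "y \<in> g"
  shows "(exp_t x * fps_const y * exp_t (- x)) $ n \<in> g"
    and "graded 1 (exp_t x * fps_const y * exp_t (- x))"
proof -
  have J: "x \<in> J 1" "- x \<in> J 1" "y \<in> J 1" using x y lie_closed_J J_uminus by auto
  show gr: "graded 1 (exp_t x * fps_const y * exp_t (- x))"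
    using graded_mult[OF graded_mult[OF exp_t_graded graded_const] exp_t_graded] J by fastforce
  show "(exp_t x * fps_const y * exp_t (- x)) $ n \<in> g"
  proof (cases "n < N")
    case True
    then show ?thesis
      using conj_exp_t_nth J x y lie_closed_c lie_closed_lie_power by simp
  next
    case False
    then show ?thesis using graded_nth[OF gr] lie_closed_0 by simp
  qed
qed

lemma conj_ex:
  assumes x: "x \<in> g" and y: "y \<in> g"
  shows "ex x * y * ex (- x) = (\<Sum>n<N. c n * (lie x ^^ n) y)"
proof -
  have J: "x \<in> J 1" "- x \<in> J 1" "y \<in> J 1" using x y lie_closed_J J_uminus by auto
  have y0: "graded 0 (fps_const y)" using J(3) J_antimono[of 0 1] by (intro graded_const) auto
  have "ex x * y * ex (- x) = ev (exp_t x * fps_const y * exp_t (- x))"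
    using graded_mult[OF exp_t_graded[OF J(1)] y0]
    by (simp add: ev_mult[OF _ exp_t_graded[OF J(2)]] ev_mult[OF exp_t_graded[OF J(1)] y0] ev_exp_t ev_const)
  also have "\<dots> = (\<Sum>n<N. c n * (lie x ^^ n) y)"
    unfolding ev_def by (rule sum.cong) (simp_all add: conj_exp_t_nth[OF J(1,3)])
  finally show ?thesis .
qed

lemma conj_ex_in: "x \<in> g \<Longrightarrow> y \<in> g \<Longrightarrow> ex x * y * ex (- x) \<in> g"
  unfolding conj_ex by (intro lie_closed_sum lie_closed_c lie_closed_lie_power)

text \<open>Invariance under the group element \<open>ex x\<close> is equivalent to its
  infinitesimal version. From right to left all terms of the series but the first vanish. From left
  to right, invariance is applied to iterated brackets, the longest ones first, so that only the
  linear term of the series survives each time.\<close>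

lemma conj_ex_fixes_form_iff:
  fixes l :: "'a \<Rightarrow> 'b::ab_group_add"
  assumes x: "x \<in> g" and l: "\<And>y z. y \<in> g \<Longrightarrow> z \<in> g \<Longrightarrow> l (y + z) = l y + l z"
  shows "(\<forall>y\<in>g. l (ex x * y * ex (- x)) = l y) \<longleftrightarrow> (\<forall>y\<in>g. l (lie x y) = 0)"
proof -
  obtain M where M: "N = Suc M" using N_pos by (cases N) auto
  have l0: "l 0 = 0" using l[OF lie_closed_0 lie_closed_0] by simp
  have lsum: "l (sum f A) = (\<Sum>i\<in>A. l (f i))" if "\<And>i. i \<in> A \<Longrightarrow> f i \<in> g" for f and A :: "nat set"
    using that by (induction A rule: infinite_finite_induct) (auto simp: l0 l lie_closed_sum)
  \<comment> \<open>The form is only additive, so a scalar cannot be pulled out of it; it is pushed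
    into the innermost argument instead.\<close>
  have cpow: "c k * (lie x ^^ n) y = (lie x ^^ n) (c k * y)" for k n y
  proof (induction n)
    case (Suc n)
    have "c k * lie x v = lie x (c k * v)" for v
      unfolding lie_def by (simp only: right_diff_distrib mult.assoc[symmetric] c_central) 
        (simp only: mult.assoc c_central[of k v])
    with Suc show ?case by simp
  qed simp
  have expand: "l (ex x * y * ex (- x)) = l y + (\<Sum>n<M. l (c (Suc n) * (lie x ^^ Suc n) y))" if "y \<in> g" for y
  proof -
    have "ex x * y * ex (- x) = y + (\<Sum>n<M. c (Suc n) * (lie x ^^ Suc n) y)"
      unfolding conj_ex[OF x that] by (simp add: M sum.lessThan_Suc_shift del: sum.lessThan_Suc)
    then show ?thesis
      using that x by (simp add: l lsum lie_closed_sum lie_closed_c lie_closed_lie_power del: c.simps funpow.simps)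
  qed
  show ?thesis
  proof
    assume *: "\<forall>y\<in>g. l (lie x y) = 0"
    show "\<forall>y\<in>g. l (ex x * y * ex (- x)) = l y"
    proof
      fix y assume y: "y \<in> g"
      have "l (c (Suc n) * (lie x ^^ Suc n) y) = 0" for n
        unfolding cpow using * x y lie_closed_c[of y "Suc n"] lie_closed_lie_power[of x "c (Suc n) * y" n]
        by (simp del: c.simps)
      then show "l (ex x * y * ex (- x)) = l y" by (simp add: expand[OF y])
    qed
  next
    assume *: "\<forall>y\<in>g. l (ex x * y * ex (- x)) = l y"
    \<comment> \<open>A downward induction on the number \<open>n\<close> of brackets, run as an
      upward induction on a bound \<open>k\<close> for \<open>N - n\<close>; it starts with brackets
      of length at least \<open>N\<close>, which are zero, and is used for
      \<open>n = 1\<close>.\<close>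
    have "N \<le> n + k \<Longrightarrow> 0 < n \<Longrightarrow> \<forall>y\<in>g. l ((lie x ^^ n) y) = 0" for n k
    proof (induction k arbitrary: n)
      case 0
      have "(lie x ^^ i) y \<in> J i" if "y \<in> g" for i y
      proof (induction i)
        case 0
        show ?case using that lie_closed_J J_antimono[of 0 1] by auto
      next
        case (Suc i)
        then show ?case
          using lie_closed_J[OF x] J_mult[of x 1 _ i] J_mult[of _ i x 1]
          by (simp add: lie_def J_diff)
      qed
      then show ?case using 0 J_top l0 by (metis add.right_neutral)
    next
      case (Suc k)
      show ?case
      proof
        fix y assume y: "y \<in> g"
        define z where "z = (lie x ^^ (n - 1)) y"
        have z: "z \<in> g" unfolding z_def using x y by (rule lie_closed_lie_power)
        show "l ((lie x ^^ n) y) = 0"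
        proof (cases "M = 0")
          case True
          have "(lie x ^^ n) y \<in> g" using x y by (rule lie_closed_lie_power)
          then have "(lie x ^^ n) y = 0" using True M J_top[OF lie_closed_J] by simp
          then show ?thesis by (simp add: l0)
        next
          case False
          then obtain M' where M': "M = Suc M'" by (cases M) auto
          have c1: "c (Suc 0) = 1" using c_one M M' by simp
          have "l (c (Suc (Suc m)) * (lie x ^^ Suc (Suc m)) z) = 0" for m
          proof -
            have "(lie x ^^ Suc (Suc m)) z = (lie x ^^ (n + Suc m)) y"
            proof -
              have "n + Suc m = Suc (Suc m) + (n - 1)" using Suc.prems by simp
              then show ?thesis unfolding z_def by (simp only: funpow_add comp_apply)
            qed
            then have "c (Suc (Suc m)) * (lie x ^^ Suc (Suc m)) z = (lie x ^^ (n + Suc m)) (c (Suc (Suc m)) * y)"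
              by (simp only: cpow)
            moreover have "\<forall>y\<in>g. l ((lie x ^^ (n + Suc m)) y) = 0"
              by (rule Suc.IH) (use Suc.prems in auto)
            ultimately show ?thesis using lie_closed_c[OF y] by (simp only:)
          qed
          with expand[OF z] * z have "l (lie x z) = 0"
            unfolding M' sum.lessThan_Suc_shift by (simp add: c1 del: c.simps(2))
          moreover have "lie x z = (lie x ^^ n) y"
            unfolding z_def using Suc.prems by (cases n) auto
          ultimately show ?thesis by simp
        qed
      qed
    qed
    from this[of 1 N] show "\<forall>y\<in>g. l (lie x y) = 0" by simp
  qed
qed

end

text \<open>The ideal \<open>g'\<close> keeps track of \<open>log (exp x exp y) \<equiv> x + y\<close> modulo brackets, which makes \<open>exp x \<mapsto> e (l x)\<close> a
  character when \<open>l\<close> vanishes on brackets.\<close>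

lemma ex_mult_closed_mod:
  assumes g: "lie_closed g" and g': "lie_closed g'" "g' \<subseteq> g" "\<And>u v. u \<in> g \<Longrightarrow> v \<in> g \<Longrightarrow> lie u v \<in> g'"
    and x: "x \<in> g" and y: "y \<in> g"
  shows "\<exists>z\<in>g. ex x * ex y = ex z \<and> z - (x + y) \<in> g'"
proof -
  note gJ = lie_closed_J[OF g] and g0 = lie_closed_0[OF g]
  have J: "x \<in> J 1" "- x \<in> J 1" "y \<in> J 1" using x y gJ J_uminus by auto
  \<comment> \<open>\<open>A\<close> is the logarithmic derivative of
    \<open>exp (t x) exp (t y)\<close>: the first factor contributes \<open>x\<close>, the second
    one \<open>y\<close> conjugated by the first factor, which is \<open>B\<close>.\<close>
  define B where "B = exp_t x * fps_const y * exp_t (- x)"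
  define A where "A = fps_const x + B"
  have "graded 1 A"
    unfolding A_def B_def using x y conj_exp_t_in[OF g] J graded_const by (intro graded_add) auto
  moreover have "A $ n \<in> g" for n
    unfolding A_def B_def fps_add_nth
    by (intro lie_closed_add[OF g] conj_exp_t_in[OF g] x y) (use x g0 in auto)
  ultimately obtain Z where Z: "Z $ 0 = 0" "graded 0 Z" "\<And>i. Z $ i \<in> g" "dlog Z = A"
    by (rule dlog_surj[OF g]) blast
  have inv: "exp_t (- x) * exp_t x = 1" by (rule exp_t_uminus[OF J(1)])
  have gr: "graded 0 (exp_t x * exp_t y)"
    using graded_mult[OF exp_t_graded exp_t_graded] J by fastforce
  have "exp_t x * exp_t y = ser_exp Z"
  proof (rule ode_unique[where A = A])
    have "A * (exp_t x * exp_t y) = fps_const x * exp_t x * exp_t y + exp_t x * fps_const y * (exp_t (- x) * exp_t x) * exp_t y"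
      unfolding A_def B_def by (simp only: distrib_right mult.assoc)
    also have "\<dots> = fps_deriv (exp_t x * exp_t y)"
      unfolding inv using deriv_exp_t J by (simp add: mult.assoc)
    finally show "fps_deriv (exp_t x * exp_t y) = A * (exp_t x * exp_t y)" ..
    show "fps_deriv (ser_exp Z) = A * ser_exp Z"
      using deriv_ser_exp[OF Z(2,1)] Z(4) by simp
    show "(exp_t x * exp_t y) $ 0 = ser_exp Z $ 0"
      using Z by (simp add: exp_t_0 ser_exp_0)
  qed (use gr Z graded_ser_exp in auto)
  then have eq: "ex x * ex y = ex (ev Z)"
    using ev_mult[OF exp_t_graded exp_t_graded, of x y] J ev_ser_exp[OF Z(2)] by (simp add: ev_exp_t)
  have evg: "ev Z \<in> g" unfolding ev_def by (intro lie_closed_sum[OF g] Z)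
  obtain M where M: "N = Suc M" using N_pos by (cases N) auto
  have split: "(\<Sum>i<N. f i) = f 0 + (\<Sum>i<M. f (Suc i))" for f :: "nat \<Rightarrow> 'a"
    by (simp only: M sum.lessThan_Suc_shift)
  \<comment> \<open>In degree \<open>n\<close>, the equation \<open>dlog Z = A\<close> reads
    \<open>(n + 1) Z (n + 1) + brackets = A n\<close>, and the brackets lie in
    \<open>g'\<close>.\<close>
  have step: "Z $ Suc n - r (Suc n) * A $ n \<in> g'" if n: "n < M" for n
  proof -
    have c1: "c (Suc 0) = 1" using c_one n M by simp
    define R where "R = (\<Sum>j<M. c (Suc (Suc j)) * ((lie Z ^^ Suc j) (fps_deriv Z)) $ n)"
    have lieg: "((lie Z ^^ j) (fps_deriv Z)) $ i \<in> g" for i j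
    proof (induction j arbitrary: i)
      case 0
      show ?case using Z(3) lie_closed_of_nat[OF g, of "Z $ (i + 1)" "i + 1"] by simp
    next
      case (Suc j)
      then show ?case using fps_lie_in[OF g Z(3)] by simp
    qed
    have "((lie Z ^^ Suc j) (fps_deriv Z)) $ n \<in> g'" for j
      unfolding funpow.simps comp_apply fps_lie_nth[OF g] by (intro lie_closed_sum[OF g'(1)] g'(3) Z(3) lieg)
    then have R: "R \<in> g'"
      unfolding R_def by (intro lie_closed_sum[OF g'(1)] lie_closed_c[OF g'(1)])
    have "A $ n = of_nat (Suc n) * Z $ Suc n + R"
      unfolding Z(4)[symmetric] dlog_def fps_sum_nth split
      by (simp add: R_def c1 del: c.simps funpow.simps(2) of_nat_Suc)
    then have "r (Suc n) * A $ n = r (Suc n) * of_nat (Suc n) * Z $ Suc n + r (Suc n) * R"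
      by (simp only: distrib_left mult.assoc)
    then have "Z $ Suc n - r (Suc n) * A $ n = - (r (Suc n) * R)"
      using r_inverse[of "Suc n"] n M by (simp del: of_nat_Suc)
    then show ?thesis
      using lie_closed_uminus[OF g'(1) lie_closed_r[OF g'(1) R]] by simp
  qed
  have Bn: "B $ Suc n \<in> g'" if n: "Suc n < N" for n
  proof -
    have "B $ Suc n = c (Suc n) * lie x ((lie x ^^ n) y)"
      using conj_exp_t_nth[OF g J(1,3) n] by (simp add: B_def)
    then show ?thesis
      using lie_closed_c[OF g'(1) g'(3)[OF x lie_closed_lie_power[OF g x y]]] by (simp only:)
  qed
  have "ev Z - (x + y) \<in> g'"
  proof (cases M)
    case 0
    then have "x = 0" "y = 0" using J_top[OF J(1)] J_top[OF J(3)] M by auto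
    moreover have "ev Z = 0" unfolding ev_def split using 0 Z(1) by simp
    ultimately show ?thesis using lie_closed_0[OF g'(1)] by simp
  next
    case (Suc M')
    have r1: "r (Suc 0) = 1" using r_inverse[of 1] M Suc by simp
    have B0: "B $ 0 = y" by (simp add: B_def exp_t_0)
    have "ev Z = (\<Sum>n<M. (Z $ Suc n - r (Suc n) * A $ n) + r (Suc n) * A $ n)"
      unfolding ev_def split using Z(1) by simp
    also have "\<dots> = (\<Sum>n<M. Z $ Suc n - r (Suc n) * A $ n) + (\<Sum>n<M. r (Suc n) * A $ n)"
      by (rule sum.distrib)
    \<comment> \<open>Only the constant coefficient \<open>x + y\<close> of \<open>A\<close> counts
      modulo \<open>g'\<close>; every higher coefficient of \<open>B\<close> is a bracket with
      \<open>x\<close>.\<close>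
    also have "(\<Sum>n<M. r (Suc n) * A $ n) = (x + y) + (\<Sum>n<M'. r (Suc (Suc n)) * B $ Suc n)"
      unfolding Suc sum.lessThan_Suc_shift by (simp add: A_def r1 B0)
    finally have "ev Z - (x + y) = (\<Sum>n<M. Z $ Suc n - r (Suc n) * A $ n) + (\<Sum>n<M'. r (Suc (Suc n)) * B $ Suc n)"
      by (simp add: algebra_simps)
    moreover have "\<dots> \<in> g'"
      by (intro lie_closed_add[OF g'(1)] lie_closed_sum[OF g'(1)] lie_closed_r[OF g'(1)] step Bn) (auto simp: M Suc)
    ultimately show ?thesis by simp
  qed
  with eq evg show ?thesis by blast
qed

section \<open>Injectivity of the exponential\<close>

lemma power_diff_J:
  assumes "x \<in> J 1" "y \<in> J 1" "x - y \<in> J k" shows "x ^ Suc m - y ^ Suc m \<in> J (k + m)"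
proof (induction m)
  case (Suc m)
  have "x ^ Suc (Suc m) - y ^ Suc (Suc m) = x * (x ^ Suc m - y ^ Suc m) + (x - y) * y ^ Suc m"
    by (simp add: algebra_simps)
  moreover have "x * (x ^ Suc m - y ^ Suc m) \<in> J (k + Suc m)"
    using J_mult[OF assms(1) Suc] by simp
  moreover have "(x - y) * y ^ Suc m \<in> J (k + Suc m)"
    using J_mult[OF assms(3) J_power[OF assms(2)]] .
  ultimately show ?case using J_add by metis
qed (use assms in simp)

text \<open>A bootstrap along the filtration: if \<open>x - y\<close> lies in \<open>J k\<close>
  with \<open>k > 0\<close>, the differences of squares and higher powers lie one step deeper, so
  equality of the exponentials forces the linear term \<open>x - y\<close> to do so too.\<close>

lemma ex_inj: "inj_on ex (J 1)"
proof (rule inj_onI)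
  fix x y assume x: "x \<in> J 1" and y: "y \<in> J 1" and e: "ex x = ex y"
  have "x - y \<in> J (Suc k)" for k
  proof (induction k)
    case 0
    show ?case using x y J_diff by simp
  next
    case (Suc k)
    show ?case
    proof (cases "N = 1")
      case True
      then have "x - y = 0" using J_top[OF Suc] by simp
      then show ?thesis using J_zero by simp
    next
      case False
      then obtain M where M: "N = Suc (Suc M)" using N_pos by (metis One_nat_def gr0_implies_Suc old.nat.exhaust)
      have c1: "c (Suc 0) = 1" using c_one M by simp
      have split: "(\<Sum>i<N. f i) = f 0 + (f 1 + (\<Sum>i<M. f (Suc (Suc i))))" for f :: "nat \<Rightarrow> 'a"
        by (simp only: M sum.lessThan_Suc_shift One_nat_def)
      have *: "ex v = 1 + v + (\<Sum>m<M. c (Suc (Suc m)) * v ^ Suc (Suc m))" for v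
        unfolding ex_def split using c1 by (simp add: add.assoc del: c.simps(2))
      have "x - y = - (\<Sum>m<M. c (Suc (Suc m)) * (x ^ Suc (Suc m) - y ^ Suc (Suc m)))"
        using e unfolding * by (simp add: right_diff_distrib sum_subtractf algebra_simps del: c.simps power_Suc)
      moreover have "c (Suc (Suc m)) * (x ^ Suc (Suc m) - y ^ Suc (Suc m)) \<in> J (Suc (Suc k))" for m
        using J_mult0[OF c_J power_diff_J[OF x y Suc, of "Suc m"]] J_antimono[of "Suc (Suc k)" "Suc k + Suc m"]
        by (auto simp del: c.simps power_Suc)
      ultimately show ?thesis using J_uminus J_sum by (metis (no_types, lifting))
    qed
  qed
  from J_top[OF this[of N]] show "x = y" by simp
qed

lemma ex_conj:
  assumes "v * u = 1" "u * v = 1"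
  shows "ex (u * x * v) = u * ex x * v"
proof -
  have "(u * x * v) ^ k = u * x ^ k * v" for k
  proof (induction k)
    case (Suc k)
    have "(u * x * v) ^ Suc k = (u * x * v) * (u * x ^ k * v)" by (simp only: power_Suc Suc)
    also have "\<dots> = u * x * (v * u) * x ^ k * v" by (simp only: mult.assoc)
    finally have "(u * x * v) ^ Suc k = u * x * (v * u) * x ^ k * v" .
    then show ?case by (simp add: assms mult.assoc)
  qed (simp add: assms)
  moreover have "c k * (u * w * v) = u * (c k * w) * v" for k w
    by (metis c_central mult.assoc)
  ultimately show ?thesis
    by (simp add: ex_def sum_distrib_left sum_distrib_right)
qed

end

section \<open>Triangular matrices of unbounded size\<close>

text \<open>Square matrices of a fixed size are not a type. The infinite upper triangular ones are, and form a
  ring; \<open>emb N d A\<close> below pads an \<open>N \<times> N\<close> matrix with the scalar \<open>d\<close>, so that \<open>emb N 1\<close> preserves the unit.\<close>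

typedef (overloaded) 'k tri = "{f :: nat \<Rightarrow> nat \<Rightarrow> 'k::zero. \<forall>i j. j < i \<longrightarrow> f i j = 0}"
  morphisms entry Tri
  by (rule exI[of _ "\<lambda>_ _. 0"]) simp

setup_lifting type_definition_tri

lemma entry_lower: "j < i \<Longrightarrow> entry a i j = 0"
  using entry[of a] by simp

lemma tri_eqI:
  assumes "\<And>i j. i \<le> j \<Longrightarrow> entry a i j = entry b i j" shows "a = b"
proof -
  have "entry a i j = entry b i j" for i j
    using assms entry_lower[of j i a] entry_lower[of j i b] by (cases "i \<le> j") auto
  then show ?thesis by (simp add: entry_inject[symmetric] fun_eq_iff)
qed

instantiation tri :: (comm_ring_1) ring_1
begin

lift_definition zero_tri :: "'a tri" is "\<lambda>_ _. 0" by simp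
lift_definition one_tri :: "'a tri" is "\<lambda>i j. if i = j then 1 else 0" by simp
lift_definition plus_tri :: "'a tri \<Rightarrow> 'a tri \<Rightarrow> 'a tri" is "\<lambda>f g i j. f i j + g i j" by simp
lift_definition minus_tri :: "'a tri \<Rightarrow> 'a tri \<Rightarrow> 'a tri" is "\<lambda>f g i j. f i j - g i j" by simp
lift_definition uminus_tri :: "'a tri \<Rightarrow> 'a tri" is "\<lambda>f i j. - f i j" by simp
lift_definition times_tri :: "'a tri \<Rightarrow> 'a tri \<Rightarrow> 'a tri"
  is "\<lambda>f g i j. \<Sum>k\<le>j. f i k * g k j"
  by (auto intro!: sum.neutral)

lemma entry_times_upto:
  assumes "j \<le> m" shows "entry (a * b) i j = (\<Sum>k\<le>m. entry a i k * entry b k j)"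
  unfolding times_tri.rep_eq
  by (rule sum.mono_neutral_left) (use assms in \<open>auto simp: entry_lower\<close>)

instance
proof
  fix a b c :: "'a tri"
  show "a * b * c = a * (b * c)"
  proof (rule tri_eqI)
    fix i j :: nat
    have "entry (a * b * c) i j = (\<Sum>k\<le>j. (\<Sum>l\<le>j. entry a i l * entry b l k) * entry c k j)"
      unfolding entry_times_upto[OF order_refl, of "a * b"] by (simp add: entry_times_upto[of _ j])
    also have "\<dots> = (\<Sum>l\<le>j. entry a i l * (\<Sum>k\<le>j. entry b l k * entry c k j))"
      by (simp add: sum_distrib_left sum_distrib_right mult.assoc) (rule sum.swap)
    also have "\<dots> = entry (a * (b * c)) i j"
      by (simp add: entry_times_upto[OF order_refl])
    finally show "entry (a * b * c) i j = entry (a * (b * c)) i j" .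
  qed
  show "1 * a = a" "a * 1 = a"
    by (intro tri_eqI; simp add: times_tri.rep_eq one_tri.rep_eq if_distrib[of "\<lambda>x. x * _"]
        if_distrib[of "\<lambda>x. _ * x"] sum.delta cong: if_cong)+
  show "(a + b) * c = a * c + b * c" "a * (b + c) = a * b + a * c"
    by (intro tri_eqI; simp add: times_tri.rep_eq plus_tri.rep_eq sum.distrib algebra_simps)+
  show "(0::'a tri) \<noteq> 1"
    by (metis one_tri.rep_eq zero_tri.rep_eq zero_neq_one)
qed (intro tri_eqI; simp add: plus_tri.rep_eq minus_tri.rep_eq uminus_tri.rep_eq zero_tri.rep_eq algebra_simps)+

end

section \<open>Scalars, the nilpotent filtration and the embedding of square matrices\<close>

lift_definition scal :: "'k::comm_ring_1 \<Rightarrow> 'k tri" is "\<lambda>a i j. if i = j then a else 0" by simp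

lemma entry_scal_times: "entry (scal a * f) i j = a * entry f i j"
  by (cases "i \<le> j") (simp_all add: times_tri.rep_eq scal.rep_eq if_distrib[of "\<lambda>x. x * _"] sum.delta' entry_lower cong: if_cong)

lemma entry_times_scal: "entry (f * scal a) i j = a * entry f i j"
  by (simp add: times_tri.rep_eq scal.rep_eq if_distrib[of "\<lambda>x. _ * x"] sum.delta mult.commute cong: if_cong)

lemma scal_mult: "scal a * scal b = scal (a * b)"
  by (intro tri_eqI) (simp add: entry_scal_times, simp add: scal.rep_eq)

lemma scal_one: "scal 1 = 1"
  by (intro tri_eqI) (simp add: scal.rep_eq one_tri.rep_eq)

lemma of_nat_tri: "(of_nat n :: 'k::comm_ring_1 tri) = scal (of_nat n)"
  by (induction n) (auto intro!: tri_eqI simp: scal.rep_eq zero_tri.rep_eq one_tri.rep_eq plus_tri.rep_eq)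

lemma entry_sum: "entry (sum f A) i j = (\<Sum>k\<in>A. entry (f k) i j)"
  by (induction A rule: infinite_finite_induct) (simp_all add: zero_tri.rep_eq plus_tri.rep_eq)

text \<open>Matrices supported in the first \<open>N\<close> columns, on and above the
  \<open>n\<close>-th superdiagonal. For \<open>n = 0\<close> the diagonal outside the block is left
  free as well, since \<open>1\<close> and the scalars have to belong to \<open>J 0\<close>.\<close>

definition tri_filt :: "nat \<Rightarrow> nat \<Rightarrow> 'k::comm_ring_1 tri set" where
  "tri_filt N n = {f. \<forall>i j. j < i + n \<or> (N \<le> j \<and> (n = 0 \<longrightarrow> i \<noteq> j)) \<longrightarrow> entry f i j = 0}"

definition tri_r :: "nat \<Rightarrow> 'k::field tri" where
  "tri_r m = scal (1 / of_nat m)"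

definition uptri :: "nat \<Rightarrow> 'k::field mat set" where
  "uptri N = {A \<in> carrier_mat N N. \<forall>i<N. \<forall>j<i. A $$ (i, j) = 0}"

definition emb :: "nat \<Rightarrow> 'k \<Rightarrow> 'k::field mat \<Rightarrow> 'k tri" where
  "emb N d A = Tri (\<lambda>i j. if j < N \<and> i \<le> j then A $$ (i, j) else if i = j then d else 0)"

lemma entry_emb:
  "entry (emb N d A) i j = (if j < N \<and> i \<le> j then A $$ (i, j) else if i = j then d else 0)"
  unfolding emb_def by (subst Tri_inverse) auto

lemma uptri_carrier: "A \<in> uptri N \<Longrightarrow> A \<in> carrier_mat N N"
  by (simp add: uptri_def)

lemma uptri_mult_entry:
  assumes "A \<in> uptri N" "B \<in> uptri N" "i < N" "j < N"
  shows "(A * B) $$ (i, j) = (\<Sum>k\<le>j. A $$ (i, k) * B $$ (k, j))"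
proof -
  have "(A * B) $$ (i, j) = (\<Sum>k<N. A $$ (i, k) * B $$ (k, j))"
    using assms by (auto simp: uptri_def scalar_prod_def atLeast0LessThan)
  also have "\<dots> = (\<Sum>k\<le>j. A $$ (i, k) * B $$ (k, j))"
    by (rule sum.mono_neutral_right) (use assms in \<open>auto simp: uptri_def\<close>)
  finally show ?thesis .
qed

lemma uptri_mult: "A \<in> uptri N \<Longrightarrow> B \<in> uptri N \<Longrightarrow> A * B \<in> uptri N"
  using uptri_mult_entry[of A N B]
  unfolding uptri_def by (auto intro!: sum.neutral)

lemma uptri_one: "1\<^sub>m N \<in> uptri N"
  by (auto simp: uptri_def)

lemma uptri_power: "A \<in> uptri N \<Longrightarrow> A ^\<^sub>m k \<in> uptri N"
  by (induction k) (auto simp: uptri_mult uptri_one uptri_carrier[THEN carrier_matD(1)])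

lemma ut_uptri: "A \<in> ut N \<Longrightarrow> A \<in> uptri N"
  by (auto simp: ut_def uptri_def)

lemma emb_mult:
  assumes "A \<in> uptri N" "B \<in> uptri N" shows "emb N d A * emb N d' B = emb N (d * d') (A * B)"
proof (rule tri_eqI)
  fix i j :: nat assume ij: "i \<le> j"
  show "entry (emb N d A * emb N d' B) i j = entry (emb N (d * d') (A * B)) i j"
  proof (cases "j < N")
    case True
    have "(\<Sum>k\<le>j. entry (emb N d A) i k * entry (emb N d' B) k j) = (\<Sum>k\<le>j. A $$ (i, k) * B $$ (k, j))"
      by (rule sum.cong) (use True ij assms in \<open>auto simp: entry_emb uptri_def\<close>)
    then show ?thesis using True ij assms uptri_mult_entry[OF assms, of i j]
      by (simp add: times_tri.rep_eq) (simp add: entry_emb)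
  next
    case False
    have "(\<Sum>k\<le>j. entry (emb N d A) i k * entry (emb N d' B) k j)
        = (\<Sum>k\<le>j. if k = j then entry (emb N d A) i j * d' else 0)"
      by (rule sum.cong) (use False in \<open>auto simp: entry_emb\<close>)
    then show ?thesis using False ij
      by (simp add: times_tri.rep_eq) (simp add: entry_emb)
  qed
qed

lemma emb_add: "A \<in> carrier_mat N N \<Longrightarrow> B \<in> carrier_mat N N \<Longrightarrow> emb N d A + emb N d' B = emb N (d + d') (A + B)"
  by (intro tri_eqI) (auto simp: plus_tri.rep_eq entry_emb)

lemma emb_diff: "A \<in> carrier_mat N N \<Longrightarrow> B \<in> carrier_mat N N \<Longrightarrow> emb N d A - emb N d' B = emb N (d - d') (A - B)"
  by (intro tri_eqI) (auto simp: minus_tri.rep_eq entry_emb)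

lemma emb_smult: "A \<in> carrier_mat N N \<Longrightarrow> scal a * emb N d A = emb N (a * d) (a \<cdot>\<^sub>m A)"
  by (intro tri_eqI) (auto simp: entry_scal_times entry_emb)

lemma emb_uminus: "A \<in> carrier_mat N N \<Longrightarrow> - emb N d A = emb N (- d) (- A)"
  by (intro tri_eqI) (auto simp: uminus_tri.rep_eq entry_emb)

lemma emb_one: "emb N 1 (1\<^sub>m N) = 1"
  by (intro tri_eqI) (auto simp: one_tri.rep_eq entry_emb)

lemma emb_power: "A \<in> uptri N \<Longrightarrow> emb N d A ^ k = emb N (d ^ k) (A ^\<^sub>m k)"
proof (induction k)
  case 0
  then show ?case by (simp add: emb_one uptri_carrier[THEN carrier_matD(1)])
next
  case (Suc k)
  have "emb N d A ^ Suc k = emb N d A ^ k * emb N d A" by (rule power_Suc2)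
  also have "\<dots> = emb N (d ^ k * d) (A ^\<^sub>m k * A)"
    using Suc by (simp add: emb_mult uptri_power)
  finally show ?case by (simp add: mult.commute)
qed

lemma emb_inj:
  assumes "A \<in> uptri N" "B \<in> uptri N" "emb N d A = emb N d B" shows "A = B"
proof (rule eq_matI)
  fix i j assume ij: "i < dim_row B" "j < dim_col B"
  have N: "dim_row A = N" "dim_col A = N" "dim_row B = N" "dim_col B = N"
    using assms(1,2) by (auto simp: uptri_def)
  show "A $$ (i, j) = B $$ (i, j)"
  proof (cases "i \<le> j")
    case True
    then show ?thesis using arg_cong[OF assms(3), of "\<lambda>a. entry a i j"] ij N by (simp add: entry_emb)
  next
    case False
    then show ?thesis using assms(1,2) ij N by (simp add: uptri_def)
  qed
qed (use assms(1,2) in \<open>auto simp: uptri_def\<close>)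

lemma nilpotent_exp_tri:
  assumes "N \<ge> 1" "CHAR('k::field) \<ge> N"
  shows "nilpotent_exp N (tri_filt N) (tri_r :: nat \<Rightarrow> 'k tri)"
proof
  fix a b :: "'k tri" and m n :: nat
  show "0 \<in> (tri_filt N n :: 'k tri set)" by (simp add: tri_filt_def zero_tri.rep_eq)
  show "a + b \<in> tri_filt N n" if "a \<in> tri_filt N n" "b \<in> tri_filt N n"
    using that by (simp add: tri_filt_def plus_tri.rep_eq)
  show "- a \<in> tri_filt N n" if "a \<in> tri_filt N n"
    using that by (simp add: tri_filt_def uminus_tri.rep_eq)
  show "(1 :: 'k tri) \<in> tri_filt N 0" by (simp add: tri_filt_def one_tri.rep_eq)
  show "tri_filt N n \<subseteq> (tri_filt N m :: 'k tri set)" if "m \<le> n"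
    using that by (auto simp: tri_filt_def)
  show "a = 0" if "a \<in> tri_filt N n" "n \<ge> N"
  proof (rule tri_eqI)
    fix i j
    show "entry a i j = entry 0 i j"
      using that assms(1) by (cases "j < N") (auto simp: tri_filt_def zero_tri.rep_eq)
  qed
  show "tri_r m * a = a * tri_r m"
    by (intro tri_eqI) (simp add: tri_r_def entry_scal_times entry_times_scal)
  show "(tri_r m :: 'k tri) \<in> tri_filt N 0"
    by (simp add: tri_filt_def tri_r_def scal.rep_eq)
  show "N > 0" using assms by simp
  show "tri_r m * of_nat m = (1 :: 'k tri)" if "0 < m" "m < N"
  proof -
    \<comment> \<open>The place where the bound on the characteristic enters: it cannot divide a
      positive \<open>m < N\<close>.\<close>
    have "(of_nat m :: 'k) \<noteq> 0"
      using that assms by (auto simp: of_nat_eq_0_iff_char_dvd dest: dvd_imp_le)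
    then show ?thesis by (simp add: tri_r_def of_nat_tri scal_mult scal_one)
  qed
  show "a * b \<in> tri_filt N (m + n)" if "a \<in> tri_filt N m" "b \<in> tri_filt N n"
    unfolding tri_filt_def
  proof (intro CollectI allI impI)
    fix i j assume ij: "j < i + (m + n) \<or> (N \<le> j \<and> (m + n = 0 \<longrightarrow> i \<noteq> j))"
    have "entry a i k * entry b k j = 0" if "k \<le> j" for k
    proof (rule ccontr)
      assume "entry a i k * entry b k j \<noteq> 0"
      then have "entry a i k \<noteq> 0" "entry b k j \<noteq> 0" by auto
      then have "i + m \<le> k" "N \<le> k \<longrightarrow> m = 0 \<and> i = k" "k + n \<le> j" "N \<le> j \<longrightarrow> n = 0 \<and> k = j"
        using \<open>a \<in> _\<close> \<open>b \<in> _\<close> unfolding tri_filt_def by (force simp: not_less)+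
      with ij show False by auto
    qed
    then show "entry (a * b) i j = 0" unfolding times_tri.rep_eq by (intro sum.neutral) simp
  qed
qed

lemma emb_ut_filt: "A \<in> ut N \<Longrightarrow> emb N 0 A \<in> tri_filt N 1"
  by (auto simp: tri_filt_def entry_emb ut_def)

section \<open>The exponential map of a matrix Lie algebra\<close>

locale matrix_lie_algebra =
  fixes N :: nat and g :: "'k::field mat set"
  assumes N1: "N \<ge> 1" and char: "CHAR('k) \<ge> N" and g: "lie_subalgebra N g (ut N)"
begin

sublocale tri: nilpotent_exp N "tri_filt N" "tri_r :: nat \<Rightarrow> 'k tri"
  by (rule nilpotent_exp_tri[OF N1 char])

abbreviation E :: "'k mat \<Rightarrow> 'k mat" where "E \<equiv> mat_exp N"
text \<open>Two paddings are used side by side: 0 puts Lie algebra elements into the nilpotent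
  ideal, and 1 is what the exponential makes of that 0 for group elements.\<close>

abbreviation em :: "'k mat \<Rightarrow> 'k tri" where "em \<equiv> emb N 0"
abbreviation eu :: "'k mat \<Rightarrow> 'k tri" where "eu \<equiv> emb N 1"

lemma g_ut: "x \<in> g \<Longrightarrow> x \<in> ut N"
  and g_carrier: "x \<in> g \<Longrightarrow> x \<in> carrier_mat N N"
  and g_zero: "0\<^sub>m N N \<in> g"
  and g_add: "x \<in> g \<Longrightarrow> y \<in> g \<Longrightarrow> x + y \<in> g"
  and g_smult: "x \<in> g \<Longrightarrow> a \<cdot>\<^sub>m x \<in> g"
  and g_bracket: "x \<in> g \<Longrightarrow> y \<in> g \<Longrightarrow> bracket x y \<in> g"
  using g unfolding lie_subalgebra_def mat_subspace_def by blast+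

lemma g_uptri: "x \<in> g \<Longrightarrow> x \<in> uptri N"
  using g_ut ut_uptri by blast

lemma g_uminus:
  assumes "x \<in> g" shows "- x \<in> g"
proof -
  have "- x = (-1) \<cdot>\<^sub>m x" by auto
  then show ?thesis using g_smult[OF assms] by metis
qed

lemma c_scal: "tri.c k = scal (1 / of_nat (fact k))"
proof (induction k)
  case (Suc k)
  have "tri.c (Suc k) = tri_r (Suc k) * scal (1 / of_nat (fact k))" by (simp only: tri.c.simps(2) Suc)
  also have "\<dots> = scal (1 / of_nat (fact (Suc k)))" by (simp add: tri_r_def scal_mult mult.commute distrib_left)
  finally show ?case .
qed (simp add: scal_one)

lemma exp_uptri: "x \<in> ut N \<Longrightarrow> E x \<in> uptri N"
  using uptri_power[OF ut_uptri, of x N] unfolding uptri_def mat_exp_def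
  by (auto intro!: sum.neutral)

lemma emb_exp:
  assumes "x \<in> ut N" shows "eu (E x) = tri.ex (em x)"
proof (rule tri_eqI)
  fix i j :: nat assume ij: "i \<le> j"
  have "entry (tri.ex (em x)) i j = (\<Sum>k<N. 1 / of_nat (fact k) * entry (emb N (0 ^ k) (x ^\<^sub>m k)) i j)"
    unfolding tri.ex_def entry_sum c_scal entry_scal_times emb_power[OF ut_uptri[OF assms]] ..
  also have "\<dots> = entry (eu (E x)) i j"
  proof (cases "j < N")
    case True
    then show ?thesis using ij by (simp add: entry_emb mat_exp_def)
  next
    case False
    \<comment> \<open>Outside the block the powers show only their padding \<open>0 ^ k\<close>, so
      the constant term alone remains.\<close>
    have "(\<Sum>k<N. 1 / of_nat (fact k) * entry (emb N (0 ^ k) (x ^\<^sub>m k)) i j)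
      = (\<Sum>k<N. if k = 0 then (if i = j then 1 else 0) else 0)"
      by (rule sum.cong) (use False in \<open>auto simp: entry_emb\<close>)
    then show ?thesis using False N1 by (simp add: entry_emb)
  qed
  finally show "entry (eu (E x)) i j = entry (tri.ex (em x)) i j" ..
qed

lemma em_bracket:
  assumes "x \<in> ut N" "y \<in> ut N" shows "em (bracket x y) = lie (em x) (em y)"
  using assms[THEN ut_uptri] uptri_mult[of x N y] uptri_mult[of y N x]
  by (simp add: lie_def bracket_def emb_mult emb_diff[OF uptri_carrier uptri_carrier, where d = 0 and d' = 0, simplified])

lemma em_closed: "tri.lie_closed (em ` g)"
  unfolding tri.lie_closed_def
proof (intro conjI ballI allI)
  show "em ` g \<subseteq> tri_filt N 1" using emb_ut_filt g_ut by blast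
  have "em (0\<^sub>m N N) = 0"
    by (intro tri_eqI) (simp add: entry_emb zero_tri.rep_eq)
  then show "0 \<in> em ` g" using g_zero by (metis imageI)
next
  fix u v assume "u \<in> em ` g" "v \<in> em ` g"
  then obtain x y where xy: "x \<in> g" "y \<in> g" "u = em x" "v = em y" by blast
  show "u + v \<in> em ` g"
    using emb_add[of x N y 0 0] xy g_carrier g_add by simp
  show "lie u v \<in> em ` g"
    using em_bracket[of x y] xy g_ut g_bracket by (metis imageI)
next
  fix u assume "u \<in> em ` g"
  then obtain x where x: "x \<in> g" "u = em x" by blast
  show "- u \<in> em ` g"
    using emb_uminus[of x N 0] x g_carrier g_uminus by simp
  show "tri_r m * u \<in> em ` g" for m
    using emb_smult[of x N "1 / of_nat m" 0] x g_carrier g_smult by (simp add: tri_r_def)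
qed

lemma exp_uminus:
  assumes "x \<in> g" shows "E (- x) * E x = 1\<^sub>m N"
proof -
  have up: "E x \<in> uptri N" "E (- x) \<in> uptri N"
    using assms exp_uptri g_ut g_uminus by blast+
  have "eu (E (- x) * E x) = tri.ex (- em x) * tri.ex (em x)"
    using emb_mult[OF up(2,1), where d = 1 and d' = 1] assms g_uminus emb_uminus[of x N 0] g_carrier
    by (simp add: emb_exp g_ut)
  also have "\<dots> = eu (1\<^sub>m N)"
    using tri.ex_uminus[OF emb_ut_filt[OF g_ut[OF assms]]] by (simp add: emb_one)
  finally show ?thesis by (rule emb_inj[OF uptri_mult[OF up(2,1)] uptri_one])
qed

lemma exp_inj: "inj_on E (ut N)"
proof (rule inj_onI)
  fix x y assume x: "x \<in> ut N" and y: "y \<in> ut N" and e: "E x = E y"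
  then have "tri.ex (em x) = tri.ex (em y)" using emb_exp by metis
  then have "em x = em y" using tri.ex_inj emb_ut_filt x y by (meson inj_onD)
  then show "x = y" using emb_inj ut_uptri x y by blast
qed

lemma emb_conj:
  assumes x: "x \<in> g" and y: "y \<in> uptri N"
  shows "emb N d (E x * y * E (- x)) = tri.ex (em x) * emb N d y * tri.ex (- em x)"
proof -
  have up: "E x \<in> uptri N" "E (- x) \<in> uptri N"
    using x exp_uptri g_ut g_uminus by blast+
  have "emb N d (E x * y * E (- x)) = eu (E x) * emb N d y * eu (E (- x))"
    using emb_mult[OF up(1) y, where d = 1] emb_mult[OF uptri_mult[OF up(1) y] up(2), where d' = 1] by simp
  then show ?thesis
    using x g_uminus emb_uminus[of x N 0] g_carrier by (simp add: emb_exp g_ut)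
qed

lemma exp_conj_uptri: "x \<in> g \<Longrightarrow> y \<in> uptri N \<Longrightarrow> E x * y * E (- x) \<in> uptri N"
  by (intro uptri_mult exp_uptri g_ut g_uminus)

lemma conj_in:
  assumes "x \<in> g" "y \<in> g" shows "E x * y * E (- x) \<in> g"
proof -
  have "em (E x * y * E (- x)) \<in> em ` g"
    unfolding emb_conj[OF assms(1) g_uptri[OF assms(2)]]
    by (intro tri.conj_ex_in[OF em_closed] imageI assms)
  then obtain z where z: "z \<in> g" "em (E x * y * E (- x)) = em z" by blast
  with emb_inj[OF exp_conj_uptri[OF assms(1) g_uptri[OF assms(2)]] g_uptri[OF z(1)], of 0]
  show ?thesis by metis
qed

lemma exp_conj:
  assumes x: "x \<in> g" and y: "y \<in> g"
  shows "E (E x * y * E (- x)) = E x * E y * E (- x)"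
proof -
  have *: "tri.ex (- em x) * tri.ex (em x) = 1" "tri.ex (em x) * tri.ex (- em x) = 1"
    using tri.ex_uminus[OF emb_ut_filt[OF g_ut[OF x]]]
      tri.ex_uminus[OF tri.J_uminus[OF emb_ut_filt[OF g_ut[OF x]]]] by (simp_all only: minus_minus)
  have "eu (E (E x * y * E (- x))) = tri.ex (em (E x * y * E (- x)))"
    using conj_in[OF assms] emb_exp g_ut by blast
  also have "\<dots> = tri.ex (em x) * tri.ex (em y) * tri.ex (- em x)"
    unfolding emb_conj[OF x g_uptri[OF y]] by (rule tri.ex_conj[OF *])
  also have "\<dots> = eu (E x * E y * E (- x))"
    unfolding emb_conj[OF x exp_uptri[OF g_ut[OF y]]] emb_exp[OF g_ut[OF y]] ..
  finally show ?thesis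
    by (rule emb_inj[OF exp_uptri[OF g_ut[OF conj_in[OF assms]]] exp_conj_uptri[OF x exp_uptri[OF g_ut[OF y]]]])
qed

lemma conj_fixes_form_iff:
  fixes l :: "'k mat \<Rightarrow> 'b::ab_group_add"
  assumes x: "x \<in> g" and l: "\<And>y z. y \<in> g \<Longrightarrow> z \<in> g \<Longrightarrow> l (y + z) = l y + l z"
  shows "(\<forall>y\<in>g. l (E x * y * E (- x)) = l y) \<longleftrightarrow> (\<forall>y\<in>g. l (bracket x y) = 0)"
proof -
  \<comment> \<open>The form is carried over to the image of \<open>em\<close>; the abstract
    criterion asks for additivity there and nothing more.\<close>
  define l' where "l' v = l (inv_into g em v)" for v
  have inj: "inj_on em g"
    using emb_inj g_uptri by (meson inj_onI)
  have l': "l' (em y) = l y" if "y \<in> g" for y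
    using inv_into_f_f[OF inj that] by (simp add: l'_def)
  have "l' (u + v) = l' u + l' v" if "u \<in> em ` g" "v \<in> em ` g" for u v
  proof -
    obtain y z where yz: "y \<in> g" "z \<in> g" "u = em y" "v = em z" using \<open>u \<in> _\<close> \<open>v \<in> _\<close> by blast
    then have "u + v = em (y + z)" using emb_add[of y N z 0 0] g_carrier by simp
    then show ?thesis using yz l l' g_add by simp
  qed
  from tri.conj_ex_fixes_form_iff[OF em_closed, of "em x" l', OF _ this] x
  have "(\<forall>y\<in>g. l' (tri.ex (em x) * em y * tri.ex (- em x)) = l' (em y)) \<longleftrightarrow> (\<forall>y\<in>g. l' (lie (em x) (em y)) = 0)"
    by simp
  moreover have "l' (tri.ex (em x) * em y * tri.ex (- em x)) = l (E x * y * E (- x))" if "y \<in> g" for y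
    using that emb_conj[OF x g_uptri[OF that], of 0] l' conj_in[OF x that] by metis
  moreover have "l' (lie (em x) (em y)) = l (bracket x y)" if "y \<in> g" for y
    using that em_bracket[OF g_ut[OF x] g_ut[OF that]] l' g_bracket[OF x that] by metis
  ultimately show ?thesis using l' by simp
qed

lemma exp_zero: "E (0\<^sub>m N N) = 1\<^sub>m N"
proof -
  have z: "0\<^sub>m N N \<in> ut N" by (simp add: ut_def)
  have "em (0\<^sub>m N N) = 0"
    by (intro tri_eqI) (simp add: entry_emb zero_tri.rep_eq)
  moreover have "tri.ex 0 = (\<Sum>k<N. if k = 0 then 1 else 0)"
    unfolding tri.ex_def by (rule sum.cong) (auto simp: power_0_left)
  ultimately have "eu (E (0\<^sub>m N N)) = eu (1\<^sub>m N)"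
    unfolding emb_exp[OF z] emb_one using N1 by simp
  then show ?thesis by (rule emb_inj[OF exp_uptri[OF z] uptri_one])
qed

end

context matrix_lie_algebra
begin

text \<open>With \<open>k = g\<close> this is closure of the exponentials under products. Applied to
  a polarization, with \<open>k\<close> the kernel of the form on it, it yields that the form
  defines a character of the group.\<close>

lemma exp_mult_closed_mod:
  assumes k: "lie_subalgebra N k g" and gk: "\<And>u v. u \<in> g \<Longrightarrow> v \<in> g \<Longrightarrow> bracket u v \<in> k"
    and x: "x \<in> g" and y: "y \<in> g"
  shows "\<exists>z\<in>g. E x * E y = E z \<and> z - (x + y) \<in> k"
proof -
  have kg: "k \<subseteq> g" using k by (simp add: lie_subalgebra_def)
  have "lie_subalgebra N k (ut N)" using k g unfolding lie_subalgebra_def by blast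
  then interpret k: matrix_lie_algebra N k using N1 char by unfold_locales
  have "lie u v \<in> em ` k" if uv: "u \<in> em ` g" "v \<in> em ` g" for u v
  proof -
    obtain a b where ab: "a \<in> g" "b \<in> g" "u = em a" "v = em b" using uv by blast
    then show ?thesis using em_bracket[of a b] g_ut gk by (metis imageI)
  qed
  then obtain w where w: "w \<in> em ` g" "tri.ex (em x) * tri.ex (em y) = tri.ex w" "w - (em x + em y) \<in> em ` k"
    using tri.ex_mult_closed_mod[OF em_closed k.em_closed, of "em x" "em y"] kg x y by blast
  then obtain z u where z: "z \<in> g" "w = em z" and u: "u \<in> k" "em z - (em x + em y) = em u" by blast
  have up: "E x \<in> uptri N" "E y \<in> uptri N" "E z \<in> uptri N"
    using x y z exp_uptri g_ut by blast+
  have "eu (E x * E y) = eu (E z)"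
    using z w x y by (simp add: emb_mult[OF up(1,2), where d = 1 and d' = 1, simplified, symmetric] emb_exp g_ut)
  from emb_inj[OF uptri_mult[OF up(1,2)] up(3) this] have e: "E x * E y = E z" .
  have c: "x \<in> carrier_mat N N" "y \<in> carrier_mat N N" "z \<in> carrier_mat N N" using x y z g_carrier by auto
  have "em (z - (x + y)) = em u"
    using u(2) emb_add[OF c(1,2), of 0 0] emb_diff[OF c(3), of "x + y" 0 0] c by simp
  moreover have "z - (x + y) \<in> uptri N"
    using g_uptri[OF x] g_uptri[OF y] g_uptri[OF z(1)] by (auto simp: uptri_def)
  ultimately have "z - (x + y) = u"
    using emb_inj[OF _ k.g_uptri[OF u(1)]] by blast
  then show ?thesis using e z u by blast
qed

lemma exp_mult_closed:
  assumes "x \<in> g" "y \<in> g" shows "\<exists>z\<in>g. E x * E y = E z"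
proof -
  have "lie_subalgebra N g g" using g by (simp add: lie_subalgebra_def)
  then show ?thesis using exp_mult_closed_mod g_bracket assms by blast
qed

end

section \<open>Complex vector spaces\<close>

interpretation complex_vector_pair:
  vector_space_pair "scaleC :: complex \<Rightarrow> 'v \<Rightarrow> 'v::complex_vector"
    "scaleC :: complex \<Rightarrow> 'w \<Rightarrow> 'w::complex_vector" ..

lemma scaleC_fun_apply [simp]: "(a *\<^sub>C f) x = a *\<^sub>C f x"
  by (simp add: scaleC_fun_def)

lemma scaleC_complex [simp]: "a *\<^sub>C (z::complex) = a * z"
  by (simp add: scaleC_complex_def)

lemma sum_fun_apply: "(\<Sum>i\<in>A. f i) x = (\<Sum>i\<in>A. f i x)" for f :: "'i \<Rightarrow> 'a \<Rightarrow> 'b::ab_group_add"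
  by (induction A rule: infinite_finite_induct) auto

lemma complex_vector_basis:
  fixes V :: "'v::complex_vector set"
  assumes "complex_vector.subspace V"
  obtains B where "B \<subseteq> V" "complex_vector.independent B" "complex_vector.span B = V"
    "card B = complex_vector.dim V"
  using complex_vector.basis_exists[of V] complex_vector.span_subspace assms by metis

text \<open>Representations live on subspaces, so their maps are linear only there. Extending from a
  basis of \<open>V\<close> makes the theory of globally linear maps applicable.\<close>

lemma linear_on_extend:
  fixes f :: "'v::complex_vector \<Rightarrow> 'w::complex_vector"
  assumes V: "complex_vector.subspace V" and f: "linear_on V f"
  obtains g where "Vector_Spaces.linear scaleC scaleC g" "\<And>v. v \<in> V \<Longrightarrow> g v = f v"
proof -
  obtain B where B: "B \<subseteq> V" "complex_vector.independent B" "complex_vector.span B = V"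
    using complex_vector_basis[OF V] by blast
  obtain g where g: "Vector_Spaces.linear scaleC scaleC g" "\<forall>x\<in>B. g x = f x"
    using complex_vector_pair.linear_independent_extend[OF B(2)] by blast
  have f0: "f 0 = 0"
  proof -
    have "f (0 *\<^sub>C 0) = 0 *\<^sub>C f 0"
      using f complex_vector.subspace_0[OF V] unfolding linear_on_def by blast
    then show ?thesis by simp
  qed
  have "v \<in> V \<and> g v = f v" if "v \<in> complex_vector.span B" for v
    using that
  proof (induction rule: complex_vector.span_induct_alt)
    case base
    show ?case using f0 complex_vector.subspace_0[OF V] complex_vector_pair.linear_0[OF g(1)] by simp
  next
    case (step c x y)
    then have x: "x \<in> V" "c *\<^sub>C x \<in> V" using B(1) complex_vector.subspace_scale[OF V] by auto
    have "f (c *\<^sub>C x + y) = c *\<^sub>C f x + f y"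
      using f x step unfolding linear_on_def by simp
    moreover have "g (c *\<^sub>C x + y) = c *\<^sub>C g x + g y"
      using complex_vector_pair.linear_add[OF g(1)] complex_vector_pair.linear_scale[OF g(1)] by simp
    ultimately show ?case using step g x complex_vector.subspace_add[OF V] by simp
  qed
  with g B that show ?thesis by metis
qed

text \<open>\<open>dim\<close> is the cardinality of a basis and hence 0 for infinite-dimensional
  spaces; arguments that compare dimensions need finiteness separately.\<close>

definition fin_dim :: "'v::complex_vector set \<Rightarrow> bool" where
  "fin_dim V \<longleftrightarrow> (\<exists>B. finite B \<and> V \<subseteq> complex_vector.span B)"

lemma fin_dim_subset: "fin_dim V \<Longrightarrow> W \<subseteq> V \<Longrightarrow> fin_dim W"
  unfolding fin_dim_def by blast

lemma fin_dim_independent_finite: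
  "fin_dim V \<Longrightarrow> B \<subseteq> V \<Longrightarrow> complex_vector.independent B \<Longrightarrow> finite B"
  unfolding fin_dim_def using complex_vector.independent_span_bound by blast

lemma fin_dim_dim_less:
  assumes V: "fin_dim V" and W: "complex_vector.subspace W" "W \<subseteq> V" "W \<noteq> V"
    and sV: "complex_vector.subspace V"
  shows "complex_vector.dim W < complex_vector.dim V"
proof -
  obtain B where B: "B \<subseteq> W" "complex_vector.independent B" "complex_vector.span B = W"
    "card B = complex_vector.dim W" by (rule complex_vector_basis[OF W(1)])
  obtain v where v: "v \<in> V" "v \<notin> W" using W by blast
  have i: "complex_vector.independent (insert v B)"
    using complex_vector.independent_insertI[of v B] B v by blast
  have fB: "finite B" using fin_dim_independent_finite[OF V _ B(2)] B W by blast
  have vB: "v \<notin> B" using v B by blast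
  obtain C where C: "insert v B \<subseteq> C" "C \<subseteq> V" "complex_vector.independent C" "V \<subseteq> complex_vector.span C"
    using complex_vector.maximal_independent_subset_extend[of "insert v B" V] i v B W by blast
  have "card C = complex_vector.dim V"
    using complex_vector.basis_card_eq_dim C by blast
  moreover have "card (insert v B) \<le> card C"
    using C fin_dim_independent_finite[OF V C(2,3)] by (intro card_mono)
  ultimately show ?thesis using fB vB B by simp
qed

lemma linear_on_inj_image:
  fixes f :: "'v::complex_vector \<Rightarrow> 'w::complex_vector"
  assumes V: "complex_vector.subspace V" and f: "linear_on V f" and inj: "inj_on f V"
  shows "complex_vector.dim (f ` V) = complex_vector.dim V"
    and "fin_dim (f ` V) \<Longrightarrow> fin_dim V"
    and "complex_vector.subspace (f ` V)"
proof -
  obtain g where g: "Vector_Spaces.linear scaleC scaleC g" "\<And>v. v \<in> V \<Longrightarrow> g v = f v"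
    using linear_on_extend[OF V f] by blast
  obtain B where B: "B \<subseteq> V" "complex_vector.independent B" "complex_vector.span B = V"
    "card B = complex_vector.dim V" by (rule complex_vector_basis[OF V])
  have injg: "inj_on g V" using inj g(2) by (simp add: inj_on_def)
  have img: "g ` V = f ` V" using g(2) by auto
  have i: "complex_vector.independent (g ` B)"
    using complex_vector_pair.linear_independent_injective_image[OF g(1) B(2)] injg B(3) by simp
  have sp: "complex_vector.span (g ` B) = f ` V"
    using complex_vector_pair.linear_span_image[OF g(1)] B(3) img by metis
  have injB: "inj_on g B" using injg B(1) inj_on_subset by blast
  show "complex_vector.dim (f ` V) = complex_vector.dim V"
    using complex_vector.dim_span_eq_card_independent[OF i] sp card_image[OF injB] B(4) by simp
  show "complex_vector.subspace (f ` V)" using sp by (metis complex_vector.subspace_span)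
  assume "fin_dim (f ` V)"
  then have "finite (g ` B)"
    using fin_dim_independent_finite[OF _ _ i] img B(1) by blast
  then have "finite B" using injB finite_image_iff by blast
  then show "fin_dim V" using B(3) unfolding fin_dim_def by blast
qed

lemma fin_dim_finite_support:
  assumes "finite X" shows "fin_dim {f :: 'x \<Rightarrow> complex. \<forall>x. x \<notin> X \<longrightarrow> f x = 0}"
proof -
  define d where "d x = (\<lambda>y. if y = x then 1 else 0 :: complex)" for x :: 'x
  have "f \<in> complex_vector.span (d ` X)" if "\<forall>x. x \<notin> X \<longrightarrow> f x = 0" for f :: "'x \<Rightarrow> complex"
  proof -
    have "f = (\<Sum>x\<in>X. f x *\<^sub>C d x)"
      using assms that by (auto simp: fun_eq_iff sum_fun_apply d_def if_distrib cong: if_cong)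
    also have "\<dots> \<in> complex_vector.span (d ` X)"
      by (intro complex_vector.span_sum complex_vector.span_scale complex_vector.span_base imageI)
    finally show ?thesis .
  qed
  then show ?thesis unfolding fin_dim_def using assms by blast
qed

text \<open>\<open>K\<close> is the matrix of a projection onto \<open>F\<close>, whose rank is its trace.\<close>

lemma dim_reproducing_kernel:
  fixes F :: "('x \<Rightarrow> complex) set"
  assumes F: "complex_vector.subspace F" and X: "finite X"
    and supp: "\<And>k x. k \<in> F \<Longrightarrow> x \<notin> X \<Longrightarrow> k x = 0"
    and KF: "\<And>y. y \<in> X \<Longrightarrow> (\<lambda>x. K x y) \<in> F"
    and rep: "\<And>k x. k \<in> F \<Longrightarrow> x \<in> X \<Longrightarrow> k x = (\<Sum>y\<in>X. K x y * k y)"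
  shows "of_nat (complex_vector.dim F) = (\<Sum>x\<in>X. K x x)"
proof -
  obtain B where B: "B \<subseteq> F" "complex_vector.independent B" "complex_vector.span B = F"
    "card B = complex_vector.dim F" by (rule complex_vector_basis[OF F])
  have "fin_dim F"
    by (rule fin_dim_subset[OF fin_dim_finite_support[OF X]]) (use supp in auto)
  then have fB: "finite B" using fin_dim_independent_finite B by blast
  define a where "a y = complex_vector.representation B (\<lambda>x. K x y)" for y
  have K: "K x y = (\<Sum>b\<in>B. a y b * b x)" if "y \<in> X" for x y
  proof -
    have "(\<Sum>b\<in>B. a y b *\<^sub>C b) = (\<lambda>x. K x y)"
      unfolding a_def using B KF[OF that] fB by (intro complex_vector.sum_representation_eq) auto
    from fun_cong[OF this, of x] show ?thesis by (simp add: sum_fun_apply)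
  qed
  \<comment> \<open>These numbers are the diagonal entries of the projection in the basis
    \<open>B\<close> of its image. Expanding the reproducing identity for \<open>b\<close> in this
    basis and comparing coefficients gives 1.\<close>
  have delta: "(\<Sum>y\<in>X. a y b * b y) = 1" if b: "b \<in> B" for b
  proof -
    define u where "u b' = (\<Sum>y\<in>X. a y b' * b y) - (if b' = b then 1 else 0)" for b'
    have "(\<Sum>b'\<in>B. u b' *\<^sub>C b') = 0"
    proof
      fix x
      have bF: "b \<in> F" using b B by blast
      have "u b' * b' x = (\<Sum>y\<in>X. a y b' * b' x * b y) - (if b' = b then b x else 0)" for b'
        by (simp add: u_def left_diff_distrib sum_distrib_right mult.assoc mult.commute[of "b' x"])
      then have "(\<Sum>b'\<in>B. u b' *\<^sub>C b') x = (\<Sum>b'\<in>B. \<Sum>y\<in>X. a y b' * b' x * b y) - b x"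
        using fB b by (simp add: sum_fun_apply sum_subtractf)
      also have "(\<Sum>b'\<in>B. \<Sum>y\<in>X. a y b' * b' x * b y) = (\<Sum>y\<in>X. K x y * b y)"
        by (subst sum.swap) (simp add: K sum_distrib_right)
      also have "\<dots> = b x"
      proof (cases "x \<in> X")
        case False
        then show ?thesis using supp bF KF by (simp add: supp[OF KF])
      qed (use rep[OF bF] in simp)
      finally show "(\<Sum>b'\<in>B. u b' *\<^sub>C b') x = 0 x" by (simp only: zero_fun_apply diff_self)
    qed
    from complex_vector.independentD[OF B(2) fB order_refl this b] show ?thesis
      by (simp add: u_def)
  qed
  have "(\<Sum>x\<in>X. K x x) = (\<Sum>x\<in>X. \<Sum>b\<in>B. a x b * b x)"
    by (intro sum.cong refl K)
  also have "\<dots> = (\<Sum>b\<in>B. \<Sum>x\<in>X. a x b * b x)" by (rule sum.swap)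
  also have "\<dots> = of_nat (card B)" by (simp add: delta)
  finally show ?thesis using B by simp
qed

section \<open>Complete reducibility\<close>

lemma is_repD:
  assumes "is_rep G T"
  shows "complex_vector.subspace (rep_space T)"
    and "g \<in> carrier G \<Longrightarrow> v \<in> rep_space T \<Longrightarrow> rep_act T g v \<in> rep_space T"
    and "g \<in> carrier G \<Longrightarrow> linear_on (rep_space T) (rep_act T g)"
    and "v \<in> rep_space T \<Longrightarrow> rep_act T \<one>\<^bsub>G\<^esub> v = v"
    and "g \<in> carrier G \<Longrightarrow> h \<in> carrier G \<Longrightarrow> v \<in> rep_space T \<Longrightarrow>
      rep_act T (g \<otimes>\<^bsub>G\<^esub> h) v = rep_act T g (rep_act T h v)"
  using assms unfolding is_rep_def by auto

lemma linear_onD: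
  assumes "linear_on V f"
  shows "v \<in> V \<Longrightarrow> w \<in> V \<Longrightarrow> f (v + w) = f v + f w"
    and "v \<in> V \<Longrightarrow> f (a *\<^sub>C v) = a *\<^sub>C f v"
  using assms unfolding linear_on_def by auto

lemma linear_on_sum:
  assumes "complex_vector.subspace V" "linear_on V f" "\<And>i. i \<in> I \<Longrightarrow> v i \<in> V"
  shows "f (\<Sum>i\<in>I. v i) = (\<Sum>i\<in>I. f (v i))"
proof -
  have "f (0 *\<^sub>C 0) = 0 *\<^sub>C f 0"
    using linear_onD(2)[OF assms(2) complex_vector.subspace_0[OF assms(1)]] .
  then have "f 0 = 0" by simp
  then show ?thesis
    using assms(3)
    by (induction I rule: infinite_finite_induct)
      (auto simp: linear_onD(1)[OF assms(2)] complex_vector.subspace_sum[OF assms(1)])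
qed

lemma linear_on_diff:
  assumes "complex_vector.subspace V" "linear_on V f" "v \<in> V" "w \<in> V"
  shows "f (v - w) = f v - f w"
  using linear_onD(1)[OF assms(2) complex_vector.subspace_diff[OF assms(1,3,4)] assms(4)]
  by (simp add: eq_diff_eq)

lemma linear_on_inv_into:
  assumes V: "complex_vector.subspace V" and f: "linear_on V f" and b: "bij_betw f V W"
  shows "linear_on W (inv_into V f)"
  unfolding linear_on_def
proof (intro conjI ballI allI)
  have i: "inv_into V f w \<in> V" "f (inv_into V f w) = w" if "w \<in> W" for w
    using that b by (auto simp: bij_betw_def inv_into_into f_inv_into_f)
  fix v w assume vw: "v \<in> W" "w \<in> W"
  have "f (inv_into V f v + inv_into V f w) = v + w"
    using linear_onD(1)[OF f] i vw by metis
  then show "inv_into V f (v + w) = inv_into V f v + inv_into V f w"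
    using b i vw complex_vector.subspace_add[OF V] by (metis bij_betw_def inv_into_f_f)
next
  have i: "inv_into V f w \<in> V" "f (inv_into V f w) = w" if "w \<in> W" for w
    using that b by (auto simp: bij_betw_def inv_into_into f_inv_into_f)
  fix a w assume w: "w \<in> W"
  have "f (a *\<^sub>C inv_into V f w) = a *\<^sub>C w"
    using linear_onD(2)[OF f] i w by metis
  then show "inv_into V f (a *\<^sub>C w) = a *\<^sub>C inv_into V f w"
    using b i w complex_vector.subspace_scale[OF V] by (metis bij_betw_def inv_into_f_f)
qed

lemma rep_equiv_sym:
  assumes T: "is_rep G T" and e: "rep_equiv G T S" shows "rep_equiv G S T"
proof -
  obtain f where f: "linear_on (rep_space T) f" "bij_betw f (rep_space T) (rep_space S)"
    "\<And>g v. g \<in> carrier G \<Longrightarrow> v \<in> rep_space T \<Longrightarrow> f (rep_act T g v) = rep_act S g (f v)"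
    using e unfolding rep_equiv_def by blast
  let ?h = "inv_into (rep_space T) f"
  have i: "?h w \<in> rep_space T" "f (?h w) = w" if "w \<in> rep_space S" for w
    using that f(2) by (auto simp: bij_betw_def inv_into_into f_inv_into_f)
  have "?h (rep_act S g w) = rep_act T g (?h w)" if "g \<in> carrier G" "w \<in> rep_space S" for g w
  proof -
    have "f (rep_act T g (?h w)) = rep_act S g w" using f(3) i that by metis
    then show ?thesis using f(2) i that is_repD(2)[OF T] by (metis bij_betw_def inv_into_f_f)
  qed
  then show ?thesis
    unfolding rep_equiv_def
    using linear_on_inv_into[OF is_repD(1)[OF T] f(1,2)] bij_betw_inv_into[OF f(2)] by blast
qed

lemma rep_equiv_trans:
  assumes "rep_equiv G T S" "rep_equiv G S R" shows "rep_equiv G T R"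
proof -
  obtain f where f: "linear_on (rep_space T) f" "bij_betw f (rep_space T) (rep_space S)"
    "\<And>g v. g \<in> carrier G \<Longrightarrow> v \<in> rep_space T \<Longrightarrow> f (rep_act T g v) = rep_act S g (f v)"
    using assms(1) unfolding rep_equiv_def by blast
  obtain h where h: "linear_on (rep_space S) h" "bij_betw h (rep_space S) (rep_space R)"
    "\<And>g v. g \<in> carrier G \<Longrightarrow> v \<in> rep_space S \<Longrightarrow> h (rep_act S g v) = rep_act R g (h v)"
    using assms(2) unfolding rep_equiv_def by blast
  have fS: "f v \<in> rep_space S" if "v \<in> rep_space T" for v
    using f(2) that by (auto simp: bij_betw_def)
  have "linear_on (rep_space T) (h \<circ> f)"
    using f(1) h(1) fS unfolding linear_on_def by simp
  moreover have "bij_betw (h \<circ> f) (rep_space T) (rep_space R)"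
    using f(2) h(2) by (rule bij_betw_trans)
  ultimately show ?thesis unfolding rep_equiv_def using f(3) h(3) fS by (metis comp_apply)
qed

lemma subrep_simps [simp]: "rep_space (subrep V W) = W" "rep_act (subrep V W) = rep_act V"
  by (simp_all add: subrep_def)

lemma is_rep_subrep:
  assumes "is_rep G V" "invariant_subspace G V W" shows "is_rep G (subrep V W)"
  using assms unfolding is_rep_def invariant_subspace_def linear_on_def by (auto simp: Pi_iff subset_iff)

lemma invariant_subspaceD:
  assumes "invariant_subspace G V W"
  shows "complex_vector.subspace W" "W \<subseteq> rep_space V"
    "g \<in> carrier G \<Longrightarrow> w \<in> W \<Longrightarrow> rep_act V g w \<in> W"
  using assms unfolding invariant_subspace_def by auto

text \<open>Schur's argument: the kernel is invariant and proper, hence zero, and the image is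
  invariant and nonzero, hence everything.\<close>

lemma irreducible_intertwiner_equiv:
  assumes A: "irreducible_rep G A" and W: "irreducible_rep G W"
    and lin: "linear_on (rep_space A) \<Phi>" and into: "\<And>a. a \<in> rep_space A \<Longrightarrow> \<Phi> a \<in> rep_space W"
    and eqv: "\<And>g a. g \<in> carrier G \<Longrightarrow> a \<in> rep_space A \<Longrightarrow> \<Phi> (rep_act A g a) = rep_act W g (\<Phi> a)"
    and nz: "a \<in> rep_space A" "\<Phi> a \<noteq> 0"
  shows "rep_equiv G A W"
proof -
  have rA: "is_rep G A" and rW: "is_rep G W" using A W unfolding irreducible_rep_def by auto
  note sA = is_repD(1)[OF rA] and sW = is_repD(1)[OF rW]
  define Ker where "Ker = {x \<in> rep_space A. \<Phi> x = 0}"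
  have P0: "\<Phi> 0 = 0" using linear_on_sum[OF sA lin, of "{}"] by simp
  have W0: "rep_act W g 0 = 0" if "g \<in> carrier G" for g
    using linear_on_sum[OF sW is_repD(3)[OF rW that], of "{}"] by simp
  have "invariant_subspace G A Ker"
    unfolding invariant_subspace_def
  proof (intro conjI ballI)
    show "complex_vector.subspace Ker"
      unfolding complex_vector.subspace_def Ker_def
      using P0 linear_onD[OF lin] complex_vector.subspace_0[OF sA] complex_vector.subspace_add[OF sA]
        complex_vector.subspace_scale[OF sA] by auto
    show "Ker \<subseteq> rep_space A" by (auto simp: Ker_def)
    show "rep_act A g w \<in> Ker" if "g \<in> carrier G" "w \<in> Ker" for g w
      using that eqv W0 is_repD(2)[OF rA] by (auto simp: Ker_def)
  qed
  then have Ker: "Ker = {0}" using A nz unfolding irreducible_rep_def by (auto simp: Ker_def)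
  have inj: "inj_on \<Phi> (rep_space A)"
  proof (rule inj_onI)
    fix x y assume xy: "x \<in> rep_space A" "y \<in> rep_space A" "\<Phi> x = \<Phi> y"
    then have "x - y \<in> Ker"
      using linear_on_diff[OF sA lin] complex_vector.subspace_diff[OF sA] by (simp add: Ker_def)
    then show "x = y" using Ker by simp
  qed
  have "invariant_subspace G W (\<Phi> ` rep_space A)"
    unfolding invariant_subspace_def
  proof (intro conjI ballI)
    show "complex_vector.subspace (\<Phi> ` rep_space A)"
      by (rule linear_on_inj_image(3)[OF sA lin inj])
    show "\<Phi> ` rep_space A \<subseteq> rep_space W" using into by auto
    fix g w assume g: "g \<in> carrier G" and "w \<in> \<Phi> ` rep_space A"
    then obtain x where x: "x \<in> rep_space A" "w = \<Phi> x" by blast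
    then show "rep_act W g w \<in> \<Phi> ` rep_space A"
      using eqv[OF g x(1)] is_repD(2)[OF rA g x(1)] by (simp add: image_iff) metis
  qed
  then have "\<Phi> ` rep_space A = rep_space W"
    using W nz unfolding irreducible_rep_def by blast
  then show ?thesis
    unfolding rep_equiv_def bij_betw_def using lin inj eqv by blast
qed

locale finite_group = group G for G :: "'a monoid" (structure) +
  assumes finite_carrier: "finite (carrier G)"
begin

lemma card_pos: "card (carrier G) > 0"
  using finite_carrier one_closed card_gt_0_iff by blast

lemma sum_translate:
  assumes "g \<in> carrier G" shows "(\<Sum>x\<in>carrier G. f (g \<otimes> x)) = (\<Sum>x\<in>carrier G. f x)"
proof (rule sum.reindex_bij_witness[where j = "\<lambda>x. g \<otimes> x" and i = "\<lambda>x. inv g \<otimes> x"])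
  fix a assume "a \<in> carrier G"
  then show "inv g \<otimes> (g \<otimes> a) = a" "g \<otimes> a \<in> carrier G" "g \<otimes> (inv g \<otimes> a) = a" "inv g \<otimes> a \<in> carrier G"
    using assms by (simp_all add: m_assoc[symmetric])
qed simp

text \<open>A linear projection \<open>p\<close> onto \<open>W\<close> is averaged over the group.
  The sum \<open>q\<close> is equivariant and acts on \<open>W\<close> as multiplication by the
  order of the group, which \<open>c\<close> inverts; its kernel in \<open>V\<close> is the
  complement.\<close>

lemma maschke:
  fixes V :: "('a, 'v::complex_vector) rep"
  assumes V: "is_rep G V" and W: "invariant_subspace G V W"
  obtains W' where "invariant_subspace G V W'" "W \<inter> W' = {0}"
    "\<And>v. v \<in> rep_space V \<Longrightarrow> \<exists>w\<in>W. v - w \<in> W'"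
proof -
  note sV = is_repD(1)[OF V] and act = is_repD(2)[OF V] and lin = is_repD(3)[OF V]
  note sW = invariant_subspaceD(1)[OF W] and WV = invariant_subspaceD(2)[OF W] and Wact = invariant_subspaceD(3)[OF W]
  obtain p :: "'v \<Rightarrow> 'v" where p: "range p \<subseteq> W" "Vector_Spaces.linear scaleC scaleC p" "\<And>v. v \<in> W \<Longrightarrow> p v = v"
    using complex_vector_pair.linear_exists_left_inverse_on[where f = "id :: 'v \<Rightarrow> 'v", OF complex_vector.linear_id sW]
    by auto
  define c where "c = inverse (of_nat (card (carrier G)) :: complex)"
  define q where "q v = (\<Sum>g\<in>carrier G. rep_act V g (p (rep_act V (inv g) v)))" for v
  have pW: "p v \<in> W" for v using p(1) by auto
  have pV: "p v \<in> rep_space V" for v using pW WV by blast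
  have qW: "q v \<in> W" for v
    unfolding q_def by (intro complex_vector.subspace_sum[OF sW] Wact pW)
  have q_id: "c *\<^sub>C q w = w" if w: "w \<in> W" for w
  proof -
    have "rep_act V g (p (rep_act V (inv g) w)) = w" if g: "g \<in> carrier G" for g
      using is_repD(5)[OF V g inv_closed[OF g], of w] is_repD(4)[OF V, of w] g w WV p(3)[OF Wact[OF inv_closed[OF g] w]]
      by auto
    then have "q w = (\<Sum>g\<in>carrier G. w)" unfolding q_def by simp
    also have "\<dots> = of_nat (card (carrier G)) *\<^sub>C w"
      using complex_vector.sum_constant_scale[of w "carrier G"] by simp
    finally show ?thesis using card_pos by (simp add: c_def scaleC_scaleC scaleC_one)
  qed
  have q_lin: "q (v + w) = q v + q w" "q (a *\<^sub>C v) = a *\<^sub>C q v"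
    if "v \<in> rep_space V" "w \<in> rep_space V" for v w a
    unfolding q_def sum.distrib[symmetric] complex_vector.scale_sum_right
    using that pW WV
    by (auto intro!: sum.cong simp: linear_onD[OF lin] act subset_iff
        complex_vector_pair.linear_add[OF p(2)] complex_vector_pair.linear_scale[OF p(2)])
  have q_eqv: "q (rep_act V h v) = rep_act V h (q v)" if h: "h \<in> carrier G" and v: "v \<in> rep_space V" for h v
  proof -
    have "rep_act V h (q v) = (\<Sum>g\<in>carrier G. rep_act V h (rep_act V g (p (rep_act V (inv g) v))))"
      unfolding q_def using pW WV act by (intro linear_on_sum[OF sV lin[OF h]]) blast
    also have "\<dots> = (\<Sum>g\<in>carrier G. (\<lambda>g. rep_act V g (p (rep_act V (inv g) (rep_act V h v)))) (h \<otimes> g))"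
    proof (rule sum.cong[OF refl])
      fix g assume g: "g \<in> carrier G"
      have "rep_act V (inv (h \<otimes> g)) (rep_act V h v) = rep_act V (inv (h \<otimes> g) \<otimes> h) v"
        using is_repD(5)[OF V, of "inv (h \<otimes> g)" h v] g h v by simp
      also have "inv (h \<otimes> g) \<otimes> h = inv g"
        using g h by (simp add: inv_mult_group m_assoc)
      finally show "rep_act V h (rep_act V g (p (rep_act V (inv g) v)))
          = (\<lambda>g. rep_act V g (p (rep_act V (inv g) (rep_act V h v)))) (h \<otimes> g)"
        using is_repD(5)[OF V h g pV] by simp
    qed
    also have "\<dots> = q (rep_act V h v)" unfolding q_def by (rule sum_translate[OF h])
    finally show ?thesis ..
  qed
  have c0: "c \<noteq> 0" using card_pos by (simp add: c_def)
  define W' where "W' = {v \<in> rep_space V. q v = 0}"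
  have "invariant_subspace G V W'"
    unfolding invariant_subspace_def
  proof (intro conjI ballI)
    have "q 0 = 0" using q_id[of 0] c0 complex_vector.subspace_0[OF sW] by simp
    then show "complex_vector.subspace W'"
      unfolding complex_vector.subspace_def W'_def
      using q_lin complex_vector.subspace_0[OF sV] complex_vector.subspace_add[OF sV]
        complex_vector.subspace_scale[OF sV] by auto
    show "W' \<subseteq> rep_space V" by (auto simp: W'_def)
    fix g w assume g: "g \<in> carrier G" and w: "w \<in> W'"
    have "rep_act V g 0 = 0"
      using linear_on_sum[OF sV lin[OF g], of "{}"] by simp
    then show "rep_act V g w \<in> W'" using g w q_eqv act by (auto simp: W'_def)
  qed
  moreover have "W \<inter> W' = {0}"
  proof -
    have "w = 0" if "w \<in> W" "w \<in> W'" for w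
      using q_id[OF that(1)] that(2) by (simp add: W'_def)
    then show ?thesis using complex_vector.subspace_0[OF sW] complex_vector.subspace_0 calculation
        invariant_subspaceD(1) by blast
  qed
  moreover have "\<exists>w\<in>W. v - w \<in> W'" if v: "v \<in> rep_space V" for v
  proof
    show m: "c *\<^sub>C q v \<in> W" using complex_vector.subspace_scale[OF sW qW] .
    have qqv: "q (c *\<^sub>C q v) = q v"
      using q_lin(2)[of "q v" "q v" c] q_id[OF qW, of v] qW WV by auto
    have mV: "c *\<^sub>C q v \<in> rep_space V" "v - c *\<^sub>C q v \<in> rep_space V"
      using m WV complex_vector.subspace_diff[OF sV v] by auto
    have "q ((v - c *\<^sub>C q v) + c *\<^sub>C q v) = q (v - c *\<^sub>C q v) + q (c *\<^sub>C q v)"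
      by (rule q_lin(1)[OF mV(2,1)])
    then show "v - c *\<^sub>C q v \<in> W'" using qqv mV by (simp add: W'_def)
  qed
  ultimately show ?thesis using that by blast
qed

text \<open>A nonzero invariant subspace \<open>W\<close> of least dimension in \<open>U\<close> is
  irreducible. A complement of it in the whole of \<open>V\<close>, intersected with
  \<open>U\<close>, is a complement in \<open>U\<close>, because \<open>W \<subseteq> U\<close>; it
  has smaller dimension, and adjoining \<open>W\<close> to its decomposition preserves unique
  representability.\<close>

lemma irreducible_decomposition_aux:
  fixes V :: "('a, 'v::complex_vector) rep"
  assumes V: "is_rep G V" and fd: "fin_dim (rep_space V)"
  shows "invariant_subspace G V U \<Longrightarrow> \<exists>D. finite D \<and>
     (\<forall>W\<in>D. invariant_subspace G V W \<and> irreducible_rep G (subrep V W) \<and> W \<subseteq> U) \<and>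
     (\<forall>v\<in>U. \<exists>!f. f \<in> (\<Pi>\<^sub>E W\<in>D. W) \<and> v = (\<Sum>W\<in>D. f W))"
proof (induction "complex_vector.dim U" arbitrary: U rule: less_induct)
  case less
  note U = invariant_subspaceD[OF less.prems]
  show ?case
  proof (cases "U = {0}")
    case True
    then show ?thesis by (intro exI[of _ "{}"]) auto
  next
    case False
    then obtain W where W: "invariant_subspace G V W" "W \<subseteq> U" "W \<noteq> {0}"
      and min: "\<And>X. invariant_subspace G V X \<Longrightarrow> X \<subseteq> U \<Longrightarrow> X \<noteq> {0} \<Longrightarrow> complex_vector.dim W \<le> complex_vector.dim X"
      using ex_has_least_nat[of "\<lambda>W. invariant_subspace G V W \<and> W \<subseteq> U \<and> W \<noteq> {0}" U complex_vector.dim]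
        less.prems by blast
    note sW = invariant_subspaceD[OF W(1)]
    have irr: "irreducible_rep G (subrep V W)"
      unfolding irreducible_rep_def
    proof (intro conjI allI impI)
      fix X assume "invariant_subspace G (subrep V W) X"
      then have X: "invariant_subspace G V X" "X \<subseteq> W"
        using sW(2) by (auto simp: invariant_subspace_def)
      have "X = W" if "X \<noteq> {0}"
        using min[OF X(1) _ that] X W fin_dim_dim_less[OF fin_dim_subset[OF fd sW(2)] invariant_subspaceD(1)[OF X(1)] X(2) _ sW(1)]
        by (meson leD order_trans)
      then show "X = {0} \<or> X = rep_space (subrep V W)" by auto
    qed (use W is_rep_subrep[OF V W(1)] in auto)
    obtain W' where W': "invariant_subspace G V W'" "W \<inter> W' = {0}" "\<And>v. v \<in> rep_space V \<Longrightarrow> \<exists>w\<in>W. v - w \<in> W'"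
      using maschke[OF V W(1)] by blast
    define U' where "U' = W' \<inter> U"
    have U': "invariant_subspace G V U'"
      using W'(1) less.prems unfolding U'_def invariant_subspace_def
      by (auto intro: complex_vector.subspace_inter)
    note sU' = invariant_subspaceD(1)[OF U']
    have WU': "x = 0" if "x \<in> W" "x \<in> U'" for x using that W'(2) by (auto simp: U'_def)
    have "U' \<noteq> U" using W(2,3) WU' complex_vector.subspace_0[OF sW(1)] by blast
    then have "complex_vector.dim U' < complex_vector.dim U"
      using fin_dim_dim_less[OF fin_dim_subset[OF fd U(2)] sU' _ _ U(1)] by (auto simp: U'_def)
    from less.hyps[OF this U'] obtain D where D': "finite D \<and>
     (\<forall>W\<in>D. invariant_subspace G V W \<and> irreducible_rep G (subrep V W) \<and> W \<subseteq> U') \<and>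
     (\<forall>v\<in>U'. \<exists>!f. f \<in> (\<Pi>\<^sub>E W\<in>D. W) \<and> v = (\<Sum>W\<in>D. f W))" by (rule exE)
    have D: "finite D"
      "\<And>W. W \<in> D \<Longrightarrow> invariant_subspace G V W \<and> irreducible_rep G (subrep V W) \<and> W \<subseteq> U'"
      "\<And>v. v \<in> U' \<Longrightarrow> \<exists>!f. f \<in> (\<Pi>\<^sub>E W\<in>D. W) \<and> v = (\<Sum>W\<in>D. f W)"
      using D' by simp_all
    have WD: "W \<notin> D"
      using D(2)[of W] WU' W(3) complex_vector.subspace_0[OF sW(1)] by blast
    have "\<exists>!f. f \<in> (\<Pi>\<^sub>E X\<in>insert W D. X) \<and> v = (\<Sum>X\<in>insert W D. f X)" if v: "v \<in> U" for v
    proof -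
      obtain w where w: "w \<in> W" "v - w \<in> W'" using W'(3) v U(2) by blast
      then have vw: "v - w \<in> U'" using v W(2) complex_vector.subspace_diff[OF U(1)] by (auto simp: U'_def)
      from D(3)[OF vw] obtain f where f': "f \<in> (\<Pi>\<^sub>E W\<in>D. W) \<and> v - w = (\<Sum>W\<in>D. f W)"
        and uf': "\<forall>f'. f' \<in> (\<Pi>\<^sub>E W\<in>D. W) \<and> v - w = (\<Sum>W\<in>D. f' W) \<longrightarrow> f' = f" by (rule ex1E)
      note f = conjunct1[OF f'] conjunct2[OF f'] and uf = uf'[rule_format, OF conjI]
      show ?thesis
      proof (rule ex1I[of _ "f(W := w)"])
        have "(\<Sum>X\<in>D. (f(W := w)) X) = (\<Sum>X\<in>D. f X)"
          by (rule sum.cong) (use WD in auto)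
        then have "v = (\<Sum>X\<in>insert W D. (f(W := w)) X)"
          using D(1) WD f(2) by (simp add: algebra_simps)
        moreover have "f(W := w) \<in> (\<Pi>\<^sub>E X\<in>insert W D. X)"
          using f(1) w(1) by (intro PiE_fun_upd)
        ultimately show "f(W := w) \<in> (\<Pi>\<^sub>E X\<in>insert W D. X) \<and> v = (\<Sum>X\<in>insert W D. (f(W := w)) X)" by blast
      next
        fix h assume h: "h \<in> (\<Pi>\<^sub>E X\<in>insert W D. X) \<and> v = (\<Sum>X\<in>insert W D. h X)"
        then have hW: "h W \<in> W" and hX: "\<And>X. X \<in> D \<Longrightarrow> h X \<in> X" by auto
        have v': "v = h W + (\<Sum>X\<in>D. h X)" using h D(1) WD by simp
        have S: "(\<Sum>X\<in>D. h X) \<in> U'" using hX D(2) by (intro complex_vector.subspace_sum[OF sU']) blast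
        have "h W - w = (v - w) - (\<Sum>X\<in>D. h X)" using v' by (simp add: algebra_simps)
        then have "h W - w \<in> U'" using complex_vector.subspace_diff[OF sU' vw S] by (simp only:)
        then have hw: "h W = w" using WU' complex_vector.subspace_diff[OF sW(1) hW w(1)] by fastforce
        have fh: "restrict h D = f"
        proof (rule uf)
          show "restrict h D \<in> (\<Pi>\<^sub>E W\<in>D. W)" using hX by auto
          show "v - w = (\<Sum>W\<in>D. restrict h D W)" using v' hw by simp
        qed
        show "h = f(W := w)"
        proof
          fix x
          have "f x = restrict h D x" using fh by simp
          then show "h x = (f(W := w)) x"
            using h hw by (cases "x = W"; cases "x \<in> D") (simp_all add: PiE_def extensional_def)
        qed
      qed
    qed
    then show ?thesis
      using D W irr by (intro exI[of _ "insert W D"]) (auto simp: U'_def)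
  qed
qed

lemma irreducible_decomposition_exists:
  assumes "is_rep G V" "fin_dim (rep_space V)"
  obtains D where "irreducible_decomposition G V D"
proof -
  have "invariant_subspace G V (rep_space V)"
    using assms(1) unfolding invariant_subspace_def is_rep_def by auto
  from irreducible_decomposition_aux[OF assms this] obtain D where D: "finite D \<and>
     (\<forall>W\<in>D. invariant_subspace G V W \<and> irreducible_rep G (subrep V W) \<and> W \<subseteq> rep_space V) \<and>
     (\<forall>v\<in>rep_space V. \<exists>!f. f \<in> (\<Pi>\<^sub>E W\<in>D. W) \<and> v = (\<Sum>W\<in>D. f W))" by (rule exE)
  have "irreducible_decomposition G V D"
    unfolding irreducible_decomposition_def
    using conjunct1[OF D] conjunct1[OF conjunct2[OF D]] by (intro conjI conjunct2[OF conjunct2[OF D]]) simp_all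
  then show ?thesis by (rule that)
qed

end

section \<open>Induced characters and multiplicities\<close>

text \<open>A subgroup given as a monoid record of its own, as \<open>exp_group N p\<close> is. Only
  the products on the smaller carrier are compared; unit and inverses then agree
  automatically.\<close>

definition group_below :: "'g monoid \<Rightarrow> 'g monoid \<Rightarrow> bool" where
  "group_below L G \<longleftrightarrow> group L \<and> carrier L \<subseteq> carrier G \<and>
     (\<forall>x\<in>carrier L. \<forall>y\<in>carrier L. x \<otimes>\<^bsub>L\<^esub> y = x \<otimes>\<^bsub>G\<^esub> y)"

definition linear_character :: "'g monoid \<Rightarrow> ('g \<Rightarrow> complex) \<Rightarrow> bool" where
  "linear_character L \<chi> \<longleftrightarrow> (\<forall>x\<in>carrier L. \<chi> x \<noteq> 0) \<and>
     (\<forall>x\<in>carrier L. \<forall>y\<in>carrier L. \<chi> (x \<otimes>\<^bsub>L\<^esub> y) = \<chi> x * \<chi> y)"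

definition char_rep :: "('g \<Rightarrow> complex) \<Rightarrow> ('g, complex) rep" where
  "char_rep \<chi> = \<lparr>rep_space = UNIV, rep_act = (\<lambda>u z. \<chi> u * z)\<rparr>"

definition eigenvectors :: "('g, 'v::complex_vector) rep \<Rightarrow> 'g monoid \<Rightarrow> ('g \<Rightarrow> complex) \<Rightarrow> 'v set" where
  "eigenvectors T L \<psi> = {v \<in> rep_space T. \<forall>x\<in>carrier L. rep_act T x v = \<psi> x *\<^sub>C v}"

lemma linear_character_one:
  assumes "group L" "linear_character L \<chi>" shows "\<chi> \<one>\<^bsub>L\<^esub> = 1"
proof -
  interpret L: group L by fact
  have "\<chi> \<one>\<^bsub>L\<^esub> * \<chi> \<one>\<^bsub>L\<^esub> = \<chi> \<one>\<^bsub>L\<^esub>" "\<chi> \<one>\<^bsub>L\<^esub> \<noteq> 0"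
    using assms(2) L.one_closed unfolding linear_character_def by (metis L.r_one)+
  then show ?thesis by simp
qed

lemma linear_character_inv:
  assumes "group L" "linear_character L \<chi>" "x \<in> carrier L"
  shows "\<chi> (inv\<^bsub>L\<^esub> x) = inverse (\<chi> x)"
proof -
  interpret L: group L by fact
  have "\<chi> (inv\<^bsub>L\<^esub> x) * \<chi> x = 1"
    using assms L.inv_closed L.l_inv linear_character_one[OF assms(1,2)]
    unfolding linear_character_def by metis
  then show ?thesis by (metis inverse_unique mult.commute)
qed

lemma dim_one_span:
  fixes E :: "'v::complex_vector set"
  assumes "complex_vector.subspace E" "complex_vector.dim E = 1"
  obtains b where "b \<in> E" "b \<noteq> 0" "\<And>v. v \<in> E \<Longrightarrow> \<exists>a. v = a *\<^sub>C b"
proof -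
  obtain B where B: "B \<subseteq> E" "complex_vector.independent B" "complex_vector.span B = E" "card B = 1"
    using complex_vector_basis[OF assms(1)] assms(2) by metis
  obtain b where b: "B = {b}" using B(4) card_1_singletonE by blast
  show ?thesis
  proof
    show "b \<in> E" using B(1) b by blast
    show "b \<noteq> 0" using B(2) b by simp
    show "\<exists>a. v = a *\<^sub>C b" if "v \<in> E" for v
      using that B(3) unfolding b complex_vector.span_singleton by blast
  qed
qed

lemma is_rep_char_rep:
  assumes "group L" "linear_character L \<chi>" shows "is_rep L (char_rep \<chi>)"
  using assms linear_character_one[OF assms]
  unfolding is_rep_def char_rep_def linear_character_def linear_on_def
  by (simp add: algebra_simps)

section \<open>Restriction to and induction from subgroups\<close>

context finite_group
begin

context
  fixes L :: "'a monoid"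
  assumes L: "group_below L G"
begin

lemma below_group: "group L" using L by (simp add: group_below_def)

lemma below_closed: "x \<in> carrier L \<Longrightarrow> x \<in> carrier G"
  using L unfolding group_below_def by blast

lemma below_mult: "x \<in> carrier L \<Longrightarrow> y \<in> carrier L \<Longrightarrow> x \<otimes>\<^bsub>L\<^esub> y = x \<otimes> y"
  using L unfolding group_below_def by blast

lemma below_one: "\<one>\<^bsub>L\<^esub> = \<one>"
proof -
  interpret L: group L by (rule below_group)
  have "\<one>\<^bsub>L\<^esub> \<otimes> \<one>\<^bsub>L\<^esub> = \<one>\<^bsub>L\<^esub>" using below_mult[of "\<one>\<^bsub>L\<^esub>" "\<one>\<^bsub>L\<^esub>"] by simp
  then show ?thesis using below_closed[of "\<one>\<^bsub>L\<^esub>"] by simp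
qed

lemma below_inv: "x \<in> carrier L \<Longrightarrow> inv\<^bsub>L\<^esub> x = inv x"
proof -
  assume x: "x \<in> carrier L"
  interpret L: group L by (rule below_group)
  have "inv\<^bsub>L\<^esub> x \<otimes> x = \<one>" using below_mult[of "inv\<^bsub>L\<^esub> x" x] x below_one by simp
  from inv_equality[OF this] show ?thesis using x below_closed by simp
qed

lemma below_inv_closed: "x \<in> carrier L \<Longrightarrow> inv x \<in> carrier L"
  using below_inv group.inv_closed[OF below_group] by metis

lemma below_m_closed: "x \<in> carrier L \<Longrightarrow> y \<in> carrier L \<Longrightarrow> x \<otimes> y \<in> carrier L"
  using below_mult monoid.m_closed[OF group.is_monoid[OF below_group]] by metis

lemma below_mult_iff_left:
  assumes "x \<in> carrier G" "y \<in> carrier L" shows "x \<otimes> y \<in> carrier L \<longleftrightarrow> x \<in> carrier L"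
proof
  assume "x \<otimes> y \<in> carrier L"
  then have "x \<otimes> y \<otimes> inv y \<in> carrier L" using assms below_inv_closed below_m_closed by blast
  then show "x \<in> carrier L" using assms below_closed by (simp add: m_assoc)
qed (use assms below_m_closed in blast)

lemma below_mult_iff_right:
  assumes "x \<in> carrier G" "y \<in> carrier L" shows "y \<otimes> x \<in> carrier L \<longleftrightarrow> x \<in> carrier L"
proof
  assume "y \<otimes> x \<in> carrier L"
  then have "inv y \<otimes> (y \<otimes> x) \<in> carrier L" using assms below_inv_closed below_m_closed by blast
  then show "x \<in> carrier L" using assms below_closed by (simp add: m_assoc[symmetric])
qed (use assms below_m_closed in blast)

lemma below_finite: "finite_group L"
  using below_group finite_carrier L finite_subset
  unfolding finite_group_def finite_group_axioms_def group_below_def by blast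

lemma is_rep_restrict:
  assumes "is_rep G T" shows "is_rep L (res_rep T L)"
  using assms below_closed below_mult below_m_closed below_one
    group.is_monoid[OF below_group, THEN monoid.one_closed]
  unfolding is_rep_def res_rep_def by auto

lemma ind_rep_space:
  "f \<in> rep_space (ind_rep t L G) \<longleftrightarrow> (\<forall>x\<in>carrier G. f x \<in> rep_space t) \<and> (\<forall>x. x \<notin> carrier G \<longrightarrow> f x = 0) \<and>
    (\<forall>x\<in>carrier G. \<forall>h\<in>carrier L. f (x \<otimes> h) = rep_act t (inv h) (f x))"
  using below_inv by (simp add: ind_rep_def)

lemma ind_rep_act:
  "rep_act (ind_rep t L G) g f x = (if x \<in> carrier G then f (inv g \<otimes> x) else 0)"
  by (simp add: ind_rep_def)

lemma is_rep_ind: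
  assumes t: "is_rep L t" shows "is_rep G (ind_rep t L G)"
  unfolding is_rep_def
proof (intro conjI ballI)
  note st = is_repD(1)[OF t]
  have t0: "rep_act t (inv h) 0 = 0" if "h \<in> carrier L" for h
    using linear_on_sum[OF st is_repD(3)[OF t below_inv_closed[OF that]], of "{}"] by simp
  show "complex_vector.subspace (rep_space (ind_rep t L G))"
    unfolding complex_vector.subspace_def ind_rep_space
    using complex_vector.subspace_0[OF st] complex_vector.subspace_add[OF st]
      complex_vector.subspace_scale[OF st] linear_onD[OF is_repD(3)[OF t below_inv_closed]] t0
    by (auto simp: ind_rep_space)
  show "rep_act (ind_rep t L G) g \<in> rep_space (ind_rep t L G) \<rightarrow> rep_space (ind_rep t L G)"
    if g: "g \<in> carrier G" for g
  proof
    fix f assume f: "f \<in> rep_space (ind_rep t L G)"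
    then show "rep_act (ind_rep t L G) g f \<in> rep_space (ind_rep t L G)"
      unfolding ind_rep_space ind_rep_act
      using g below_closed by (auto simp: m_assoc[symmetric])
  qed
  show "linear_on (rep_space (ind_rep t L G)) (rep_act (ind_rep t L G) g)" if "g \<in> carrier G" for g
    unfolding linear_on_def by (auto simp: fun_eq_iff ind_rep_act)
  show "rep_act (ind_rep t L G) \<one> f = f" if "f \<in> rep_space (ind_rep t L G)" for f
    using that by (auto simp: fun_eq_iff ind_rep_act ind_rep_space)
  show "rep_act (ind_rep t L G) (g \<otimes> h) f = rep_act (ind_rep t L G) g (rep_act (ind_rep t L G) h f)"
    if "g \<in> carrier G" "h \<in> carrier G" "f \<in> rep_space (ind_rep t L G)" for g h f
    using that by (auto simp: fun_eq_iff ind_rep_act inv_mult_group m_assoc)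
qed

lemma subspace_eigenvectors:
  assumes V: "is_rep G V" shows "complex_vector.subspace (eigenvectors V L \<psi>)"
proof -
  note sV = is_repD(1)[OF V]
  have "rep_act V x 0 = 0" if "x \<in> carrier L" for x
    using linear_on_sum[OF sV is_repD(3)[OF V below_closed[OF that]], of "{}"] by simp
  then show ?thesis
    unfolding complex_vector.subspace_def eigenvectors_def
    using complex_vector.subspace_0[OF sV] complex_vector.subspace_add[OF sV]
      complex_vector.subspace_scale[OF sV] linear_onD[OF is_repD(3)[OF V below_closed]]
    by (auto simp: scaleC_add_right scaleC_scaleC mult.commute)
qed

end

section \<open>The representation induced from a linear character\<close>

context
  fixes P :: "'a monoid" and \<chi> :: "'a \<Rightarrow> complex"
  assumes P: "group_below P G" and \<chi>: "linear_character P \<chi>"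
begin

abbreviation (input) A :: "('a, 'a \<Rightarrow> complex) rep" where
  "A \<equiv> ind_rep (char_rep \<chi>) P G"

lemma is_rep_A: "is_rep G A"
  by (rule is_rep_ind[OF P is_rep_char_rep[OF below_group[OF P] \<chi>]])

lemma chi_nz: "x \<in> carrier P \<Longrightarrow> \<chi> x \<noteq> 0"
  using \<chi> by (simp add: linear_character_def)

lemma chi_mult: "x \<in> carrier P \<Longrightarrow> y \<in> carrier P \<Longrightarrow> \<chi> (x \<otimes> y) = \<chi> x * \<chi> y"
  using \<chi> below_mult[OF P] unfolding linear_character_def by metis

lemma chi_inv: "x \<in> carrier P \<Longrightarrow> \<chi> (inv x) = inverse (\<chi> x)"
  using linear_character_inv[OF below_group[OF P] \<chi>] below_inv[OF P] by metis

lemma chi_one: "\<chi> \<one> = 1"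
  using linear_character_one[OF below_group[OF P] \<chi>] below_one[OF P] by simp

lemma P_one: "\<one> \<in> carrier P"
  using below_one[OF P] group.is_monoid[OF below_group[OF P], THEN monoid.one_closed] by simp

lemma P_finite: "finite (carrier P)"
  using below_finite[OF P] by (simp add: finite_group_def finite_group_axioms_def)

lemma P_card: "of_nat (card (carrier P)) \<noteq> (0 :: complex)"
  using P_finite P_one by auto

lemma A_space:
  "f \<in> rep_space A \<longleftrightarrow> (\<forall>x. x \<notin> carrier G \<longrightarrow> f x = 0) \<and>
    (\<forall>x\<in>carrier G. \<forall>h\<in>carrier P. f (x \<otimes> h) = inverse (\<chi> h) * f x)"
  unfolding ind_rep_space[OF P] by (auto simp: char_rep_def chi_inv)

lemma fin_dim_A: "fin_dim (rep_space A)"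
  by (rule fin_dim_subset[OF fin_dim_finite_support[OF finite_carrier]]) (auto simp: A_space)

text \<open>The canonical cyclic vector of the induced representation. Under Frobenius reciprocity,
  intertwiners out of it correspond to the possible images of \<open>delta\<close>, which are the
  \<open>(P, \<chi>)\<close>-eigenvectors of the target.\<close>

definition delta :: "'a \<Rightarrow> complex" where
  "delta x = (if x \<in> carrier P then inverse (\<chi> x) else 0)"

lemma delta_eigenvector: "delta \<in> eigenvectors A P \<chi>"
  unfolding eigenvectors_def
proof (intro CollectI conjI ballI)
  show "delta \<in> rep_space A"
    unfolding A_space delta_def
    using below_mult_iff_left[OF P] below_closed[OF P] by (auto simp: chi_mult)
  fix p assume p: "p \<in> carrier P"
  then show "rep_act A p delta = \<chi> p *\<^sub>C delta"
    unfolding ind_rep_act[OF P] delta_def fun_eq_iff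
    using below_mult_iff_right[OF P _ below_inv_closed[OF P p]] below_closed[OF P] below_inv_closed[OF P p]
    by (auto simp: chi_mult chi_inv)
qed

lemma delta_in_A: "delta \<in> rep_space A"
  using delta_eigenvector by (simp add: eigenvectors_def)

lemma delta_one: "delta \<one> = 1"
  by (simp add: delta_def P_one chi_one)

text \<open>The translate of \<open>delta\<close> by \<open>g\<close> is supported on the coset
  \<open>g P\<close>. At a given point only the elements of one coset contribute, and each of them
  contributes the same value.\<close>

lemma delta_generates:
  assumes f: "f \<in> rep_space A"
  shows "(\<Sum>g\<in>carrier G. f g *\<^sub>C rep_act A g delta) = of_nat (card (carrier P)) *\<^sub>C f"
proof
  fix x
  show "(\<Sum>g\<in>carrier G. f g *\<^sub>C rep_act A g delta) x = (of_nat (card (carrier P)) *\<^sub>C f) x"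
  proof (cases "x \<in> carrier G")
    case False
    then show ?thesis using f by (simp add: sum_fun_apply ind_rep_act[OF P] A_space)
  next
    case x: True
    have "(\<Sum>g\<in>carrier G. f g *\<^sub>C rep_act A g delta) x = (\<Sum>g\<in>carrier G. f g * delta (inv g \<otimes> x))"
      using x by (simp add: sum_fun_apply ind_rep_act[OF P])
    also have "\<dots> = (\<Sum>y\<in>carrier G. f (x \<otimes> inv y) * delta y)"
      by (rule sum.reindex_bij_witness[where i = "\<lambda>y. x \<otimes> inv y" and j = "\<lambda>g. inv g \<otimes> x"])
        (use x in \<open>auto simp: inv_mult_group m_assoc[symmetric]\<close>, simp add: m_assoc)
    also have "\<dots> = (\<Sum>y\<in>carrier P. f (x \<otimes> inv y) * delta y)"
      by (rule sum.mono_neutral_right[OF finite_carrier]) (auto simp: below_closed[OF P] delta_def)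
    also have "\<dots> = (\<Sum>y\<in>carrier P. f x)"
    proof (rule sum.cong[OF refl])
      fix y assume y: "y \<in> carrier P"
      have "f (x \<otimes> inv y) = \<chi> y * f x"
        using f x below_inv_closed[OF P y] y by (simp add: A_space chi_inv)
      then show "f (x \<otimes> inv y) * delta y = f x" using y chi_nz[OF y] by (simp add: delta_def)
    qed
    finally show ?thesis by simp
  qed
qed

text \<open>Frobenius reciprocity in explicit form. Summation over the group in place of a set of
  coset representatives costs only the factor \<open>card (carrier P)\<close> in the image of
  \<open>delta\<close>.\<close>

lemma induced_intertwiner:
  fixes W :: "('a, 'w::complex_vector) rep"
  assumes W: "is_rep G W" and w: "w \<in> eigenvectors W P \<chi>"
  defines "\<Phi> \<equiv> (\<lambda>f. \<Sum>g\<in>carrier G. f g *\<^sub>C rep_act W g w)"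
  shows "linear_on (rep_space A) \<Phi>"
    and "f \<in> rep_space A \<Longrightarrow> \<Phi> f \<in> rep_space W"
    and "h \<in> carrier G \<Longrightarrow> f \<in> rep_space A \<Longrightarrow> \<Phi> (rep_act A h f) = rep_act W h (\<Phi> f)"
    and "\<Phi> delta = of_nat (card (carrier P)) *\<^sub>C w"
proof -
  note sW = is_repD(1)[OF W]
  have wW: "w \<in> rep_space W" and we: "\<And>p. p \<in> carrier P \<Longrightarrow> rep_act W p w = \<chi> p *\<^sub>C w"
    using w by (auto simp: eigenvectors_def)
  show "linear_on (rep_space A) \<Phi>"
    unfolding linear_on_def \<Phi>_def
    by (auto simp: scaleC_add_left sum.distrib complex_vector.scale_sum_right scaleC_scaleC)
  have termW: "f g *\<^sub>C rep_act W g w \<in> rep_space W" if "g \<in> carrier G" for f g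
    using complex_vector.subspace_scale[OF sW is_repD(2)[OF W that wW]] .
  show "\<Phi> f \<in> rep_space W"
    unfolding \<Phi>_def by (intro complex_vector.subspace_sum[OF sW] termW)
  show "\<Phi> (rep_act A h f) = rep_act W h (\<Phi> f)" if h: "h \<in> carrier G"
  proof -
    have "\<Phi> (rep_act A h f) = (\<Sum>g\<in>carrier G. f (inv h \<otimes> g) *\<^sub>C rep_act W g w)"
      unfolding \<Phi>_def by (rule sum.cong) (auto simp: ind_rep_act[OF P])
    also have "\<dots> = (\<Sum>g\<in>carrier G. f (inv h \<otimes> (h \<otimes> g)) *\<^sub>C rep_act W (h \<otimes> g) w)"
      by (rule sum_translate[OF h, symmetric])
    also have "\<dots> = (\<Sum>g\<in>carrier G. rep_act W h (f g *\<^sub>C rep_act W g w))"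
      using h is_repD(5)[OF W h _ wW] linear_onD(2)[OF is_repD(3)[OF W h] is_repD(2)[OF W _ wW]]
      by (intro sum.cong) (auto simp: m_assoc[symmetric])
    also have "\<dots> = rep_act W h (\<Phi> f)"
      unfolding \<Phi>_def using termW by (intro linear_on_sum[OF sW is_repD(3)[OF W h], symmetric])
    finally show ?thesis .
  qed
  have "\<Phi> delta = (\<Sum>g\<in>carrier P. delta g *\<^sub>C rep_act W g w)"
    unfolding \<Phi>_def by (rule sum.mono_neutral_right[OF finite_carrier])
      (auto simp: below_closed[OF P] delta_def)
  also have "\<dots> = (\<Sum>g\<in>carrier P. w)"
    by (rule sum.cong) (auto simp: delta_def we scaleC_scaleC chi_nz scaleC_one)
  also have "\<dots> = of_nat (card (carrier P)) *\<^sub>C w"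
    using complex_vector.sum_constant_scale[of w "carrier P"] by simp
  finally show "\<Phi> delta = of_nat (card (carrier P)) *\<^sub>C w" .
qed

text \<open>A nonzero element of an invariant subspace is translated so that it does not vanish at
  the unit, then averaged over \<open>P\<close> against the inverse of \<open>\<chi>\<close>. The
  average is an eigenvector whose value at the unit has merely been multiplied by the order of
  \<open>P\<close>, hence a nonzero multiple of \<open>delta\<close>, which generates
  everything.\<close>

lemma irreducible_A:
  assumes dim1: "complex_vector.dim (eigenvectors A P \<chi>) = 1"
  shows "irreducible_rep G A"
proof -
  note sA = is_repD(1)[OF is_rep_A]
  note sE = subspace_eigenvectors[OF P is_rep_A]
  have mult: "\<exists>a. v = a *\<^sub>C delta" if v: "v \<in> eigenvectors A P \<chi>" for v
  proof -
    obtain b where b: "\<And>v. v \<in> eigenvectors A P \<chi> \<Longrightarrow> \<exists>a. v = a *\<^sub>C b"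
      using dim_one_span[OF sE dim1] by metis
    obtain a a' where a: "delta = a *\<^sub>C b" "v = a' *\<^sub>C b"
      using b[OF delta_eigenvector] b[OF v] by blast
    have "a \<noteq> 0" using a(1) delta_one by auto
    then have "v = (a' / a) *\<^sub>C delta" unfolding a by (simp add: scaleC_scaleC)
    then show ?thesis by blast
  qed
  show ?thesis
    unfolding irreducible_rep_def
  proof (intro conjI allI impI)
    show "is_rep G A" by (rule is_rep_A)
    show "rep_space A \<noteq> {0}" using delta_in_A delta_one by (metis singletonD zero_fun_apply zero_neq_one)
    fix W assume W: "invariant_subspace G A W"
    note W' = invariant_subspaceD[OF W]
    show "W = {0} \<or> W = rep_space A"
    proof (cases "W \<subseteq> {0}")
      case True
      then show ?thesis using complex_vector.subspace_0[OF W'(1)] by blast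
    next
      case False
      then obtain f where f: "f \<in> W" "f \<noteq> 0" by blast
      then obtain x where x: "f x \<noteq> 0" by (auto simp: fun_eq_iff)
      have fA: "f \<in> rep_space A" using f W' by blast
      then have xG: "x \<in> carrier G" using x by (auto simp: A_space)
      define k where "k = rep_act A (inv x) f"
      have kW: "k \<in> W" unfolding k_def using W'(3) xG f by simp
      then have kA: "k \<in> rep_space A" using W' by blast
      have k1: "k \<one> \<noteq> 0" using x xG by (simp add: k_def ind_rep_act[OF P])
      define v where "v = (\<Sum>p\<in>carrier P. inverse (\<chi> p) *\<^sub>C rep_act A p k)"
      have vW: "v \<in> W" unfolding v_def
        by (intro complex_vector.subspace_sum[OF W'(1)] complex_vector.subspace_scale[OF W'(1)] W'(3) kW below_closed[OF P])
      have "rep_act A q v = \<chi> q *\<^sub>C v" if q: "q \<in> carrier P" for q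
      proof -
        have qG: "q \<in> carrier G" by (rule below_closed[OF P q])
        interpret P: finite_group P by (rule below_finite[OF P])
        have "\<chi> q *\<^sub>C v = (\<Sum>p\<in>carrier P. (\<chi> q * inverse (\<chi> p)) *\<^sub>C rep_act A p k)"
          unfolding v_def complex_vector.scale_sum_right by (simp add: scaleC_scaleC)
        also have "\<dots> = (\<Sum>p\<in>carrier P. (\<chi> q * inverse (\<chi> (q \<otimes>\<^bsub>P\<^esub> p))) *\<^sub>C rep_act A (q \<otimes>\<^bsub>P\<^esub> p) k)"
          by (rule P.sum_translate[OF q, symmetric])
        also have "\<dots> = (\<Sum>p\<in>carrier P. rep_act A q (inverse (\<chi> p) *\<^sub>C rep_act A p k))"
        proof (rule sum.cong[OF refl])
          fix p assume p: "p \<in> carrier P"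
          have "\<chi> q * inverse (\<chi> (q \<otimes>\<^bsub>P\<^esub> p)) = inverse (\<chi> p)"
            using chi_nz[OF q] chi_nz[OF p] p q by (simp add: below_mult[OF P] chi_mult)
          moreover have "rep_act A (q \<otimes>\<^bsub>P\<^esub> p) k = rep_act A q (rep_act A p k)"
            using is_repD(5)[OF is_rep_A qG below_closed[OF P p] kA] p q by (simp add: below_mult[OF P])
          moreover have "rep_act A p k \<in> rep_space A"
            by (rule is_repD(2)[OF is_rep_A below_closed[OF P p] kA])
          ultimately show "(\<chi> q * inverse (\<chi> (q \<otimes>\<^bsub>P\<^esub> p))) *\<^sub>C rep_act A (q \<otimes>\<^bsub>P\<^esub> p) k = rep_act A q (inverse (\<chi> p) *\<^sub>C rep_act A p k)"
            by (simp add: linear_onD(2)[OF is_repD(3)[OF is_rep_A qG]])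
        qed
        also have "\<dots> = rep_act A q v"
          unfolding v_def
          by (rule linear_on_sum[OF sA is_repD(3)[OF is_rep_A qG], symmetric])
            (intro complex_vector.subspace_scale[OF sA] is_repD(2)[OF is_rep_A _ kA] below_closed[OF P])
        finally show ?thesis ..
      qed
      then obtain a where a: "v = a *\<^sub>C delta"
        using mult[of v] vW W'(2) by (auto simp: eigenvectors_def)
      have "v \<one> = (\<Sum>p\<in>carrier P. k \<one>)"
        unfolding v_def sum_fun_apply
      proof (rule sum.cong[OF refl])
        fix p assume p: "p \<in> carrier P"
        have "k (\<one> \<otimes> inv p) = \<chi> p * k \<one>"
          using kA below_inv_closed[OF P p] p by (simp add: A_space chi_inv)
        then show "(inverse (\<chi> p) *\<^sub>C rep_act A p k) \<one> = k \<one>"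
          using chi_nz[OF p] below_closed[OF P p] by (simp add: ind_rep_act[OF P])
      qed
      then have "a \<noteq> 0" using a k1 P_card by auto
      then have "delta = inverse a *\<^sub>C v" using a by (simp add: scaleC_scaleC scaleC_one)
      then have dW: "delta \<in> W" using complex_vector.subspace_scale[OF W'(1) vW] by simp
      have "h \<in> W" if h: "h \<in> rep_space A" for h
      proof -
        have "of_nat (card (carrier P)) *\<^sub>C h \<in> W"
          unfolding delta_generates[OF h, symmetric]
          by (intro complex_vector.subspace_sum[OF W'(1)] complex_vector.subspace_scale[OF W'(1)] W'(3) dW)
        then have "inverse (of_nat (card (carrier P))) *\<^sub>C of_nat (card (carrier P)) *\<^sub>C h \<in> W"
          by (rule complex_vector.subspace_scale[OF W'(1)])
        then show ?thesis using P_card by (simp add: scaleC_scaleC scaleC_one)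
      qed
      then show ?thesis using W' by blast
    qed
  qed
qed

end

end

lemma eigenvectors_equiv:
  fixes S :: "('g, 'v::complex_vector) rep" and R :: "('g, 'w::complex_vector) rep"
  assumes S: "is_rep G S" and e: "rep_equiv G S R" and LG: "carrier L \<subseteq> carrier G"
    and sE: "complex_vector.subspace (eigenvectors S L \<psi>)"
  shows "complex_vector.dim (eigenvectors R L \<psi>) = complex_vector.dim (eigenvectors S L \<psi>)"
proof -
  obtain f where f: "linear_on (rep_space S) f" "bij_betw f (rep_space S) (rep_space R)"
    "\<And>g v. g \<in> carrier G \<Longrightarrow> v \<in> rep_space S \<Longrightarrow> f (rep_act S g v) = rep_act R g (f v)"
    using e unfolding rep_equiv_def by blast
  note sS = is_repD(1)[OF S]
  have inj: "inj_on f (rep_space S)" and surj: "f ` rep_space S = rep_space R"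
    using f(2) by (auto simp: bij_betw_def)
  have sub: "eigenvectors S L \<psi> \<subseteq> rep_space S" by (auto simp: eigenvectors_def)
  have "f v \<in> eigenvectors R L \<psi> \<longleftrightarrow> v \<in> eigenvectors S L \<psi>" if v: "v \<in> rep_space S" for v
  proof -
    have "rep_act R x (f v) = \<psi> x *\<^sub>C f v \<longleftrightarrow> rep_act S x v = \<psi> x *\<^sub>C v" if x: "x \<in> carrier L" for x
    proof -
      have xG: "x \<in> carrier G" using x LG by blast
      have "f (rep_act S x v) = f (\<psi> x *\<^sub>C v) \<longleftrightarrow> rep_act S x v = \<psi> x *\<^sub>C v"
        using inj_on_eq_iff[OF inj] is_repD(2)[OF S xG v] complex_vector.subspace_scale[OF sS v] by blast
      then show ?thesis using f(3)[OF xG v] linear_onD(2)[OF f(1) v] by simp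
    qed
    then show ?thesis using v surj by (auto simp: eigenvectors_def)
  qed
  then have "f ` eigenvectors S L \<psi> = eigenvectors R L \<psi>"
    using sub surj by (fastforce simp: eigenvectors_def)
  moreover have "linear_on (eigenvectors S L \<psi>) f"
    using f(1) sub unfolding linear_on_def by blast
  ultimately show ?thesis
    using linear_on_inj_image(1)[OF sE _ inj_on_subset[OF inj sub]] by metis
qed

lemma fin_dim_equiv:
  assumes "is_rep G S" "rep_equiv G S R" "fin_dim (rep_space R)" shows "fin_dim (rep_space S)"
  using assms linear_on_inj_image(2)[OF is_repD(1)[OF assms(1)]]
  unfolding rep_equiv_def bij_betw_def by metis

section \<open>Multiplicities as dimensions of spaces of biequivariant functions\<close>

context finite_group
begin

lemma sum_translate_right:
  assumes "g \<in> carrier G" shows "(\<Sum>x\<in>carrier G. f (x \<otimes> g)) = (\<Sum>x\<in>carrier G. f x)"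
proof (rule sum.reindex_bij_witness[where j = "\<lambda>x. x \<otimes> g" and i = "\<lambda>x. x \<otimes> inv g"])
  fix a assume "a \<in> carrier G"
  then show "a \<otimes> g \<otimes> inv g = a" "a \<otimes> g \<in> carrier G" "a \<otimes> inv g \<otimes> g = a" "a \<otimes> inv g \<in> carrier G"
    using assms by (simp_all add: m_assoc)
qed simp

text \<open>In a decomposition, a summand equivalent to \<open>T\<close> contains exactly one line
  of eigenvectors and any other summand none. The argument is made for every decomposition, so
  together with existence it shows that the definite description in \<open>rep_mult\<close> is
  meaningful.\<close>

lemma rep_mult_eq_dim_eigenvectors:
  fixes T :: "('a, 'v::complex_vector) rep" and V :: "('a, 'w::complex_vector) rep"
  assumes P: "group_below P G" and \<chi>: "linear_character P \<chi>"
    and dim1: "complex_vector.dim (eigenvectors (ind_rep (char_rep \<chi>) P G) P \<chi>) = 1"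
    and T: "is_rep G T" and TA: "rep_equiv G T (ind_rep (char_rep \<chi>) P G)"
    and V: "is_rep G V" and fd: "fin_dim (rep_space V)"
  shows "rep_mult G T V = complex_vector.dim (eigenvectors V P \<chi>)"
proof -
  let ?A = "ind_rep (char_rep \<chi>) P G"
  note rA = is_rep_A[OF P \<chi>] and irrA = irreducible_A[OF P \<chi> dim1]
  have PG: "carrier P \<subseteq> carrier G" using P by (simp add: group_below_def)
  have main: "card {W \<in> D. rep_equiv G T (subrep V W)} = complex_vector.dim (eigenvectors V P \<chi>)"
    if D: "irreducible_decomposition G V D" for D
  proof -
    have fD: "finite D" and inv: "\<And>W. W \<in> D \<Longrightarrow> invariant_subspace G V W"
      and irr: "\<And>W. W \<in> D \<Longrightarrow> irreducible_rep G (subrep V W)"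
      and dec: "\<And>v. v \<in> rep_space V \<Longrightarrow> \<exists>!f. f \<in> (\<Pi>\<^sub>E W\<in>D. W) \<and> v = (\<Sum>W\<in>D. f W)"
      using D unfolding irreducible_decomposition_def by simp_all
    note invD = invariant_subspaceD[OF inv]
    note sV = is_repD(1)[OF V]
    have uniq: "f X = f' X"
      if f: "\<And>W. W \<in> D \<Longrightarrow> f W \<in> W" and f': "\<And>W. W \<in> D \<Longrightarrow> f' W \<in> W"
        and eq: "(\<Sum>W\<in>D. f W) = (\<Sum>W\<in>D. f' W)" and X: "X \<in> D" for f f' :: "'w set \<Rightarrow> 'w" and X
    proof -
      have "(\<Sum>W\<in>D. f W) \<in> rep_space V"
        by (intro complex_vector.subspace_sum[OF sV]) (use f invD(2) in blast)
      from dec[OF this] obtain h where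
        "\<forall>h'. h' \<in> (\<Pi>\<^sub>E W\<in>D. W) \<and> (\<Sum>W\<in>D. f W) = (\<Sum>W\<in>D. h' W) \<longrightarrow> h' = h" by (rule ex1E)
      then have h: "h' = h" if "h' \<in> (\<Pi>\<^sub>E W\<in>D. W)" "(\<Sum>W\<in>D. f W) = (\<Sum>W\<in>D. h' W)" for h'
        using that by blast
      have "restrict f D = h" by (rule h) (use f in auto)
      moreover have "restrict f' D = h" by (rule h) (use f' eq in auto)
      ultimately have "restrict f D = restrict f' D" by simp
      then show ?thesis using X by (metis restrict_apply')
    qed
    have eW: "eigenvectors (subrep V W) P \<chi> = eigenvectors V P \<chi> \<inter> W" if "W \<in> D" for W
      using invD(2)[OF that] by (auto simp: eigenvectors_def)
    have equivA: "rep_equiv G T (subrep V W) \<longleftrightarrow> rep_equiv G ?A (subrep V W)" for W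
      using rep_equiv_trans[OF TA] rep_equiv_trans[OF rep_equiv_sym[OF T TA]] by blast
    define D1 where "D1 = {W \<in> D. rep_equiv G T (subrep V W)}"
    have D1D: "W \<in> D" if "W \<in> D1" for W using that by (simp add: D1_def)
    have fD1: "finite D1" using fD by (simp add: D1_def)
    have sE: "complex_vector.subspace (eigenvectors (subrep V W) P \<chi>)" if "W \<in> D" for W
      by (rule subspace_eigenvectors[OF P is_rep_subrep[OF V inv[OF that]]])
    have "\<exists>b. b \<in> eigenvectors (subrep V W) P \<chi> \<and> b \<noteq> 0 \<and> (\<forall>v\<in>eigenvectors (subrep V W) P \<chi>. \<exists>a. v = a *\<^sub>C b)"
      if W: "W \<in> D1" for W
    proof -
      have "complex_vector.dim (eigenvectors (subrep V W) P \<chi>) = 1"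
      proof -
        have "rep_equiv G ?A (subrep V W)" using W equivA by (simp add: D1_def)
        from eigenvectors_equiv[OF rA this PG subspace_eigenvectors[OF P rA]] dim1 show ?thesis by simp
      qed
      from dim_one_span[OF sE[OF D1D[OF W]] this] show ?thesis by metis
    qed
    then obtain w where w: "\<And>W. W \<in> D1 \<Longrightarrow> w W \<in> eigenvectors (subrep V W) P \<chi>" "\<And>W. W \<in> D1 \<Longrightarrow> w W \<noteq> 0"
      "\<And>W v. W \<in> D1 \<Longrightarrow> v \<in> eigenvectors (subrep V W) P \<chi> \<Longrightarrow> \<exists>a. v = a *\<^sub>C w W"
      by metis
    have wW: "w W \<in> W" if "W \<in> D1" for W using w(1)[OF that] eW[OF D1D[OF that]] by blast
    have z: "0 \<in> W" if "W \<in> D" for W by (rule complex_vector.subspace_0[OF invD(1)[OF that]])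
    \<comment> \<open>By reciprocity a nonzero eigenvector yields a nonzero intertwiner from the
      induced representation, which would be an equivalence.\<close>
    have triv: "v = 0" if W: "W \<in> D" "W \<notin> D1" and v: "v \<in> eigenvectors (subrep V W) P \<chi>" for W v
    proof (rule ccontr)
      assume "v \<noteq> 0"
      note I = induced_intertwiner[OF P \<chi> is_rep_subrep[OF V inv[OF W(1)]] v]
      have "rep_equiv G ?A (subrep V W)"
        by (rule irreducible_intertwiner_equiv[OF irrA irr[OF W(1)] I(1) I(2) I(3) delta_in_A[OF P \<chi>]])
          (use I(4) \<open>v \<noteq> 0\<close> P_card[OF P \<chi>] in simp_all)
      then show False using W equivA by (simp add: D1_def)
    qed
    have inj: "inj_on w D1"
    proof (rule inj_onI, rule ccontr)
      fix W W' assume W: "W \<in> D1" "W' \<in> D1" "w W = w W'" "W \<noteq> W'"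
      \<comment> \<open>A vector common to two summands would have two decompositions, one in each
        of them.\<close>
      let ?f = "\<lambda>Y X. if X = Y then w W else 0"
      have m: "w W \<in> W" "w W \<in> W'" using wW[OF W(1)] wW[OF W(2)] W(3) by simp_all
      have "?f W W = ?f W' W"
        by (rule uniq[of "?f W" "?f W'"]) (use m z D1D[OF W(1)] D1D[OF W(2)] fD in simp_all)
      then show False using W(4) w(2)[OF W(1)] by simp
    qed
    have "complex_vector.dim (eigenvectors V P \<chi>) = card D1"
    proof (rule complex_vector.dim_unique)
      show "w ` D1 \<subseteq> eigenvectors V P \<chi>" using w(1) eW D1D by blast
      show "card (w ` D1) = card D1" by (rule card_image[OF inj])
      show "complex_vector.independent (w ` D1)"
      proof (rule complex_vector.independent_if_scalars_zero)
        fix u b assume u: "(\<Sum>b\<in>w ` D1. u b *\<^sub>C b) = 0" and b: "b \<in> w ` D1"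
        then obtain W where W: "W \<in> D1" "b = w W" by blast
        let ?f = "\<lambda>X. if X \<in> D1 then u (w X) *\<^sub>C w X else 0"
        have "(\<Sum>X\<in>D. ?f X) = (\<Sum>X\<in>D1. u (w X) *\<^sub>C w X)"
          by (rule sum.mono_neutral_cong_right[OF fD]) (use D1D in auto)
        also have "\<dots> = 0" using u by (simp add: sum.reindex[OF inj])
        finally have s: "(\<Sum>X\<in>D. ?f X) = (\<Sum>X\<in>D. (\<lambda>_. 0) X)" by simp
        have "?f W = (\<lambda>_. 0) W"
          by (rule uniq[OF _ _ s])
            (use wW z D1D W complex_vector.subspace_scale[OF invD(1)] in auto)
        then show "u b = 0" using W w(2) by simp
      qed (use fD1 in simp)
      show "eigenvectors V P \<chi> \<subseteq> complex_vector.span (w ` D1)"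
      proof
        fix v assume v: "v \<in> eigenvectors V P \<chi>"
        then have vV: "v \<in> rep_space V" by (simp add: eigenvectors_def)
        from dec[OF vV] obtain f where f': "f \<in> (\<Pi>\<^sub>E W\<in>D. W) \<and> v = (\<Sum>W\<in>D. f W)" by (rule ex1E)
        then have f: "\<And>W. W \<in> D \<Longrightarrow> f W \<in> W" "v = (\<Sum>W\<in>D. f W)" by auto
        have fV: "f W \<in> rep_space V" if "W \<in> D" for W using f(1) invD(2) that by blast
        \<comment> \<open>The components of an eigenvector are eigenvectors: acting and scaling both
          preserve the summands, so uniqueness of components applies to the eigenvalue
          equation.\<close>
        have fE: "f W \<in> eigenvectors (subrep V W) P \<chi>" if W: "W \<in> D" for W
        proof -
          have "rep_act V x (f W) = \<chi> x *\<^sub>C f W" if x: "x \<in> carrier P" for x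
          proof -
            have xG: "x \<in> carrier G" using x PG by blast
            have "(\<Sum>W\<in>D. rep_act V x (f W)) = rep_act V x v"
              unfolding f(2) by (rule linear_on_sum[OF sV is_repD(3)[OF V xG] fV, symmetric])
            also have "\<dots> = \<chi> x *\<^sub>C v" using v x by (simp add: eigenvectors_def)
            also have "\<dots> = (\<Sum>W\<in>D. \<chi> x *\<^sub>C f W)" unfolding f(2) by (rule complex_vector.scale_sum_right)
            finally have s: "(\<Sum>W\<in>D. rep_act V x (f W)) = (\<Sum>W\<in>D. \<chi> x *\<^sub>C f W)" .
            show ?thesis
              by (rule uniq[OF _ _ s W])
                (use f(1) invD(3)[OF _ xG] complex_vector.subspace_scale[OF invD(1)] in auto)
          qed
          then show ?thesis using f(1)[OF W] by (simp add: eigenvectors_def)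
        qed
        have "f W \<in> complex_vector.span (w ` D1)" if W: "W \<in> D" for W
        proof (cases "W \<in> D1")
          case True
          then obtain a where "f W = a *\<^sub>C w W" using w(3) fE[OF W] by blast
          then show ?thesis using True by (auto intro: complex_vector.span_scale complex_vector.span_base)
        next
          case False
          then show ?thesis using triv[OF W _ fE[OF W]] complex_vector.span_zero by simp
        qed
        then show "v \<in> complex_vector.span (w ` D1)"
          unfolding f(2) by (rule complex_vector.span_sum)
      qed
    qed
    then show ?thesis by (simp add: D1_def)
  qed
  obtain D where D: "irreducible_decomposition G V D"
    using irreducible_decomposition_exists[OF V fd] by blast
  show ?thesis
    unfolding rep_mult_def
  proof (rule the_equality)
    show "\<exists>D. irreducible_decomposition G V D \<and>
        complex_vector.dim (eigenvectors V P \<chi>) = card {W \<in> D. rep_equiv G T (subrep V W)}"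
      using D main by metis
  qed (use main in metis)
qed

text \<open>Mackey's function space for intertwiners. The inverses on both sides come from the left
  translation action and from the equivariance condition in \<open>ind_rep\<close>.\<close>

definition biequivariant ::
  "'a monoid \<Rightarrow> ('a \<Rightarrow> complex) \<Rightarrow> 'a monoid \<Rightarrow> ('a \<Rightarrow> complex) \<Rightarrow> ('a \<Rightarrow> complex) set" where
  "biequivariant L \<psi> R \<chi> = {k. (\<forall>x. x \<notin> carrier G \<longrightarrow> k x = 0) \<and>
     (\<forall>x\<in>carrier G. \<forall>l\<in>carrier L. \<forall>r\<in>carrier R. k (l \<otimes> x \<otimes> r) = inverse (\<psi> l) * inverse (\<chi> r) * k x)}"

text \<open>The kernel \<open>K\<close> is that of averaging over \<open>L\<close> and
  \<open>R\<close> against the two characters, a projection onto the space. Its trace collects the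
  triples with \<open>l x r = x\<close>, weighted by the characters and divided by the two group
  orders.\<close>

lemma dim_biequivariant:
  assumes L: "group_below L G" "linear_character L \<psi>" and R: "group_below R G" "linear_character R \<chi>"
  shows "of_nat (complex_vector.dim (biequivariant L \<psi> R \<chi>) * (card (carrier L) * card (carrier R))) =
    (\<Sum>x\<in>carrier G. \<Sum>l\<in>carrier L. \<Sum>r\<in>carrier R. if l \<otimes> x \<otimes> r = x then \<psi> l * \<chi> r else 0)"
proof -
  define C :: complex where "C = of_nat (card (carrier L) * card (carrier R))"
  have C: "C \<noteq> 0" using P_card[OF L] P_card[OF R] by (simp add: C_def)
  define K where "K x y = (if x \<in> carrier G then inverse C *
    (\<Sum>l\<in>carrier L. \<Sum>r\<in>carrier R. if l \<otimes> x \<otimes> r = y then \<psi> l * \<chi> r else 0) else 0)" for x y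
  interpret L: finite_group L by (rule below_finite[OF L(1)])
  interpret R: finite_group R by (rule below_finite[OF R(1)])
  note LG = below_closed[OF L(1)] and RG = below_closed[OF R(1)]
  have "of_nat (complex_vector.dim (biequivariant L \<psi> R \<chi>)) = (\<Sum>x\<in>carrier G. K x x)"
  proof (rule dim_reproducing_kernel[where K = K])
    show "complex_vector.subspace (biequivariant L \<psi> R \<chi>)"
      unfolding complex_vector.subspace_def biequivariant_def by (auto simp: algebra_simps)
    show "finite (carrier G)" by (rule finite_carrier)
    show "k x = 0" if "k \<in> biequivariant L \<psi> R \<chi>" "x \<notin> carrier G" for k x
      using that by (simp add: biequivariant_def)
    fix y
    show "(\<lambda>x. K x y) \<in> biequivariant L \<psi> R \<chi>"
      unfolding biequivariant_def
    proof (intro CollectI conjI allI impI ballI)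
      fix x l' r' assume x: "x \<in> carrier G" and l': "l' \<in> carrier L" and r': "r' \<in> carrier R"
      let ?S = "\<lambda>x. \<Sum>l\<in>carrier L. \<Sum>r\<in>carrier R. if l \<otimes> x \<otimes> r = y then \<psi> l * \<chi> r else 0"
      have "?S x = (\<Sum>l\<in>carrier L. \<Sum>r\<in>carrier R. if (l \<otimes>\<^bsub>L\<^esub> l') \<otimes> x \<otimes> (r' \<otimes>\<^bsub>R\<^esub> r) = y
            then \<psi> (l \<otimes>\<^bsub>L\<^esub> l') * \<chi> (r' \<otimes>\<^bsub>R\<^esub> r) else 0)"
        by (subst L.sum_translate_right[OF l', symmetric], rule sum.cong[OF refl], rule R.sum_translate[OF r', symmetric])
      also have "\<dots> = (\<Sum>l\<in>carrier L. \<Sum>r\<in>carrier R. \<psi> l' * \<chi> r' * (if l \<otimes> (l' \<otimes> x \<otimes> r') \<otimes> r = y then \<psi> l * \<chi> r else 0))"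
        by (intro sum.cong refl) (use x l' r' in \<open>simp add: below_mult[OF L(1)] below_mult[OF R(1)] chi_mult[OF L] chi_mult[OF R] m_assoc LG RG\<close>)
      also have "\<dots> = \<psi> l' * \<chi> r' * ?S (l' \<otimes> x \<otimes> r')" by (simp only: sum_distrib_left)
      finally have S: "?S x = \<psi> l' * \<chi> r' * ?S (l' \<otimes> x \<otimes> r')" .
      have "inverse (\<psi> l') * inverse (\<chi> r') * (inverse C * (\<psi> l' * \<chi> r' * s)) = inverse C * s" for s
        using chi_nz[OF L l'] chi_nz[OF R r'] by (simp add: field_simps)
      then show "K (l' \<otimes> x \<otimes> r') y = inverse (\<psi> l') * inverse (\<chi> r') * K x y"
        using x l' r' by (simp add: K_def LG RG S)
    qed (simp add: K_def)
  next
    fix k x assume k: "k \<in> biequivariant L \<psi> R \<chi>" and x: "x \<in> carrier G"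
    have "(\<Sum>y\<in>carrier G. K x y * k y) =
        inverse C * (\<Sum>y\<in>carrier G. \<Sum>l\<in>carrier L. \<Sum>r\<in>carrier R. if l \<otimes> x \<otimes> r = y then \<psi> l * \<chi> r * k y else 0)"
      using x by (simp add: K_def sum_distrib_left sum_distrib_right mult.assoc if_distrib[of "\<lambda>z. z * _"]
          if_distrib[of "\<lambda>z. _ * z"] cong: if_cong)
    also have "(\<Sum>y\<in>carrier G. \<Sum>l\<in>carrier L. \<Sum>r\<in>carrier R. if l \<otimes> x \<otimes> r = y then \<psi> l * \<chi> r * k y else 0)
      = (\<Sum>l\<in>carrier L. \<Sum>r\<in>carrier R. \<Sum>y\<in>carrier G. if l \<otimes> x \<otimes> r = y then \<psi> l * \<chi> r * k y else 0)"
      by (subst sum.swap) (rule sum.cong[OF refl], rule sum.swap)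
    also have "\<dots> = (\<Sum>l\<in>carrier L. \<Sum>r\<in>carrier R. k x)"
    proof (intro sum.cong refl)
      fix l r assume l: "l \<in> carrier L" and r: "r \<in> carrier R"
      have "(\<Sum>y\<in>carrier G. if l \<otimes> x \<otimes> r = y then \<psi> l * \<chi> r * k y else 0) = \<psi> l * \<chi> r * k (l \<otimes> x \<otimes> r)"
        using l r x finite_carrier by (simp add: LG RG)
      also have "\<dots> = k x"
        using k l r x chi_nz[OF L l] chi_nz[OF R r] by (simp add: biequivariant_def field_simps)
      finally show "(\<Sum>y\<in>carrier G. if l \<otimes> x \<otimes> r = y then \<psi> l * \<chi> r * k y else 0) = k x" .
    qed
    also have "\<dots> = C * k x" by (simp add: C_def)
    finally show "k x = (\<Sum>y\<in>carrier G. K x y * k y)" using C by simp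
  qed
  then have "of_nat (complex_vector.dim (biequivariant L \<psi> R \<chi>)) * C = (\<Sum>x\<in>carrier G. K x x * C)"
    by (simp add: sum_distrib_right)
  also have "\<dots> = (\<Sum>x\<in>carrier G. \<Sum>l\<in>carrier L. \<Sum>r\<in>carrier R. if l \<otimes> x \<otimes> r = x then \<psi> l * \<chi> r else 0)"
    by (rule sum.cong[OF refl]) (use C in \<open>simp add: K_def\<close>)
  finally show ?thesis by (simp add: C_def)
qed

lemma eigenvectors_induced:
  assumes P: "group_below P G" "linear_character P \<chi>" and Q: "group_below Q G" "linear_character Q \<mu>"
  shows "eigenvectors (ind_rep (char_rep \<chi>) P G) Q \<mu> = biequivariant Q \<mu> P \<chi>"
proof (rule Set.set_eqI)
  fix k
  note PG = below_closed[OF P(1)] and QG = below_closed[OF Q(1)]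
  have one: "\<one> \<in> carrier P" "\<one> \<in> carrier Q" "\<chi> \<one> = 1" "\<mu> \<one> = 1"
    using P_one[OF P] P_one[OF Q] chi_one[OF P] chi_one[OF Q] by auto
  show "k \<in> eigenvectors (ind_rep (char_rep \<chi>) P G) Q \<mu> \<longleftrightarrow> k \<in> biequivariant Q \<mu> P \<chi>"
  proof
    assume k: "k \<in> eigenvectors (ind_rep (char_rep \<chi>) P G) Q \<mu>"
    then have kA: "k \<in> rep_space (ind_rep (char_rep \<chi>) P G)"
      and e: "\<And>q. q \<in> carrier Q \<Longrightarrow> rep_act (ind_rep (char_rep \<chi>) P G) q k = \<mu> q *\<^sub>C k"
      by (auto simp: eigenvectors_def)
    have left: "k (l \<otimes> x) = inverse (\<mu> l) * k x" if "x \<in> carrier G" "l \<in> carrier Q" for x l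
      using fun_cong[OF e[OF below_inv_closed[OF Q(1) that(2)]], of x] that
      by (simp add: ind_rep_act[OF P(1)] chi_inv[OF Q] QG)
    show "k \<in> biequivariant Q \<mu> P \<chi>"
      using kA left by (auto simp: biequivariant_def A_space[OF P] QG)
  next
    assume k: "k \<in> biequivariant Q \<mu> P \<chi>"
    then have b: "k (l \<otimes> x \<otimes> r) = inverse (\<mu> l) * inverse (\<chi> r) * k x"
      if "x \<in> carrier G" "l \<in> carrier Q" "r \<in> carrier P" for x l r
      using that by (auto simp: biequivariant_def)
    have z: "k x = 0" if "x \<notin> carrier G" for x using k that by (simp add: biequivariant_def)
    have "k \<in> rep_space (ind_rep (char_rep \<chi>) P G)"
      using b[OF _ one(2)] z one by (auto simp: A_space[OF P])
    moreover have "rep_act (ind_rep (char_rep \<chi>) P G) q k = \<mu> q *\<^sub>C k" if q: "q \<in> carrier Q" for q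
    proof
      fix x
      show "rep_act (ind_rep (char_rep \<chi>) P G) q k x = (\<mu> q *\<^sub>C k) x"
        using b[OF _ below_inv_closed[OF Q(1) q] one(1), of x] z[of x] one q below_inv_closed[OF Q(1) q]
        by (auto simp: ind_rep_act[OF P(1)] chi_inv[OF Q] QG)
    qed
    ultimately show "k \<in> eigenvectors (ind_rep (char_rep \<chi>) P G) Q \<mu>" by (simp add: eigenvectors_def)
  qed
qed

lemma group_below_trans:
  assumes "group_below Q H" "group_below H G" shows "group_below Q G"
  using assms unfolding group_below_def by (metis subset_iff)

text \<open>Here \<open>t\<close> is detected by its own pair \<open>(Q, \<mu>)\<close>.
  Eigenvectors of \<open>Q\<close> in the restriction are eigenvectors in \<open>T\<close>, and
  \<open>T\<close> may be exchanged for its induced model.\<close>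

lemma rep_mult_res:
  fixes T :: "('a, 'v::complex_vector) rep" and t :: "('a, 'w::complex_vector) rep"
  assumes H: "group_below H G"
    and P: "group_below P G" "linear_character P \<chi>" and Q: "group_below Q H" "linear_character Q \<mu>"
    and dim1: "complex_vector.dim (eigenvectors (ind_rep (char_rep \<mu>) Q H) Q \<mu>) = 1"
    and T: "is_rep G T" "rep_equiv G T (ind_rep (char_rep \<chi>) P G)"
    and t: "is_rep H t" "rep_equiv H t (ind_rep (char_rep \<mu>) Q H)"
  shows "of_nat (rep_mult H t (res_rep T H) * (card (carrier Q) * card (carrier P))) =
    (\<Sum>x\<in>carrier G. \<Sum>l\<in>carrier Q. \<Sum>r\<in>carrier P. if l \<otimes> x \<otimes> r = x then \<mu> l * \<chi> r else 0)"
proof -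
  interpret H: finite_group H by (rule below_finite[OF H])
  have QG: "group_below Q G" by (rule group_below_trans[OF Q(1) H])
  have QH: "carrier Q \<subseteq> carrier H" using Q by (simp add: group_below_def)
  have fT: "fin_dim (rep_space T)" by (rule fin_dim_equiv[OF T fin_dim_A[OF P]])
  have "rep_mult H t (res_rep T H) = complex_vector.dim (eigenvectors (res_rep T H) Q \<mu>)"
    by (rule H.rep_mult_eq_dim_eigenvectors[OF Q dim1 t is_rep_restrict[OF H T(1)]])
      (use fT in \<open>simp add: res_rep_def\<close>)
  also have "eigenvectors (res_rep T H) Q \<mu> = eigenvectors T Q \<mu>"
    using QH by (auto simp: eigenvectors_def res_rep_def)
  also have "complex_vector.dim (eigenvectors T Q \<mu>) = complex_vector.dim (eigenvectors (ind_rep (char_rep \<chi>) P G) Q \<mu>)"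
    by (rule eigenvectors_equiv[OF T _ subspace_eigenvectors[OF QG T(1)], symmetric])
      (use QG in \<open>simp add: group_below_def\<close>)
  also have "\<dots> = complex_vector.dim (biequivariant Q \<mu> P \<chi>)"
    by (simp only: eigenvectors_induced[OF P QG Q(2)])
  finally show ?thesis by (simp only: dim_biequivariant[OF QG Q(2) P])
qed

text \<open>By transitivity of induction, \<open>ind t\<close> is a space of scalar functions on the group:
  \<open>F\<close> corresponds to \<open>g \<mapsto> \<phi> (F g) \<one>\<close>, where \<open>\<phi>\<close> identifies \<open>t\<close> with an induced character.\<close>

lemma rep_mult_ind:
  fixes T :: "('a, 'v::complex_vector) rep" and t :: "('a, 'w::complex_vector) rep"
  assumes H: "group_below H G"
    and P: "group_below P G" "linear_character P \<chi>" and Q: "group_below Q H" "linear_character Q \<mu>"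
    and dim1: "complex_vector.dim (eigenvectors (ind_rep (char_rep \<chi>) P G) P \<chi>) = 1"
    and T: "is_rep G T" "rep_equiv G T (ind_rep (char_rep \<chi>) P G)"
    and t: "is_rep H t" "rep_equiv H t (ind_rep (char_rep \<mu>) Q H)"
  shows "of_nat (rep_mult G T (ind_rep t H G) * (card (carrier P) * card (carrier Q))) =
    (\<Sum>x\<in>carrier G. \<Sum>l\<in>carrier P. \<Sum>r\<in>carrier Q. if l \<otimes> x \<otimes> r = x then \<chi> l * \<mu> r else 0)"
proof -
  interpret H: finite_group H by (rule below_finite[OF H])
  let ?a = "ind_rep (char_rep \<mu>) Q H" and ?V = "ind_rep t H G"
  have QG: "group_below Q G" by (rule group_below_trans[OF Q(1) H])
  note HG = below_closed[OF H] and QH = H.below_closed[OF Q(1)] and PG = below_closed[OF P(1)]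
  note ra = H.is_rep_A[OF Q]
  have one: "\<one>\<^bsub>H\<^esub> = \<one>" "\<one> \<in> carrier H" using below_one[OF H] H.one_closed by auto
  have mH: "x \<otimes>\<^bsub>H\<^esub> y = x \<otimes> y" "inv\<^bsub>H\<^esub> x = inv x" "x \<otimes> y \<in> carrier H" "inv x \<in> carrier H"
    if "x \<in> carrier H" "y \<in> carrier H" for x y
    using below_mult[OF H that] below_inv[OF H that(1)] below_m_closed[OF H that] below_inv_closed[OF H that(1)] by auto
  have muinv: "\<mu> (inv q) = inverse (\<mu> q)" if "q \<in> carrier Q" for q
    using chi_inv[OF QG Q(2) that] .
  obtain \<phi> where \<phi>: "linear_on (rep_space t) \<phi>" "bij_betw \<phi> (rep_space t) (rep_space ?a)"
    "\<And>g v. g \<in> carrier H \<Longrightarrow> v \<in> rep_space t \<Longrightarrow> \<phi> (rep_act t g v) = rep_act ?a g (\<phi> v)"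
    using t(2) unfolding rep_equiv_def by blast
  note st = is_repD(1)[OF t(1)]
  have \<phi>_in: "\<phi> v \<in> rep_space ?a" if "v \<in> rep_space t" for v
    using \<phi>(2) that by (auto simp: bij_betw_def)
  have a_act: "rep_act ?a h f y = (if y \<in> carrier H then f (inv h \<otimes> y) else 0)" if "h \<in> carrier H" for h f y
    using that mH[of h y] mH[of "inv h" y] by (simp add: H.ind_rep_act[OF Q(1)])
  have V_space: "F \<in> rep_space ?V \<longleftrightarrow> (\<forall>x\<in>carrier G. F x \<in> rep_space t) \<and> (\<forall>x. x \<notin> carrier G \<longrightarrow> F x = 0) \<and>
      (\<forall>x\<in>carrier G. \<forall>h\<in>carrier H. F (x \<otimes> h) = rep_act t (inv h) (F x))" for F
    by (rule ind_rep_space[OF H])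
  have V_act: "rep_act ?V g F x = (if x \<in> carrier G then F (inv g \<otimes> x) else 0)" for g F x
    by (rule ind_rep_act[OF H])
  have a_space: "f \<in> rep_space ?a \<longleftrightarrow> (\<forall>x. x \<notin> carrier H \<longrightarrow> f x = 0) \<and>
      (\<forall>x\<in>carrier H. \<forall>q\<in>carrier Q. f (x \<otimes> q) = inverse (\<mu> q) * f x)" for f
    using H.A_space[OF Q] mH QH by auto
  have V0: "F x \<in> rep_space t" if "F \<in> rep_space ?V" for F x
    using that complex_vector.subspace_0[OF st] by (cases "x \<in> carrier G") (auto simp: V_space)
  define ev where "ev F = (\<lambda>g. \<phi> (F g) \<one>)" for F :: "'a \<Rightarrow> 'w"
  have \<phi>0: "\<phi> 0 = 0" using linear_on_sum[OF st \<phi>(1), of "{}"] by simp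
  \<comment> \<open>By equivariance under the middle group, the values of
    \<open>\<phi> (F g)\<close> at all points are values at the unit for translated arguments. Hence
    \<open>ev\<close> loses nothing.\<close>
  have ev_shift: "\<phi> (F g) h = ev F (g \<otimes> h)" if F: "F \<in> rep_space ?V" and g: "g \<in> carrier G" and h: "h \<in> carrier H" for F g h
  proof -
    have "F (g \<otimes> h) = rep_act t (inv h) (F g)" using F g h by (simp add: V_space)
    then have "ev F (g \<otimes> h) = rep_act ?a (inv h) (\<phi> (F g)) \<one>"
      using \<phi>(3)[of "inv h" "F g"] V0[OF F] mH[OF h h] by (simp add: ev_def)
    then show ?thesis using mH[OF h h] h one HG by (simp add: a_act)
  qed
  have lin: "linear_on (rep_space ?V) ev"
    using linear_onD[OF \<phi>(1)] V0 unfolding linear_on_def by (auto simp: ev_def fun_eq_iff)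
  have inj: "inj_on ev (rep_space ?V)"
  proof (rule inj_onI)
    fix F F' assume F: "F \<in> rep_space ?V" and F': "F' \<in> rep_space ?V" and e: "ev F = ev F'"
    have "F g = F' g" if g: "g \<in> carrier G" for g
    proof -
      have "\<phi> (F g) h = \<phi> (F' g) h" for h
      proof (cases "h \<in> carrier H")
        case True
        then show ?thesis using ev_shift[OF F g] ev_shift[OF F' g] e by simp
      next
        case False
        then show ?thesis using \<phi>_in[OF V0[OF F, of g]] \<phi>_in[OF V0[OF F', of g]] by (simp add: a_space)
      qed
      then have "\<phi> (F g) = \<phi> (F' g)" by (simp add: fun_eq_iff)
      then show ?thesis using \<phi>(2) V0[OF F] V0[OF F'] by (meson bij_betw_def inj_onD)
    qed
    moreover have "F g = F' g" if "g \<notin> carrier G" for g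
      using F F' that by (simp add: V_space)
    ultimately show "F = F'" by (auto simp: fun_eq_iff)
  qed
  have rV: "is_rep G ?V" by (rule is_rep_ind[OF H t(1)])
  note sV = is_repD(1)[OF rV]
  have fV: "fin_dim (rep_space ?V)"
  proof (rule linear_on_inj_image(2)[OF sV lin inj])
    show "fin_dim (ev ` rep_space ?V)"
      by (rule fin_dim_subset[OF fin_dim_finite_support[OF finite_carrier]])
        (auto simp: ev_def V_space \<phi>0)
  qed
  have sub: "eigenvectors ?V P \<chi> \<subseteq> rep_space ?V" by (auto simp: eigenvectors_def)
  have "ev ` eigenvectors ?V P \<chi> = biequivariant P \<chi> Q \<mu>"
  proof (intro equalityI subsetI)
    fix k assume "k \<in> ev ` eigenvectors ?V P \<chi>"
    then obtain F where FE: "F \<in> eigenvectors ?V P \<chi>" and k: "k = ev F" by blast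
    then have F: "F \<in> rep_space ?V" using sub by blast
    have "ev F (p \<otimes> x \<otimes> q) = inverse (\<chi> p) * inverse (\<mu> q) * ev F x"
      if x: "x \<in> carrier G" and p: "p \<in> carrier P" and q: "q \<in> carrier Q" for x p q
    proof -
      have "rep_act ?V (inv p) F = \<chi> (inv p) *\<^sub>C F"
        using FE below_inv_closed[OF P(1) p] by (simp add: eigenvectors_def)
      from fun_cong[OF this, of x] have px: "F (p \<otimes> x) = inverse (\<chi> p) *\<^sub>C F x"
        using x p PG by (simp add: V_act chi_inv[OF P])
      have "ev F (p \<otimes> x \<otimes> q) = \<phi> (F (p \<otimes> x)) q"
        using ev_shift[OF F, of "p \<otimes> x" q] x p q PG QH by simp
      also have "\<dots> = \<phi> (F (p \<otimes> x)) (\<one> \<otimes> q)" using q QH HG by simp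
      also have "\<dots> = inverse (\<mu> q) * \<phi> (F (p \<otimes> x)) \<one>"
        using \<phi>_in[OF V0[OF F, of "p \<otimes> x"]] one q by (simp only: a_space)
      also have "\<phi> (F (p \<otimes> x)) = inverse (\<chi> p) *\<^sub>C \<phi> (F x)"
        unfolding px by (rule linear_onD(2)[OF \<phi>(1) V0[OF F]])
      finally show ?thesis by (simp add: ev_def)
    qed
    then show "k \<in> biequivariant P \<chi> Q \<mu>"
      using F by (auto simp: biequivariant_def k V_space ev_def \<phi>0)
  next
    fix k assume k: "k \<in> biequivariant P \<chi> Q \<mu>"
    have kb: "k (p \<otimes> x \<otimes> q) = inverse (\<chi> p) * inverse (\<mu> q) * k x"
      if "x \<in> carrier G" "p \<in> carrier P" "q \<in> carrier Q" for x p q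
      using k that by (auto simp: biequivariant_def)
    have k0: "k x = 0" if "x \<notin> carrier G" for x using k that by (simp add: biequivariant_def)
    have oneP: "\<one> \<in> carrier P" "\<chi> \<one> = 1" and oneQ: "\<one> \<in> carrier Q" "\<mu> \<one> = 1"
      using P_one[OF P] P_one[OF QG Q(2)] chi_one[OF P] chi_one[OF QG Q(2)] by auto
    \<comment> \<open>The function that \<open>\<phi> (F g)\<close> is forced to be by
      \<open>ev_shift\<close> when \<open>ev F = k\<close>.\<close>
    define f where "f g = (\<lambda>h. if h \<in> carrier H then k (g \<otimes> h) else 0)" for g
    have fa: "f g \<in> rep_space ?a" if g: "g \<in> carrier G" for g
    proof -
      have "k (g \<otimes> (x \<otimes> q)) = inverse (\<mu> q) * k (g \<otimes> x)" if "x \<in> carrier H" "q \<in> carrier Q" for x q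
        using kb[of "g \<otimes> x" \<one> q] that g HG QH oneP by (simp add: m_assoc)
      then show ?thesis using mH QH by (auto simp: a_space f_def)
    qed
    let ?i = "inv_into (rep_space t) \<phi>"
    have i: "?i v \<in> rep_space t" "\<phi> (?i v) = v" if "v \<in> rep_space ?a" for v
      using that \<phi>(2) by (auto simp: bij_betw_def inv_into_into f_inv_into_f)
    have ilin: "linear_on (rep_space ?a) ?i" by (rule linear_on_inv_into[OF st \<phi>(1,2)])
    have iphi: "?i (\<phi> v) = v" if "v \<in> rep_space t" for v
      using that \<phi>(2) by (simp add: bij_betw_def)
    define F where "F g = (if g \<in> carrier G then ?i (f g) else 0)" for g
    have "F \<in> rep_space ?V"
      unfolding V_space
    proof (intro conjI ballI allI impI)
      show "F x \<in> rep_space t" if "x \<in> carrier G" for x using that i fa by (simp add: F_def)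
      show "F x = 0" if "x \<notin> carrier G" for x using that by (simp add: F_def)
      fix x h assume x: "x \<in> carrier G" and h: "h \<in> carrier H"
      have "f (x \<otimes> h) = rep_act ?a (inv h) (f x)"
        using x h mH[OF h h] mH(3)[OF h] HG by (auto simp: a_act f_def fun_eq_iff m_assoc)
      also have "\<dots> = \<phi> (rep_act t (inv h) (?i (f x)))"
        using \<phi>(3)[of "inv h" "?i (f x)"] i fa[OF x] mH[OF h h] by simp
      finally have "?i (f (x \<otimes> h)) = rep_act t (inv h) (?i (f x))"
        using iphi is_repD(2)[OF t(1)] i fa[OF x] mH[OF h h] by simp
      then show "F (x \<otimes> h) = rep_act t (inv h) (F x)" using x h HG by (simp add: F_def)
    qed
    moreover have "rep_act ?V p F = \<chi> p *\<^sub>C F" if p: "p \<in> carrier P" for p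
    proof
      fix x
      show "rep_act ?V p F x = (\<chi> p *\<^sub>C F) x"
      proof (cases "x \<in> carrier G")
        case x: True
        note p' = below_inv_closed[OF P(1) p]
        have "k (inv p \<otimes> x \<otimes> h) = \<chi> p * k (x \<otimes> h)" if "h \<in> carrier H" for h
          using kb[of "x \<otimes> h" "inv p" \<one>] x p p' oneQ PG HG that by (simp add: chi_inv[OF P] m_assoc)
        then have "f (inv p \<otimes> x) = \<chi> p *\<^sub>C f x" by (auto simp: f_def fun_eq_iff)
        then show ?thesis
          using x p PG linear_onD(2)[OF ilin fa[OF x]] by (simp add: V_act F_def)
      qed (simp add: V_act F_def)
    qed
    ultimately have "F \<in> eigenvectors ?V P \<chi>" by (simp add: eigenvectors_def)
    moreover have "ev F = k"
      using i(2)[OF fa] one k0 by (auto simp: ev_def F_def \<phi>0 f_def fun_eq_iff)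
    ultimately show "k \<in> ev ` eigenvectors ?V P \<chi>" by blast
  qed
  moreover have "linear_on (eigenvectors ?V P \<chi>) ev"
    using lin sub unfolding linear_on_def by blast
  ultimately have "complex_vector.dim (biequivariant P \<chi> Q \<mu>) = complex_vector.dim (eigenvectors ?V P \<chi>)"
    using linear_on_inj_image(1)[OF subspace_eigenvectors[OF P(1) rV] _ inj_on_subset[OF inj sub]] by metis
  also have "\<dots> = rep_mult G T ?V"
    by (rule rep_mult_eq_dim_eigenvectors[OF P dim1 T rV fV, symmetric])
  finally show ?thesis by (simp only: dim_biequivariant[OF P QG Q(2), symmetric])
qed

end

section \<open>Coadjoint orbits\<close>

lemma finite_carrier_mat: "finite (carrier_mat n m :: 'a::finite mat set)"
proof (rule finite_imageD)
  let ?f = "\<lambda>A :: 'a mat. restrict (\<lambda>ij. A $$ ij) ({..<n} \<times> {..<m})"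
  have "?f ` carrier_mat n m \<subseteq> ({..<n} \<times> {..<m}) \<rightarrow>\<^sub>E UNIV"
    unfolding PiE_def by (auto intro: restrict_extensional)
  then show "finite (?f ` carrier_mat n m)"
    by (rule finite_subset) (intro finite_PiE; simp)
  show "inj_on ?f (carrier_mat n m)"
  proof (rule inj_onI)
    fix A B :: "'a mat" assume A: "A \<in> carrier_mat n m" "B \<in> carrier_mat n m" "?f A = ?f B"
    show "A = B"
    proof (rule eq_matI)
      fix i j assume ij: "i < dim_row B" "j < dim_col B"
      have "?f A (i, j) = ?f B (i, j)" by (simp only: A(3))
      then show "A $$ (i, j) = B $$ (i, j)" using A(1,2) ij by simp
    qed (use A in auto)
  qed
qed

lemma bracket_add_left: "x \<in> carrier_mat n n \<Longrightarrow> y \<in> carrier_mat n n \<Longrightarrow> z \<in> carrier_mat n n \<Longrightarrow>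
    bracket (x + y) z = bracket x z + bracket y z"
  by (simp add: bracket_def add_mult_distrib_mat[of _ n n] mult_add_distrib_mat[of _ n n])
    (intro eq_matI; simp)

lemma bracket_smult_left: "x \<in> carrier_mat n n \<Longrightarrow> z \<in> carrier_mat n n \<Longrightarrow>
    bracket (a \<cdot>\<^sub>m x) z = a \<cdot>\<^sub>m bracket x z"
  by (simp add: bracket_def mult_smult_distrib[of _ n n] mult_smult_assoc_mat[of _ n n])
    (intro eq_matI; simp add: right_diff_distrib)

lemma bracket_swap: "x \<in> carrier_mat n n \<Longrightarrow> z \<in> carrier_mat n n \<Longrightarrow> bracket z x = (-1) \<cdot>\<^sub>m bracket x z"
  unfolding bracket_def by (intro eq_matI) auto

section \<open>Additive characters and their orthogonality\<close>

locale additive_character =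
  fixes e :: "'k::{field,finite} \<Rightarrow> complex"
  assumes character: "nontrivial_additive_character e"
begin

lemma e_nz: "e a \<noteq> 0"
  and e_add: "e (a + b) = e a * e b"
  and e_nontrivial: "\<exists>a. e a \<noteq> 1"
  using character unfolding nontrivial_additive_character_def by auto

lemma e_zero: "e 0 = 1"
  using e_add[of 0 0] e_nz[of 0] by simp

lemma e_scale_nontrivial: "a \<noteq> 0 \<Longrightarrow> \<exists>b. e (b * a) \<noteq> 1"
  using e_nontrivial by (metis nonzero_eq_divide_eq)

text \<open>A permutation of the index set that multiplies every summand by the same
  \<open>z \<noteq> 1\<close> leaves the sum unchanged and multiplies it by
  \<open>z\<close>.\<close>

lemma sum_character_zero:
  assumes "bij_betw \<tau> S S" "\<And>s. s \<in> S \<Longrightarrow> f (\<tau> s) = z * (f s :: complex)" "z \<noteq> 1"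
  shows "(\<Sum>s\<in>S. f s) = 0"
proof -
  have "(\<Sum>s\<in>S. f s) = (\<Sum>s\<in>S. f (\<tau> s))" by (rule sum.reindex_bij_betw[OF assms(1), symmetric])
  also have "\<dots> = z * (\<Sum>s\<in>S. f s)" using assms(2) by (simp add: sum_distrib_left)
  finally show ?thesis using assms(3) by simp
qed

text \<open>The traces pair one character with the inverse of the other, so the results on
  \<open>e\<close> have to be available for its inverse as well.\<close>

lemma inverse_character: "additive_character (\<lambda>a. e (- a))"
proof
  obtain a where "e (- (- a)) \<noteq> 1" using e_nontrivial by auto
  then have "\<exists>a. e (- a) \<noteq> 1" by (rule exI)
  moreover have "e (- (a + b)) = e (- a) * e (- b)" for a b
    using e_add[of "- a" "- b"] by simp
  ultimately show "nontrivial_additive_character (\<lambda>a. e (- a))"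
    unfolding nontrivial_additive_character_def using e_nz by simp
qed

text \<open>The character may be trivial at a particular nonzero value of \<open>m\<close>, but the
  scalar multiples of that value fill the field. Translation by a suitable multiple of
  \<open>x\<close> therefore changes the sum by a factor different from 1.\<close>

lemma sum_character_subspace:
  assumes U: "mat_subspace N U"
    and add: "\<And>x y. x \<in> U \<Longrightarrow> y \<in> U \<Longrightarrow> m (x + y) = m x + m y"
    and smult: "\<And>a x. x \<in> U \<Longrightarrow> m (a \<cdot>\<^sub>m x) = a * m x"
  shows "(\<Sum>x\<in>U. e (m x)) = (if \<forall>x\<in>U. m x = 0 then of_nat (card U) else 0)"
proof (cases "\<forall>x\<in>U. m x = 0")
  case True
  then show ?thesis by (simp add: e_zero)
next
  case False
  then obtain x a where x: "x \<in> U" "e (a * m x) \<noteq> 1" using e_scale_nontrivial by blast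
  have Uc: "U \<subseteq> carrier_mat N N" and cl: "\<And>y z. y \<in> U \<Longrightarrow> z \<in> U \<Longrightarrow> y + z \<in> U" "\<And>y a. y \<in> U \<Longrightarrow> a \<cdot>\<^sub>m y \<in> U"
    using U unfolding mat_subspace_def by auto
  have "bij_betw (\<lambda>y. y + a \<cdot>\<^sub>m x) U U"
  proof (rule bij_betw_byWitness[where f' = "\<lambda>y. y + (- a) \<cdot>\<^sub>m x"])
    have "y + b \<cdot>\<^sub>m x + - b \<cdot>\<^sub>m x = y" if "y \<in> U" for y b
    proof -
      have "x \<in> carrier_mat N N" "y \<in> carrier_mat N N" using Uc x that by auto
      then show ?thesis by (intro eq_matI) auto
    qed
    from this[of _ a] this[of _ "- a"]
    show "\<forall>y\<in>U. y + a \<cdot>\<^sub>m x + - a \<cdot>\<^sub>m x = y" "\<forall>y\<in>U. y + - a \<cdot>\<^sub>m x + a \<cdot>\<^sub>m x = y"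
      by simp_all
  qed (use x cl in auto)
  from sum_character_zero[OF this, of "\<lambda>x. e (m x)" "e (a * m x)"] x False show ?thesis
    by (auto simp: add cl smult e_add mult.commute)
qed

end

section \<open>The finite group and its coadjoint action\<close>

locale finite_matrix_lie_algebra = matrix_lie_algebra N g
  for N and g :: "'k::{field,finite} mat set"
begin

abbreviation G :: "'k mat monoid" where "G \<equiv> exp_group N g"

text \<open>Conjugation by the inverse, applied both to Lie algebra and to group elements. It is a
  right action, which makes the coadjoint action on forms a left action.\<close>

definition cj :: "'k mat \<Rightarrow> 'k mat \<Rightarrow> 'k mat" where "cj u x = inv\<^bsub>G\<^esub> u * x * u"

lemma g_finite: "finite g"
  using finite_subset[OF _ finite_carrier_mat] g_carrier by blast

lemma mat_subspace_g: "mat_subspace N g"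
  using g by (simp add: lie_subalgebra_def)

lemma carrier_G: "carrier G = E ` g" and mult_G [simp]: "x \<otimes>\<^bsub>G\<^esub> y = x * y" and one_G [simp]: "\<one>\<^bsub>G\<^esub> = 1\<^sub>m N"
  by (simp_all add: exp_group_def)

lemma exp_carrier: "x \<in> g \<Longrightarrow> E x \<in> carrier_mat N N"
  using exp_uptri g_ut uptri_carrier by blast

lemma G_carrier: "u \<in> carrier G \<Longrightarrow> u \<in> carrier_mat N N"
  using exp_carrier carrier_G by auto

sublocale G: finite_group G
proof (intro finite_group.intro groupI finite_group_axioms.intro)
  fix x y z assume x: "x \<in> carrier G"
  then show "\<exists>y\<in>carrier G. y \<otimes>\<^bsub>G\<^esub> x = \<one>\<^bsub>G\<^esub>"
    using exp_uminus g_uminus by (auto simp: carrier_G)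
  show "\<one>\<^bsub>G\<^esub> \<otimes>\<^bsub>G\<^esub> x = x" using G_carrier[OF x] by simp
  assume y: "y \<in> carrier G"
  then show "x \<otimes>\<^bsub>G\<^esub> y \<in> carrier G" using exp_mult_closed x by (auto simp: carrier_G)
  assume z: "z \<in> carrier G"
  show "x \<otimes>\<^bsub>G\<^esub> y \<otimes>\<^bsub>G\<^esub> z = x \<otimes>\<^bsub>G\<^esub> (y \<otimes>\<^bsub>G\<^esub> z)"
    using G_carrier[OF x] G_carrier[OF y] G_carrier[OF z] by (simp add: assoc_mult_mat[of _ N N _ N _ N])
next
  show "\<one>\<^bsub>G\<^esub> \<in> carrier G" using exp_zero g_zero by (metis carrier_G imageI one_G)
  show "finite (carrier G)" using g_finite by (simp add: carrier_G)
qed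

lemma inv_exp: "x \<in> g \<Longrightarrow> inv\<^bsub>G\<^esub> (E x) = E (- x)"
  using exp_uminus[of x] g_uminus[of x] by (intro G.inv_equality) (auto simp: carrier_G)

lemma exp_inj_g: "inj_on E g"
  using exp_inj g_ut inj_on_subset by blast

lemma bij_exp: "bij_betw E g (carrier G)"
  using exp_inj_g by (simp add: bij_betw_def carrier_G)

lemma card_G: "card (carrier G) = card g"
  using bij_betw_same_card[OF bij_exp] by simp

lemma uminus_uminus_g: "x \<in> g \<Longrightarrow> - (- x) = (x :: 'k mat)"
  by (auto intro: eq_matI)

lemma cj_exp: "x \<in> g \<Longrightarrow> cj (E x) y = E (- x) * y * E (- (- x))"
  using inv_exp uminus_uminus_g by (simp add: cj_def)

lemma cj_in: assumes u: "u \<in> carrier G" and y: "y \<in> g" shows "cj u y \<in> g"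
proof -
  obtain x where x: "x \<in> g" "u = E x" using u carrier_G by auto
  show ?thesis using conj_in[OF g_uminus[OF x(1)] y] cj_exp[OF x(1), of y] x(2) by simp
qed

lemma exp_cj: assumes u: "u \<in> carrier G" and y: "y \<in> g" shows "E (cj u y) = cj u (E y)"
proof -
  obtain x where x: "x \<in> g" "u = E x" using u carrier_G by auto
  show ?thesis using exp_conj[OF g_uminus[OF x(1)] y] cj_exp[OF x(1)] x(2) by simp
qed

lemma inv_carrier: "u \<in> carrier G \<Longrightarrow> inv\<^bsub>G\<^esub> u \<in> carrier_mat N N"
  using G_carrier G.inv_closed by blast

lemma inv_mult_G: "u \<in> carrier G \<Longrightarrow> u * inv\<^bsub>G\<^esub> u = 1\<^sub>m N" "u \<in> carrier G \<Longrightarrow> inv\<^bsub>G\<^esub> u * u = 1\<^sub>m N"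
  using G.r_inv G.l_inv by simp_all

lemma mult_inv_cancel:
  assumes u: "u \<in> carrier G" and s: "s \<in> carrier G"
  shows "u * (inv\<^bsub>G\<^esub> u * s) = s" "inv\<^bsub>G\<^esub> u * (u * s) = s"
  using G.m_assoc[of u "inv\<^bsub>G\<^esub> u" s] G.m_assoc[of "inv\<^bsub>G\<^esub> u" u s] inv_mult_G[OF u] left_mult_one_mat[OF G_carrier[OF s]] assms
  by simp_all

lemma cj_mult:
  assumes u: "u \<in> carrier G" and v: "v \<in> carrier G" and y: "y \<in> carrier_mat N N"
  shows "cj (u * v) y = cj v (cj u y)"
proof -
  have "inv\<^bsub>G\<^esub> (u * v) = inv\<^bsub>G\<^esub> v * inv\<^bsub>G\<^esub> u" using G.inv_mult_group[OF u v] by simp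
  then show ?thesis
    using G_carrier[OF u] G_carrier[OF v] inv_carrier[OF u] inv_carrier[OF v] y
    by (simp add: cj_def assoc_mult_mat[of _ N N _ N _ N])
qed

lemma cj_one: "y \<in> carrier_mat N N \<Longrightarrow> cj (1\<^sub>m N) y = y"
  using G.inv_one by (simp add: cj_def)

lemma cj_inv_cj: "u \<in> carrier G \<Longrightarrow> y \<in> carrier_mat N N \<Longrightarrow> cj (inv\<^bsub>G\<^esub> u) (cj u y) = y"
  using cj_mult[of u "inv\<^bsub>G\<^esub> u" y] inv_mult_G(1)[of u] cj_one[of y] by simp

lemma cj_cj_inv: "u \<in> carrier G \<Longrightarrow> y \<in> carrier_mat N N \<Longrightarrow> cj u (cj (inv\<^bsub>G\<^esub> u) y) = y"
  using cj_inv_cj[of "inv\<^bsub>G\<^esub> u" y] by simp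

lemma cj_add:
  assumes u: "u \<in> carrier G" and "x \<in> carrier_mat N N" "y \<in> carrier_mat N N"
  shows "cj u (x + y) = cj u x + cj u y"
  using assms G_carrier[OF u] inv_carrier[OF u]
  by (simp add: cj_def mult_add_distrib_mat[of _ N N _ N] add_mult_distrib_mat[of _ N N _ _ N])

lemma cj_smult:
  assumes u: "u \<in> carrier G" and "x \<in> carrier_mat N N"
  shows "cj u (a \<cdot>\<^sub>m x) = a \<cdot>\<^sub>m cj u x"
  using assms G_carrier[OF u] inv_carrier[OF u]
  by (simp add: cj_def mult_smult_distrib[of _ N N _ N] mult_smult_assoc_mat[of _ N N _ N])

lemma bij_cj: "u \<in> carrier G \<Longrightarrow> bij_betw (cj u) g g"
  by (rule bij_betw_byWitness[where f' = "cj (inv\<^bsub>G\<^esub> u)"])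
    (auto simp: cj_inv_cj cj_cj_inv g_carrier cj_in)

lemma dualD:
  assumes "m \<in> dual g"
  shows "m \<in> extensional g" "x \<in> g \<Longrightarrow> y \<in> g \<Longrightarrow> m (x + y) = m x + m y" "x \<in> g \<Longrightarrow> m (a \<cdot>\<^sub>m x) = a * m x"
  using assms by (auto simp: dual_def)

lemma coadjoint_in_dual: "u \<in> carrier G \<Longrightarrow> m \<in> dual g \<Longrightarrow> coadjoint N g u m \<in> dual g"
  unfolding dual_def coadjoint_def cj_def[symmetric]
  using g_add g_smult g_carrier cj_add cj_smult cj_in by auto

lemma coadjoint_apply: "x \<in> g \<Longrightarrow> coadjoint N g u m x = m (cj u x)"
  by (simp add: coadjoint_def cj_def)

lemma coadjoint_mult:
  assumes "u \<in> carrier G" "v \<in> carrier G"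
  shows "coadjoint N g (u * v) m = coadjoint N g u (coadjoint N g v m)"
  unfolding coadjoint_def cj_def[symmetric] using assms cj_in cj_mult g_carrier by (auto simp: fun_eq_iff)

lemma coadjoint_one: "m \<in> dual g \<Longrightarrow> coadjoint N g (1\<^sub>m N) m = m"
  by (rule extensionalityI[where A = g])
    (use cj_one g_carrier dualD(1) in \<open>auto simp: coadjoint_def cj_def[symmetric]\<close>)

lemma dual_finite: "finite (dual g)"
proof (rule finite_subset)
  show "dual g \<subseteq> g \<rightarrow>\<^sub>E UNIV" by (auto simp: dual_def PiE_def)
qed (use g_finite in \<open>intro finite_PiE; simp\<close>)

lemma subalgebra:
  assumes "lie_subalgebra N h g" shows "finite_matrix_lie_algebra N h" "h \<subseteq> g"
    "group_below (exp_group N h) G"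
proof -
  have "h \<subseteq> ut N" using assms g unfolding lie_subalgebra_def by blast
  then have "lie_subalgebra N h (ut N)" using assms unfolding lie_subalgebra_def by blast
  then show h: "finite_matrix_lie_algebra N h"
    using N1 char by (simp add: finite_matrix_lie_algebra_def matrix_lie_algebra_def)
  show hg: "h \<subseteq> g" using assms unfolding lie_subalgebra_def by blast
  interpret h: finite_matrix_lie_algebra N h by (rule h)
  show "group_below (exp_group N h) G"
    unfolding group_below_def using h.G.is_group hg by (auto simp: h.carrier_G carrier_G)
qed

text \<open>A weighted orbit-stabilizer identity: the fibres of the orbit map are left cosets of the
  stabilizer. It is stated for a subgroup because it is needed for \<open>P\<close> as well as for
  the whole group.\<close>

lemma sum_stabilizer:
  assumes K: "group_below K G" and m: "m \<in> dual g"
  shows "(\<Sum>s\<in>carrier K. f (coadjoint N g s m)) =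
    of_nat (card {s \<in> carrier K. coadjoint N g s m = m}) * (\<Sum>\<nu>\<in>(\<lambda>s. coadjoint N g s m) ` carrier K. f \<nu> :: complex)"
proof -
  let ?a = "\<lambda>s. coadjoint N g s m"
  interpret K: finite_group K by (rule G.below_finite[OF K])
  note KG = G.below_closed[OF K]
  have fib: "card {s \<in> carrier K. ?a s = ?a u} = card {s \<in> carrier K. ?a s = m}" if u: "u \<in> carrier K" for u
  proof (rule bij_betw_same_card[OF bij_betw_byWitness[where f = "\<lambda>s. inv\<^bsub>G\<^esub> u * s" and f' = "\<lambda>s. u * s"]])
    have uG: "u \<in> carrier G" and iK: "inv\<^bsub>G\<^esub> u \<in> carrier K"
      using KG u G.below_inv_closed[OF K] by auto
    have cl: "x * y \<in> carrier K" if "x \<in> carrier K" "y \<in> carrier K" for x y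
      using G.below_m_closed[OF K that] by simp
    show "\<forall>s\<in>{s \<in> carrier K. ?a s = ?a u}. u * (inv\<^bsub>G\<^esub> u * s) = s"
      "\<forall>s\<in>{s \<in> carrier K. ?a s = m}. inv\<^bsub>G\<^esub> u * (u * s) = s"
      using mult_inv_cancel[OF uG KG] by auto
    have "?a (inv\<^bsub>G\<^esub> u * s) = m" if "s \<in> carrier K" "?a s = ?a u" for s
    proof -
      have "?a (inv\<^bsub>G\<^esub> u * s) = ?a (inv\<^bsub>G\<^esub> u * u)"
        unfolding coadjoint_mult[OF G.inv_closed[OF uG] KG[OF that(1)]]
          coadjoint_mult[OF G.inv_closed[OF uG] uG] that(2) ..
      then show ?thesis by (simp only: inv_mult_G(2)[OF uG] coadjoint_one[OF m])
    qed
    then show "(\<lambda>s. inv\<^bsub>G\<^esub> u * s) ` {s \<in> carrier K. ?a s = ?a u} \<subseteq> {s \<in> carrier K. ?a s = m}"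
      using cl iK by auto
    show "(\<lambda>s. u * s) ` {s \<in> carrier K. ?a s = m} \<subseteq> {s \<in> carrier K. ?a s = ?a u}"
      using cl u coadjoint_mult[OF uG] KG by auto
  qed
  have "(\<Sum>s\<in>carrier K. f (?a s)) = (\<Sum>\<nu>\<in>?a ` carrier K. \<Sum>s\<in>{s \<in> carrier K. ?a s = \<nu>}. f (?a s))"
    by (rule sum.image_gen[OF K.finite_carrier])
  also have "\<dots> = (\<Sum>\<nu>\<in>?a ` carrier K. of_nat (card {s \<in> carrier K. ?a s = \<nu>}) * f \<nu>)"
    by (rule sum.cong[OF refl]) simp
  also have "\<dots> = (\<Sum>\<nu>\<in>?a ` carrier K. of_nat (card {s \<in> carrier K. ?a s = m}) * f \<nu>)"
    by (rule sum.cong[OF refl]) (auto simp: fib)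
  finally show ?thesis by (simp add: sum_distrib_left)
qed

end

section \<open>A linear form with a polarization: radical, stabilizer and orbits\<close>

locale polarized_form = finite_matrix_lie_algebra N g + additive_character e
  for N and g :: "'k::{field,finite} mat set" and e :: "'k \<Rightarrow> complex" +
  fixes l :: "'k mat \<Rightarrow> 'k" and p :: "'k mat set"
  assumes l: "l \<in> dual g" and polarization: "polarization N g l p"
begin

abbreviation P :: "'k mat monoid" where "P \<equiv> exp_group N p"

text \<open>The radical of the skew form of \<open>l\<close>; its exponentials turn out to be the
  stabilizer of \<open>l\<close>.\<close>

definition rad :: "'k mat set" where
  "rad = {x \<in> g. \<forall>y\<in>g. l (bracket x y) = 0}"

definition orbit :: "('k mat \<Rightarrow> 'k) set" where
  "orbit = (\<lambda>s. coadjoint N g s l) ` carrier G"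

lemma p_subalgebra: "lie_subalgebra N p g"
  using polarization by (simp add: polarization_def)

sublocale p: finite_matrix_lie_algebra N p
  by (rule subalgebra(1)[OF p_subalgebra])

lemma p_g: "x \<in> p \<Longrightarrow> x \<in> g"
  using subalgebra(2)[OF p_subalgebra] by blast

lemmas P_below = subalgebra(3)[OF p_subalgebra]

lemma l_add: "x \<in> g \<Longrightarrow> y \<in> g \<Longrightarrow> l (x + y) = l x + l y"
  and l_smult: "x \<in> g \<Longrightarrow> l (a \<cdot>\<^sub>m x) = a * l x"
  using dualD[OF l] by auto

lemma form_add_left: "x \<in> g \<Longrightarrow> y \<in> g \<Longrightarrow> z \<in> g \<Longrightarrow> l (bracket (x + y) z) = l (bracket x z) + l (bracket y z)"
  using bracket_add_left[of x N y z] g_carrier g_bracket l_add by simp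

lemma form_smult_left: "x \<in> g \<Longrightarrow> z \<in> g \<Longrightarrow> l (bracket (a \<cdot>\<^sub>m x) z) = a * l (bracket x z)"
  using bracket_smult_left[of x N z a] g_carrier g_bracket l_smult by simp

lemma form_swap: "x \<in> g \<Longrightarrow> z \<in> g \<Longrightarrow> l (bracket z x) = - l (bracket x z)"
  using bracket_swap[of x N z] g_carrier g_bracket l_smult[of "bracket x z" "-1"] by simp

lemma form_add_right: "x \<in> g \<Longrightarrow> y \<in> g \<Longrightarrow> z \<in> g \<Longrightarrow> l (bracket z (x + y)) = l (bracket z x) + l (bracket z y)"
  using form_swap[of z "x + y"] form_swap[of z x] form_swap[of z y] form_add_left[of x y z] g_add[of x y]
  by (metis minus_add_distrib minus_minus)

lemma form_smult_right: "x \<in> g \<Longrightarrow> z \<in> g \<Longrightarrow> l (bracket z (a \<cdot>\<^sub>m x)) = a * l (bracket z x)"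
  using form_swap[of z "a \<cdot>\<^sub>m x"] form_swap[of z x] form_smult_left[of x z a] g_smult[of x a]
  by (metis mult_minus_right minus_minus)

lemma form_self: "x \<in> g \<Longrightarrow> l (bracket x x) = 0"
proof -
  assume x: "x \<in> g"
  have "bracket x x = 0 \<cdot>\<^sub>m x"
    unfolding bracket_def using g_carrier[OF x] by (intro eq_matI) auto
  then show ?thesis using l_smult[OF x, of 0] by simp
qed

lemma isotropic_p: "x \<in> p \<Longrightarrow> y \<in> p \<Longrightarrow> l (bracket x y) = 0"
  using polarization unfolding polarization_def isotropic_def by blast

text \<open>An element orthogonal to \<open>p\<close> can be adjoined to \<open>p\<close> without
  losing isotropy, because the form is alternating; maximality then puts it into \<open>p\<close>.
  So \<open>p\<close> is its own orthogonal.\<close>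

lemma polarization_perp:
  assumes y: "y \<in> g" and perp: "\<And>x. x \<in> p \<Longrightarrow> l (bracket x y) = 0"
  shows "y \<in> p"
proof -
  define U where "U = {x + a \<cdot>\<^sub>m y | x a. x \<in> p}"
  have yc: "y \<in> carrier_mat N N" by (rule g_carrier[OF y])
  have UI: "x + a \<cdot>\<^sub>m y \<in> U" if "x \<in> p" for x a using that by (auto simp: U_def)
  have Ug: "U \<subseteq> g" using p_g y g_add g_smult by (auto simp: U_def)
  have "mat_subspace N U"
    unfolding mat_subspace_def
  proof (intro conjI ballI allI)
    show "U \<subseteq> carrier_mat N N" using Ug g_carrier by blast
    have "0\<^sub>m N N = 0\<^sub>m N N + 0 \<cdot>\<^sub>m y" using yc by (intro eq_matI) auto
    then show "0\<^sub>m N N \<in> U" using UI[OF p.g_zero, of 0] by simp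
  next
    fix u v assume "u \<in> U" "v \<in> U"
    then obtain x a x' a' where *: "u = x + a \<cdot>\<^sub>m y" "v = x' + a' \<cdot>\<^sub>m y" "x \<in> p" "x' \<in> p"
      by (auto simp: U_def)
    have "u + v = (x + x') + (a + a') \<cdot>\<^sub>m y"
      unfolding * using yc p.g_carrier[OF *(3)] p.g_carrier[OF *(4)]
      by (intro eq_matI) (auto simp: algebra_simps)
    then show "u + v \<in> U" using UI[OF p.g_add[OF *(3,4)]] by simp
  next
    fix b u assume "u \<in> U"
    then obtain x a where *: "u = x + a \<cdot>\<^sub>m y" "x \<in> p" by (auto simp: U_def)
    have "b \<cdot>\<^sub>m u = b \<cdot>\<^sub>m x + (b * a) \<cdot>\<^sub>m y"
      unfolding * using yc p.g_carrier[OF *(2)] by (intro eq_matI) (auto simp: algebra_simps)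
    then show "b \<cdot>\<^sub>m u \<in> U" using UI[OF p.g_smult[OF *(2)]] by simp
  qed
  moreover have "isotropic l U"
    unfolding isotropic_def
  proof (intro ballI)
    fix u v assume "u \<in> U" "v \<in> U"
    then obtain x a x' a' where *: "u = x + a \<cdot>\<^sub>m y" "v = x' + a' \<cdot>\<^sub>m y" "x \<in> p" "x' \<in> p"
      by (auto simp: U_def)
    note m = p_g[OF *(3)] p_g[OF *(4)] y g_smult[OF y]
    have "l (bracket y x') = 0" using form_swap[OF m(2) y] perp[OF *(4)] by simp
    then show "l (bracket u v) = 0"
      unfolding * using m perp[OF *(3)] isotropic_p[OF *(3,4)] form_self[OF y]
      by (simp add: form_add_left form_add_right form_smult_left form_smult_right g_add)
  qed
  moreover have "p \<subseteq> U"
  proof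
    fix x assume x: "x \<in> p"
    have "x = x + 0 \<cdot>\<^sub>m y" using yc p.g_carrier[OF x] by (intro eq_matI) auto
    then show "x \<in> U" using UI[OF x, of 0] by simp
  qed
  ultimately have "U = p"
    using polarization Ug unfolding polarization_def by blast
  moreover have "0\<^sub>m N N + 1 \<cdot>\<^sub>m y = y" using yc by (intro eq_matI) auto
  ultimately show ?thesis using UI[OF p.g_zero, of 1] by simp
qed

lemma rad_p: "rad \<subseteq> p"
proof
  fix y assume "y \<in> rad"
  then have y: "y \<in> g" and r: "\<And>x. x \<in> g \<Longrightarrow> l (bracket y x) = 0" by (auto simp: rad_def)
  show "y \<in> p"
  proof (rule polarization_perp[OF y])
    fix x assume "x \<in> p"
    then show "l (bracket x y) = 0" using form_swap[OF y p_g, of x] r p_g by simp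
  qed
qed

lemma rad_g: "rad \<subseteq> g" by (auto simp: rad_def)

lemma p_finite: "finite p"
  by (rule finite_subset[OF _ g_finite]) (use p_g in blast)

lemma rad_finite: "finite rad"
  by (rule finite_subset[OF rad_g g_finite])

lemma card_p_pos: "card p > 0"
  using p_finite p.g_zero card_gt_0_iff by blast

lemma zero_rad: "0\<^sub>m N N \<in> rad"
proof -
  have "l (bracket (0\<^sub>m N N) y) = 0" if "y \<in> g" for y
    using form_smult_left[OF g_zero that, of 0] by simp
  then show ?thesis using g_zero by (simp add: rad_def)
qed

lemma card_rad_pos: "card rad > 0"
  using rad_finite zero_rad card_gt_0_iff by blast

text \<open>Evaluating \<open>\<Sum>x\<in>p. \<Sum>y\<in>g. e (l [x, y])\<close> in both orders replaces the dimension count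
  \<open>2 dim p = dim g + dim rad\<close>.\<close>

lemma card_polarization: "card p * card p = card g * card rad"
proof -
  have "(\<Sum>x\<in>p. \<Sum>y\<in>g. e (l (bracket x y))) = (\<Sum>x\<in>p. if x \<in> rad then of_nat (card g) else 0)"
  proof (rule sum.cong[OF refl])
    fix x assume x: "x \<in> p"
    have "(\<Sum>y\<in>g. e (l (bracket x y))) = (if \<forall>y\<in>g. l (bracket x y) = 0 then of_nat (card g) else 0)"
      using p_g[OF x] by (intro sum_character_subspace[OF mat_subspace_g]) (auto simp: form_add_right form_smult_right)
    then show "(\<Sum>y\<in>g. e (l (bracket x y))) = (if x \<in> rad then of_nat (card g) else 0)"
      using p_g[OF x] by (simp add: rad_def)
  qed
  also have "\<dots> = of_nat (card g * card rad)"
  proof -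
    have "{x \<in> p. x \<in> rad} = rad" using rad_p by blast
    then show ?thesis using p_finite by (simp add: sum.If_cases Int_def)
  qed
  finally have 1: "(\<Sum>x\<in>p. \<Sum>y\<in>g. e (l (bracket x y))) = of_nat (card g * card rad)" .
  have "(\<Sum>y\<in>g. \<Sum>x\<in>p. e (l (bracket x y))) = (\<Sum>y\<in>g. if y \<in> p then of_nat (card p) else 0)"
  proof (rule sum.cong[OF refl])
    fix y assume y: "y \<in> g"
    have "(\<Sum>x\<in>p. e (l (bracket x y))) = (if \<forall>x\<in>p. l (bracket x y) = 0 then of_nat (card p) else 0)"
      using p_g y by (intro sum_character_subspace[OF p.mat_subspace_g]) (auto simp: form_add_left form_smult_left)
    moreover have "(\<forall>x\<in>p. l (bracket x y) = 0) \<longleftrightarrow> y \<in> p"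
      using polarization_perp[OF y] isotropic_p by blast
    ultimately show "(\<Sum>x\<in>p. e (l (bracket x y))) = (if y \<in> p then of_nat (card p) else 0)" by simp
  qed
  also have "\<dots> = of_nat (card p * card p)"
  proof -
    have "{y \<in> g. y \<in> p} = p" using p_g by blast
    then show ?thesis using g_finite by (simp add: sum.If_cases Int_def)
  qed
  finally have "(\<Sum>x\<in>p. \<Sum>y\<in>g. e (l (bracket x y))) = of_nat (card p * card p)"
    by (subst sum.swap)
  with 1 show ?thesis by (metis of_nat_eq_iff)
qed

text \<open>The global and infinitesimal stabilizers agree. The action of \<open>E x\<close>
  conjugates by \<open>E (- x)\<close>, and the sign is irrelevant for membership in a
  subspace.\<close>

lemma coadjoint_fix_iff:
  assumes x: "x \<in> g" shows "coadjoint N g (E x) l = l \<longleftrightarrow> x \<in> rad"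
proof -
  have "coadjoint N g (E x) l = l \<longleftrightarrow> (\<forall>y\<in>g. l (cj (E x) y) = l y)"
  proof
    assume *: "coadjoint N g (E x) l = l"
    show "\<forall>y\<in>g. l (cj (E x) y) = l y"
      using coadjoint_apply[of _ "E x" l] unfolding * by simp
  next
    assume *: "\<forall>y\<in>g. l (cj (E x) y) = l y"
    show "coadjoint N g (E x) l = l"
      by (rule extensionalityI[OF _ dualD(1)[OF l]])
        (use * coadjoint_apply[of _ "E x" l] in \<open>auto simp: coadjoint_def\<close>)
  qed
  also have "\<dots> \<longleftrightarrow> (\<forall>y\<in>g. l (bracket (- x) y) = 0)"
    unfolding cj_exp[OF x] by (rule conj_fixes_form_iff[OF g_uminus[OF x] l_add])
  also have "\<dots> \<longleftrightarrow> x \<in> rad"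
  proof -
    have "- x = (-1) \<cdot>\<^sub>m x" by auto
    then have "l (bracket (- x) y) = - l (bracket x y)" if "y \<in> g" for y
      using form_smult_left[OF x that, of "-1"] by simp
    then show ?thesis using x by (simp add: rad_def)
  qed
  finally show ?thesis .
qed

text \<open>Because \<open>rad \<subseteq> p\<close>, the stabilizers of \<open>l\<close> in
  \<open>P\<close> and in the whole group coincide; the two cases are \<open>k = p\<close> and
  \<open>k = g\<close>.\<close>

lemma card_stabilizer:
  assumes "rad \<subseteq> k" "k \<subseteq> g"
  shows "card {s \<in> E ` k. coadjoint N g s l = l} = card rad"
proof -
  have "{s \<in> E ` k. coadjoint N g s l = l} = E ` rad"
    using assms coadjoint_fix_iff by auto
  then show ?thesis using card_image[OF inj_on_subset[OF exp_inj_g rad_g]] by simp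
qed

lemma sum_orbit: "(\<Sum>s\<in>carrier G. f (coadjoint N g s l)) = of_nat (card rad) * (\<Sum>\<nu>\<in>orbit. f \<nu> :: complex)"
proof -
  have "group_below G G" using G.is_group by (simp add: group_below_def)
  from sum_stabilizer[OF this l, of f] card_stabilizer[OF rad_g order_refl] show ?thesis
    by (simp add: orbit_def carrier_G)
qed

lemma sum_orbit_P:
  "(\<Sum>s\<in>carrier P. f (coadjoint N g s l)) =
    of_nat (card rad) * (\<Sum>\<nu>\<in>(\<lambda>s. coadjoint N g s l) ` carrier P. f \<nu> :: complex)"
  using sum_stabilizer[OF P_below l, of f] card_stabilizer[OF rad_p] p_g by (simp add: p.carrier_G subset_iff)

lemma card_orbit: "card g = card rad * card orbit"
proof -
  have "of_nat (card g) = (of_nat (card rad * card orbit) :: complex)"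
    using sum_orbit[of "\<lambda>_. 1"] card_G by simp
  then show ?thesis by (simp only: of_nat_eq_iff)
qed

text \<open>The translate by \<open>l\<close> of the annihilator \<open>perp\<close> of
  \<open>p\<close>; it is the set that the \<open>P\<close>-orbit of \<open>l\<close> is going to
  fill.\<close>

definition affine :: "('k mat \<Rightarrow> 'k) set" where
  "affine = {\<nu> \<in> dual g. \<forall>x\<in>p. \<nu> x = l x}"

definition perp :: "('k mat \<Rightarrow> 'k) set" where
  "perp = {\<nu> \<in> dual g. \<forall>x\<in>p. \<nu> x = 0}"

lemma dual_combine:
  assumes "\<nu> \<in> dual g" "\<nu>' \<in> dual g" shows "(\<lambda>x\<in>g. \<nu> x + a * \<nu>' x) \<in> dual g"
  using dualD[OF assms(1)] dualD[OF assms(2)] g_add g_smult by (auto simp: dual_def algebra_simps)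

lemma bij_translate:
  assumes \<nu>: "\<nu> \<in> perp" and S: "S \<subseteq> dual g"
    and cl: "\<And>\<kappa> a. \<kappa> \<in> S \<Longrightarrow> (\<lambda>x\<in>g. \<kappa> x + a * \<nu> x) \<in> S"
  shows "bij_betw (\<lambda>\<kappa>. \<lambda>x\<in>g. \<kappa> x + a * \<nu> x) S S"
proof (rule bij_betw_byWitness[where f' = "\<lambda>\<kappa>. \<lambda>x\<in>g. \<kappa> x + (- a) * \<nu> x"])
  have "(\<lambda>x\<in>g. (\<lambda>x\<in>g. \<kappa> x + b * \<nu> x) x + (- b) * \<nu> x) = \<kappa>" if "\<kappa> \<in> S" for \<kappa> b
    using that S dualD(1)[of \<kappa>] by (intro extensionalityI[where A = g]) auto
  from this[of _ a] this[of _ "- a"]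
  show "\<forall>\<kappa>\<in>S. (\<lambda>x\<in>g. (\<lambda>x\<in>g. \<kappa> x + a * \<nu> x) x + - a * \<nu> x) = \<kappa>"
    "\<forall>\<kappa>\<in>S. (\<lambda>x\<in>g. (\<lambda>x\<in>g. \<kappa> x + - a * \<nu> x) x + a * \<nu> x) = \<kappa>"
    by auto
qed (use cl[of _ a] cl[of _ "- a"] in auto)

lemma sum_character_translate:
  assumes \<nu>: "\<nu> \<in> perp" and S: "S \<subseteq> dual g"
    and cl: "\<And>\<kappa> a. \<kappa> \<in> S \<Longrightarrow> (\<lambda>x\<in>g. \<kappa> x + a * \<nu> x) \<in> S"
    and y: "y \<in> g" "\<nu> y \<noteq> 0"
  shows "(\<Sum>\<kappa>\<in>S. e (\<kappa> y)) = 0"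
proof -
  obtain a where a: "e (a * \<nu> y) \<noteq> 1" using e_scale_nontrivial[OF y(2)] by blast
  show ?thesis
    by (rule sum_character_zero[OF bij_translate[OF \<nu> S cl, of a] _ a])
      (use y in \<open>auto simp: e_add mult.commute\<close>)
qed

lemma perp_closed: "\<nu> \<in> perp \<Longrightarrow> \<kappa> \<in> perp \<Longrightarrow> (\<lambda>x\<in>g. \<kappa> x + a * \<nu> x) \<in> perp"
  using dual_combine p_g by (auto simp: perp_def)

lemma affine_closed: "\<nu> \<in> perp \<Longrightarrow> \<kappa> \<in> affine \<Longrightarrow> (\<lambda>x\<in>g. \<kappa> x + a * \<nu> x) \<in> affine"
  using dual_combine p_g by (auto simp: perp_def affine_def)

lemma card_affine: "card affine = card perp"
proof (rule bij_betw_same_card[OF bij_betw_byWitness[where f = "\<lambda>\<kappa>. \<lambda>x\<in>g. \<kappa> x + (-1) * l x"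
      and f' = "\<lambda>\<kappa>. \<lambda>x\<in>g. \<kappa> x + 1 * l x"]])
  show "\<forall>\<kappa>\<in>affine. (\<lambda>x\<in>g. (\<lambda>x\<in>g. \<kappa> x + (-1) * l x) x + 1 * l x) = \<kappa>"
    "\<forall>\<kappa>\<in>perp. (\<lambda>x\<in>g. (\<lambda>x\<in>g. \<kappa> x + 1 * l x) x + (-1) * l x) = \<kappa>"
    using dualD(1) by (auto intro!: extensionalityI[where A = g] simp: affine_def perp_def)
  show "(\<lambda>\<kappa>. \<lambda>x\<in>g. \<kappa> x + (-1) * l x) ` affine \<subseteq> perp"
    using dual_combine[OF _ l, of _ "-1"] p_g by (auto simp: affine_def perp_def)
  show "(\<lambda>\<kappa>. \<lambda>x\<in>g. \<kappa> x + 1 * l x) ` perp \<subseteq> affine"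
    using dual_combine[OF _ l, of _ 1] p_g by (auto simp: affine_def perp_def)
qed

text \<open>The double annihilator of \<open>p\<close>, at this stage only known to contain
  \<open>p\<close>.\<close>

definition annihilated :: "'k mat set" where
  "annihilated = {y \<in> g. \<forall>\<nu>\<in>perp. \<nu> y = 0}"

lemma p_annihilated: "p \<subseteq> annihilated"
  using p_g by (auto simp: annihilated_def perp_def)

lemma perp_finite: "finite perp"
  using dual_finite by (rule finite_subset[rotated]) (auto simp: perp_def)

text \<open>The double sum of \<open>e (\<nu> y)\<close> over \<open>perp\<close> and
  \<open>g\<close> in both orders: summed over \<open>y\<close>, only the zero form survives; summed
  over \<open>\<nu>\<close>, only the elements of \<open>annihilated\<close>.\<close>

lemma card_perp: "card perp * card annihilated = card g"
proof -
  define z where "z = (\<lambda>x\<in>g. 0 :: 'k)"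
  have z: "z \<in> perp" using g_add g_smult p_g by (auto simp: z_def perp_def dual_def)
  have "(\<Sum>y\<in>g. \<Sum>\<nu>\<in>perp. e (\<nu> y)) = (\<Sum>y\<in>g. if y \<in> annihilated then of_nat (card perp) else 0)"
  proof (rule sum.cong[OF refl])
    fix y assume y: "y \<in> g"
    show "(\<Sum>\<nu>\<in>perp. e (\<nu> y)) = (if y \<in> annihilated then of_nat (card perp) else 0)"
    proof (cases "y \<in> annihilated")
      case True
      then have "(\<Sum>\<nu>\<in>perp. e (\<nu> y)) = (\<Sum>\<nu>\<in>perp. 1)"
        by (intro sum.cong refl) (auto simp: annihilated_def e_zero)
      with True show ?thesis by simp
    next
      case False
      then obtain \<nu> where "\<nu> \<in> perp" "\<nu> y \<noteq> 0" using y by (auto simp: annihilated_def)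
      then have "(\<Sum>\<kappa>\<in>perp. e (\<kappa> y)) = 0"
        using perp_closed y by (intro sum_character_translate[of \<nu>]) (auto simp: perp_def)
      with False show ?thesis by simp
    qed
  qed
  also have "\<dots> = of_nat (card perp * card annihilated)"
  proof -
    have "{y \<in> g. y \<in> annihilated} = annihilated" by (auto simp: annihilated_def)
    then show ?thesis using g_finite by (simp add: sum.If_cases Int_def)
  qed
  finally have 1: "(\<Sum>\<nu>\<in>perp. \<Sum>y\<in>g. e (\<nu> y)) = of_nat (card perp * card annihilated)"
    by (subst sum.swap)
  have "(\<Sum>\<nu>\<in>perp. \<Sum>y\<in>g. e (\<nu> y)) = (\<Sum>\<nu>\<in>perp. if \<nu> = z then of_nat (card g) else 0)"
  proof (rule sum.cong[OF refl])
    fix \<nu> assume "\<nu> \<in> perp"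
    then have \<nu>: "\<nu> \<in> dual g" by (simp add: perp_def)
    have "(\<forall>y\<in>g. \<nu> y = 0) \<longleftrightarrow> \<nu> = z"
      using dualD(1)[OF \<nu>] by (auto simp: z_def intro!: extensionalityI[where A = g])
    then show "(\<Sum>y\<in>g. e (\<nu> y)) = (if \<nu> = z then of_nat (card g) else 0)"
      using sum_character_subspace[OF mat_subspace_g dualD(2,3)[OF \<nu>]] by simp
  qed
  also have "\<dots> = of_nat (card g)" using z perp_finite by simp
  finally have "(of_nat (card perp * card annihilated) :: complex) = of_nat (card g)" using 1 by simp
  then show ?thesis by (simp only: of_nat_eq_iff)
qed

text \<open>Isotropy says that the restriction of \<open>l\<close> to \<open>p\<close> kills all
  brackets in \<open>p\<close>, so by the stabilizer criterion inside \<open>p\<close> this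
  restriction is fixed by \<open>P\<close>.\<close>

lemma P_orbit_affine: "(\<lambda>s. coadjoint N g s l) ` carrier P \<subseteq> affine"
proof
  fix \<nu> assume "\<nu> \<in> (\<lambda>s. coadjoint N g s l) ` carrier P"
  then obtain x where x: "x \<in> p" "\<nu> = coadjoint N g (E x) l" by (auto simp: p.carrier_G)
  have "\<forall>y\<in>p. l (E (- x) * y * E (- (- x))) = l y"
    using p.conj_fixes_form_iff[OF p.g_uminus[OF x(1)], of l] l_add p_g
      isotropic_p[OF p.g_uminus[OF x(1)]] by blast
  then have "\<forall>y\<in>p. \<nu> y = l y"
    using x(2) p_g cj_exp[OF p_g[OF x(1)]] by (simp add: coadjoint_apply)
  moreover have "\<nu> \<in> dual g"
    unfolding x(2) using p_g x(1) by (intro coadjoint_in_dual l) (auto simp: carrier_G)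
  ultimately show "\<nu> \<in> affine" by (simp add: affine_def)
qed

text \<open>The cardinalities of the orbit and of \<open>perp\<close> leave no room for strict inclusions; the equality
  \<open>annihilated = p\<close> comes out as a by-product, without extending linear forms.\<close>

lemma P_orbit: "(\<lambda>s. coadjoint N g s l) ` carrier P = affine" and annihilated: "annihilated = p"
  and card_affine_p: "card affine * card p = card g"
proof -
  let ?O = "(\<lambda>s. coadjoint N g s l) ` carrier P"
  have "of_nat (card p) = (of_nat (card rad * card ?O) :: complex)"
    using sum_orbit_P[of "\<lambda>_. 1"] p.card_G by simp
  then have cp: "card p = card rad * card ?O" by (simp only: of_nat_eq_iff)
  \<comment> \<open>Here \<open>card p = card rad * card ?O\<close> is combined with
    \<open>card p * card p = card g * card rad\<close>.\<close>
  have "card rad * (card ?O * card p) = card rad * card g"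
    using card_polarization cp by (metis mult.assoc mult.commute)
  then have O: "card ?O * card p = card g" using card_rad_pos by simp
  have fin: "finite affine" by (rule finite_subset[OF _ dual_finite]) (auto simp: affine_def)
  have fa: "finite annihilated" by (rule finite_subset[OF _ g_finite]) (auto simp: annihilated_def)
  have le: "card ?O \<le> card affine" by (rule card_mono[OF fin P_orbit_affine])
  have le': "card p \<le> card annihilated" by (rule card_mono[OF fa p_annihilated])
  have eq: "card affine * card annihilated = card ?O * card p"
    using card_perp card_affine O by simp
  have g0: "card g > 0" using g_finite g_zero card_gt_0_iff by blast
  have O0: "card ?O > 0" using O g0 by (metis mult_0 neq0_conv)
  \<comment> \<open>The product of the larger sizes \<open>card affine\<close> and
    \<open>card annihilated\<close> is again \<open>card g\<close>, so neither can exceed its lower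
    bound.\<close>
  have "card affine * card p \<le> card affine * card annihilated" using le' by simp
  then have "card affine * card p \<le> card ?O * card p" using eq by simp
  then have c1: "card ?O = card affine" using le card_p_pos by simp
  then have c2: "card annihilated = card p" using eq O0 by simp
  show "?O = affine" by (rule card_subset_eq[OF fin P_orbit_affine c1])
  show "annihilated = p" using card_subset_eq[OF fa p_annihilated c2[symmetric]] ..
  show "card affine * card p = card g" using c1 O by simp
qed

text \<open>The orbit of \<open>P\<close> is a translate of \<open>perp\<close>, so the character
  sum vanishes unless \<open>perp\<close> annihilates \<open>y\<close>, which means
  \<open>y \<in> p\<close>. The total weight is
  \<open>card rad * card affine = card p\<close>.\<close>

lemma sum_P_coadjoint:
  assumes y: "y \<in> g"
  shows "(\<Sum>s\<in>carrier P. e (coadjoint N g s l y)) = (if y \<in> p then of_nat (card p) * e (l y) else 0)"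
proof -
  have "(\<Sum>s\<in>carrier P. e (coadjoint N g s l y)) = of_nat (card rad) * (\<Sum>\<nu>\<in>affine. e (\<nu> y))"
    using sum_orbit_P[of "\<lambda>\<nu>. e (\<nu> y)"] P_orbit by simp
  also have "(\<Sum>\<nu>\<in>affine. e (\<nu> y)) = (if y \<in> p then of_nat (card affine) * e (l y) else 0)"
  proof (cases "y \<in> p")
    case True
    then show ?thesis by (simp add: affine_def)
  next
    case False
    then obtain \<nu> where "\<nu> \<in> perp" "\<nu> y \<noteq> 0" using y annihilated by (auto simp: annihilated_def)
    then have "(\<Sum>\<kappa>\<in>affine. e (\<kappa> y)) = 0"
      using affine_closed y by (intro sum_character_translate[of \<nu>]) (auto simp: affine_def)
    with False show ?thesis by simp
  qed
  also have "of_nat (card rad) * \<dots> = (if y \<in> p then of_nat (card rad * card affine) * e (l y) else 0)"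
    by simp
  also have "card rad * card affine = card p"
  proof -
    have "card rad * card affine * card p = card p * card p"
      unfolding mult.assoc card_affine_p card_polarization by (rule mult.commute)
    then show ?thesis using card_p_pos by simp
  qed
  finally show ?thesis .
qed

text \<open>Up to the factor \<open>1 / card p\<close> this is Kirillov's formula for the character of the induced
  representation.\<close>

lemma kirillov_sum:
  assumes x: "x \<in> g"
  shows "(\<Sum>s\<in>carrier G. if cj s x \<in> p then e (l (cj s x)) else 0) = of_nat (card rad) * (\<Sum>\<nu>\<in>orbit. e (\<nu> x))"
proof -
  have PG: "u \<in> carrier G" if "u \<in> carrier P" for u using G.below_closed[OF P_below that] .
  have "of_nat (card p) * (\<Sum>s\<in>carrier G. if cj s x \<in> p then e (l (cj s x)) else 0)
      = (\<Sum>s\<in>carrier G. \<Sum>u\<in>carrier P. e (coadjoint N g u l (cj s x)))"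
    unfolding sum_distrib_left by (rule sum.cong[OF refl]) (simp add: sum_P_coadjoint cj_in x)
  \<comment> \<open>Read backwards, \<open>sum_P_coadjoint\<close> has replaced the indicator of
    \<open>p\<close> by an average over \<open>P\<close>. The additional factor \<open>u\<close> is
    absorbed by right translation in the sum over the group.\<close>
  also have "\<dots> = (\<Sum>u\<in>carrier P. \<Sum>s\<in>carrier G. e (coadjoint N g (s * u) l x))"
  proof (subst sum.swap, intro sum.cong refl)
    fix s u assume s: "s \<in> carrier G" and u: "u \<in> carrier P"
    show "e (coadjoint N g u l (cj s x)) = e (coadjoint N g (s * u) l x)"
      using s PG[OF u] x by (simp add: coadjoint_mult coadjoint_apply)
  qed
  also have "\<dots> = (\<Sum>u\<in>carrier P. \<Sum>s\<in>carrier G. e (coadjoint N g s l x))"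
    using G.sum_translate_right[of _ "\<lambda>s. e (coadjoint N g s l x)"] PG by simp
  also have "\<dots> = of_nat (card p) * (of_nat (card rad) * (\<Sum>\<nu>\<in>orbit. e (\<nu> x)))"
    using sum_orbit[of "\<lambda>\<nu>. e (\<nu> x)"] p.card_G by simp
  finally show ?thesis using card_p_pos by simp
qed

lemma orbit_finite: "finite orbit"
  using G.finite_carrier by (simp add: orbit_def)

lemma orbit_dual: "\<nu> \<in> orbit \<Longrightarrow> \<nu> \<in> dual g"
  using coadjoint_in_dual l by (auto simp: orbit_def)

lemma sum_orbit_cj:
  assumes u: "u \<in> carrier G" and x: "x \<in> g"
  shows "(\<Sum>\<nu>\<in>orbit. f (\<nu> (cj u x))) = (\<Sum>\<nu>\<in>orbit. f (\<nu> x) :: complex)"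
proof -
  have "of_nat (card rad) * (\<Sum>\<nu>\<in>orbit. f (\<nu> (cj u x))) = (\<Sum>s\<in>carrier G. f (coadjoint N g s l (cj u x)))"
    using sum_orbit[of "\<lambda>\<nu>. f (\<nu> (cj u x))"] by simp
  also have "\<dots> = (\<Sum>s\<in>carrier G. f (coadjoint N g (u * s) l x))"
    by (rule sum.cong[OF refl]) (use u x in \<open>simp add: coadjoint_mult coadjoint_apply\<close>)
  also have "\<dots> = of_nat (card rad) * (\<Sum>\<nu>\<in>orbit. f (\<nu> x))"
    using G.sum_translate[OF u, of "\<lambda>s. f (coadjoint N g s l x)"] sum_orbit[of "\<lambda>\<nu>. f (\<nu> x)"] by simp
  finally show ?thesis using card_rad_pos by simp
qed

end

section \<open>Multiplicities as numbers of incidences\<close>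

context group
begin

lemma conj_left_iff:
  assumes "u \<in> carrier G" "x \<in> carrier G" "r \<in> carrier G"
  shows "u \<otimes> x \<otimes> r = x \<longleftrightarrow> u = inv (x \<otimes> r \<otimes> inv x)"
proof -
  have "u \<otimes> x \<otimes> r = x \<longleftrightarrow> u = x \<otimes> inv (x \<otimes> r)"
    using inv_solve_right[of u x "x \<otimes> r"] assms by (auto simp: m_assoc)
  also have "x \<otimes> inv (x \<otimes> r) = inv (x \<otimes> r \<otimes> inv x)"
    using assms by (simp add: inv_mult_group m_assoc)
  finally show ?thesis .
qed

lemma conj_right_iff:
  assumes "u \<in> carrier G" "x \<in> carrier G" "r \<in> carrier G"
  shows "u \<otimes> x \<otimes> r = x \<longleftrightarrow> r = inv (inv x \<otimes> u \<otimes> x)"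
proof -
  have "u \<otimes> x \<otimes> r = x \<longleftrightarrow> r = inv (u \<otimes> x) \<otimes> x"
    using inv_solve_left[of r "u \<otimes> x" x] assms by auto
  also have "inv (u \<otimes> x) \<otimes> x = inv (inv x \<otimes> u \<otimes> x)"
    using assms by (simp add: inv_mult_group m_assoc)
  finally show ?thesis .
qed

end

section \<open>The character of \<open>P\<close> and the size of a polarization\<close>

context polarized_form
begin

definition xi :: "'k mat \<Rightarrow> complex" where
  "xi u = e (l (inv_into p E u))"

lemma xi_exp: "x \<in> p \<Longrightarrow> xi (E x) = e (l x)"
  using inv_into_f_f[OF p.exp_inj_g] by (simp add: xi_def)

text \<open>The kernel of \<open>l\<close> on \<open>p\<close> is a subalgebra containing all
  brackets of \<open>p\<close>. Modulo it the logarithm of \<open>E x * E y\<close> is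
  \<open>x + y\<close>, so \<open>l\<close> takes the value \<open>l x + l y\<close> on it.\<close>

lemma linear_character_xi: "linear_character P xi"
  unfolding linear_character_def
proof (intro conjI ballI)
  show "xi u \<noteq> 0" for u by (simp add: xi_def e_nz)
  fix u v assume "u \<in> carrier P" "v \<in> carrier P"
  then obtain x y where xy: "x \<in> p" "y \<in> p" "u = E x" "v = E y" by (auto simp: p.carrier_G)
  define k where "k = {x \<in> p. l x = 0}"
  have l0: "l (0\<^sub>m N N) = 0"
  proof -
    have "0 \<cdot>\<^sub>m 0\<^sub>m N N = (0\<^sub>m N N :: 'k mat)" by (intro eq_matI) auto
    then show ?thesis using l_smult[OF g_zero, of 0] by simp
  qed
  have "lie_subalgebra N k p"
    unfolding lie_subalgebra_def mat_subspace_def k_def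
    using p.g_zero p.g_add p.g_smult p.g_bracket p.g_carrier l_add l_smult p_g isotropic_p l0 by auto
  moreover have "bracket a b \<in> k" if "a \<in> p" "b \<in> p" for a b
    using that p.g_bracket isotropic_p by (simp add: k_def)
  ultimately obtain z where z: "z \<in> p" "E x * E y = E z" "z - (x + y) \<in> k"
    using p.exp_mult_closed_mod xy by blast
  have "z = (z - (x + y)) + (x + y)"
    using p.g_carrier[OF z(1)] p.g_carrier[OF xy(1)] p.g_carrier[OF xy(2)] by (intro eq_matI) auto
  moreover have "z - (x + y) \<in> g" "x + y \<in> g" using z(3) p_g p.g_add xy by (auto simp: k_def)
  ultimately have "l z = l (z - (x + y)) + l (x + y)" using l_add by metis
  then have "l z = l x + l y" using z(3) l_add p_g xy by (simp add: k_def)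
  then show "xi (u \<otimes>\<^bsub>P\<^esub> v) = xi u * xi v"
    using z xy by (simp add: xi_exp e_add)
qed

lemma kirillov_rep_eq: "kirillov_rep N e g l p = ind_rep (char_rep xi) P G"
  by (simp add: kirillov_rep_def xi_rep_def char_rep_def xi_def)

text \<open>The condition admits the single element \<open>E (- w)\<close>, and injectivity of the
  exponential shows that it belongs to \<open>P\<close> exactly when \<open>w \<in> p\<close>. The
  factor \<open>z\<close> is room for the value of the other character.\<close>

lemma sum_xi_inverse:
  assumes w: "w \<in> g"
  shows "(\<Sum>u\<in>carrier P. if u = inv\<^bsub>G\<^esub> (E w) then xi u * z else 0) = (if w \<in> p then e (- l w) * z else 0)"
proof (cases "w \<in> p")
  case True
  have "l (- w) = - l w"
  proof -
    have "- w = (-1) \<cdot>\<^sub>m w" by auto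
    then show ?thesis using l_smult[OF w, of "-1"] by simp
  qed
  moreover have "E (- w) \<in> carrier P" using p.g_uminus[OF True] by (simp add: p.carrier_G)
  ultimately show ?thesis
    using True p.G.finite_carrier inv_exp[OF w] xi_exp[OF p.g_uminus[OF True]] by simp
next
  case False
  have "E (- w) \<notin> carrier P"
  proof
    assume "E (- w) \<in> carrier P"
    then obtain v where v: "v \<in> p" "E (- w) = E v" by (auto simp: p.carrier_G)
    then have "- w = v" using inj_onD[OF exp_inj_g v(2)] g_uminus[OF w] p_g by blast
    then have "w = - v" using uminus_uminus_g[OF w] by simp
    then show False using False p.g_uminus[OF v(1)] by simp
  qed
  then show ?thesis using False inv_exp[OF w] by (intro trans[OF sum.neutral]) auto
qed

text \<open>The source of the square roots in the multiplicity formula: \<open>card p\<close>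
  squared is \<open>card g * card rad\<close>, and
  \<open>card g = card rad * card orbit\<close>.\<close>

lemma sqrt_card_orbit: "real (card p) = real (card rad) * sqrt (real (card orbit))"
proof -
  have "real (card p) ^ 2 = (real (card rad) * sqrt (real (card orbit))) ^ 2"
    using arg_cong[OF card_polarization, of real] card_orbit
    by (simp add: power2_eq_square mult_ac power_mult_distrib)
  then show ?thesis by (simp add: power2_eq_iff_nonneg)
qed

end

section \<open>Counting incidences between an orbit of the group and one of the subgroup\<close>

locale polarized_pair =
  big: polarized_form N g e l p + small: polarized_form N h e m q
  for N and g h :: "'k::{field,finite} mat set" and e :: "'k \<Rightarrow> complex" and l m p q +
  assumes h: "lie_subalgebra N h g"
begin

lemma h_g: "x \<in> h \<Longrightarrow> x \<in> g"
  using big.subalgebra(2)[OF h] by blast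

lemmas H_below = big.subalgebra(3)[OF h]

lemma H_G: "u \<in> carrier small.G \<Longrightarrow> u \<in> carrier big.G"
  using big.G.below_closed[OF H_below] .

lemma cj_small: "u \<in> carrier small.G \<Longrightarrow> small.cj u x = big.cj u x"
  using big.G.below_inv[OF H_below] by (simp add: big.cj_def small.cj_def)

text \<open>The numerator of the formula. A form has only one restriction, so counting forms in the
  large orbit is the same as counting incident pairs.\<close>

definition incidences :: nat where
  "incidences = card (dual_proj h -` small.orbit \<inter> big.orbit)"

text \<open>Orthogonality on \<open>h\<close>: a pair of forms contributes \<open>card h\<close> if
  the larger restricts to the smaller, and nothing otherwise.\<close>

lemma sum_restricted_characters:
  "(\<Sum>y\<in>h. (\<Sum>\<nu>\<in>big.orbit. e (\<nu> y)) * (\<Sum>\<kappa>\<in>small.orbit. e (- \<kappa> y))) = of_nat (card h * incidences)"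
proof -
  have inner: "(\<Sum>y\<in>h. e (\<nu> y) * e (- \<kappa> y)) = (if dual_proj h \<nu> = \<kappa> then of_nat (card h) else 0)"
    if \<nu>: "\<nu> \<in> big.orbit" and \<kappa>: "\<kappa> \<in> small.orbit" for \<nu> \<kappa>
  proof -
    note \<nu>' = big.dualD[OF big.orbit_dual[OF \<nu>]] and \<kappa>' = small.dualD[OF small.orbit_dual[OF \<kappa>]]
    have "(\<Sum>y\<in>h. e (\<nu> y) * e (- \<kappa> y)) = (\<Sum>y\<in>h. e (\<nu> y - \<kappa> y))"
      by (simp flip: big.e_add)
    also have "\<dots> = (if \<forall>y\<in>h. \<nu> y - \<kappa> y = 0 then of_nat (card h) else 0)"
      using \<nu>'(2,3) \<kappa>'(2,3) h_g
      by (intro big.sum_character_subspace[OF small.mat_subspace_g]) (auto simp: algebra_simps)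
    also have "(\<forall>y\<in>h. \<nu> y - \<kappa> y = 0) \<longleftrightarrow> dual_proj h \<nu> = \<kappa>"
      using \<kappa>'(1) unfolding dual_proj_def by (auto intro!: extensionalityI[where A = h])
    finally show ?thesis .
  qed
  have "(\<Sum>y\<in>h. (\<Sum>\<nu>\<in>big.orbit. e (\<nu> y)) * (\<Sum>\<kappa>\<in>small.orbit. e (- \<kappa> y)))
      = (\<Sum>y\<in>h. \<Sum>\<nu>\<in>big.orbit. \<Sum>\<kappa>\<in>small.orbit. e (\<nu> y) * e (- \<kappa> y))"
    by (simp add: sum_product)
  also have "\<dots> = (\<Sum>\<nu>\<in>big.orbit. \<Sum>\<kappa>\<in>small.orbit. \<Sum>y\<in>h. e (\<nu> y) * e (- \<kappa> y))"
    by (subst sum.swap, rule sum.cong[OF refl], rule sum.swap)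
  also have "\<dots> = (\<Sum>\<nu>\<in>big.orbit. \<Sum>\<kappa>\<in>small.orbit. if dual_proj h \<nu> = \<kappa> then of_nat (card h) else 0)"
    by (intro sum.cong refl inner)
  also have "\<dots> = (\<Sum>\<nu>\<in>big.orbit. if dual_proj h \<nu> \<in> small.orbit then of_nat (card h) else 0)"
    using small.orbit_finite by simp
  also have "\<dots> = of_nat (card h * incidences)"
  proof -
    have "{\<nu> \<in> big.orbit. dual_proj h \<nu> \<in> small.orbit} = dual_proj h -` small.orbit \<inter> big.orbit" by auto
    then show ?thesis using big.orbit_finite by (simp add: sum.If_cases Int_def incidences_def conj_commute)
  qed
  finally show ?thesis .
qed

text \<open>Kirillov's formula is used twice. In the large group it turns the inner sum into the
  orbit sum \<open>A x\<close>. As \<open>A\<close> is invariant under \<open>H\<close>, the sum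
  over \<open>q\<close> can be averaged over \<open>H\<close>, which produces the analogous orbit
  sum for the small group.\<close>

lemma sum_incidences:
  "(\<Sum>x\<in>q. e (- m x) * (\<Sum>s\<in>carrier big.G. if big.cj s x \<in> p then e (l (big.cj s x)) else 0))
    = of_nat (card big.rad * card small.rad * incidences)"
proof -
  define A where "A y = (\<Sum>\<nu>\<in>big.orbit. e (\<nu> y))" for y
  define T where "T = (\<Sum>x\<in>q. e (- m x) * A x)"
  interpret inv: additive_character "\<lambda>a. e (- a)" by (rule big.inverse_character)
  \<comment> \<open>The small group enters with \<open>e (- m x)\<close>, so Kirillov's formula is
    instantiated there with the inverse character.\<close>
  interpret small': polarized_form N h "\<lambda>a. e (- a)" m q
    by unfold_locales (rule small.l small.polarization)+
  have A_cj: "A (small.cj u y) = A y" if "u \<in> carrier small.G" "y \<in> h" for u y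
    unfolding A_def cj_small[OF that(1)] by (rule big.sum_orbit_cj[OF H_G[OF that(1)] h_g[OF that(2)]])
  \<comment> \<open>The sum over \<open>q\<close> is extended to \<open>h\<close> by an indicator
    and reindexed by conjugation with \<open>u\<close>. The factor \<open>A\<close> is unaffected,
    whereas the indicator now depends on \<open>u\<close>.\<close>
  have T_u: "T = (\<Sum>y\<in>h. A y * (if small.cj u y \<in> q then e (- m (small.cj u y)) else 0))"
    if u: "u \<in> carrier small.G" for u
  proof -
    have "T = (\<Sum>x\<in>h. if x \<in> q then e (- m x) * A x else 0)"
    proof -
      have "h \<inter> {x. x \<in> q} = q" using small.p_g by auto
      then show ?thesis using small.g_finite by (simp add: T_def sum.If_cases)
    qed
    also have "\<dots> = (\<Sum>y\<in>h. if small.cj u y \<in> q then e (- m (small.cj u y)) * A (small.cj u y) else 0)"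
      by (rule sum.reindex_bij_betw[OF small.bij_cj[OF u], symmetric])
    also have "\<dots> = (\<Sum>y\<in>h. A y * (if small.cj u y \<in> q then e (- m (small.cj u y)) else 0))"
      by (rule sum.cong[OF refl]) (simp add: A_cj[OF u] mult.commute)
    finally show ?thesis .
  qed
  have "of_nat (card h) * T = (\<Sum>u\<in>carrier small.G. T)" by (simp add: small.card_G)
  also have "\<dots> = (\<Sum>u\<in>carrier small.G. \<Sum>y\<in>h. A y * (if small.cj u y \<in> q then e (- m (small.cj u y)) else 0))"
    by (rule sum.cong[OF refl T_u])
  also have "\<dots> = (\<Sum>y\<in>h. A y * (\<Sum>u\<in>carrier small.G. if small.cj u y \<in> q then e (- m (small.cj u y)) else 0))"
    unfolding sum_distrib_left by (rule sum.swap)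
  also have "\<dots> = (\<Sum>y\<in>h. A y * (of_nat (card small.rad) * (\<Sum>\<kappa>\<in>small.orbit. e (- \<kappa> y))))"
    by (intro sum.cong refl) (simp only: small'.kirillov_sum)
  also have "\<dots> = of_nat (card small.rad) * (\<Sum>y\<in>h. A y * (\<Sum>\<kappa>\<in>small.orbit. e (- \<kappa> y)))"
    by (simp add: sum_distrib_left mult.left_commute)
  also have "\<dots> = of_nat (card h) * of_nat (card small.rad * incidences)"
    unfolding A_def sum_restricted_characters by simp
  finally have T: "T = of_nat (card small.rad * incidences)"
    using small.g_finite small.g_zero by (auto simp del: of_nat_mult)
  have "(\<Sum>x\<in>q. e (- m x) * (\<Sum>s\<in>carrier big.G. if big.cj s x \<in> p then e (l (big.cj s x)) else 0))
      = (\<Sum>x\<in>q. e (- m x) * (of_nat (card big.rad) * A x))"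
    unfolding A_def by (intro sum.cong refl) (simp only: big.kirillov_sum h_g small.p_g)
  also have "\<dots> = of_nat (card big.rad) * T"
    by (simp add: T_def sum_distrib_left mult.left_commute)
  finally show ?thesis by (simp add: T)
qed

text \<open>The right-hand side does not mention the character, so the identity may be applied to
  its inverse, which moves the sign from \<open>m\<close> to \<open>l\<close>.\<close>

lemma sum_incidences':
  "(\<Sum>x\<in>q. e (m x) * (\<Sum>s\<in>carrier big.G. if big.cj s x \<in> p then e (- l (big.cj s x)) else 0))
    = of_nat (card big.rad * card small.rad * incidences)"
proof -
  interpret inv: additive_character "\<lambda>a. e (- a)" by (rule big.inverse_character)
  interpret pair': polarized_pair N g h "\<lambda>a. e (- a)" l m p q
    by unfold_locales (rule big.l big.polarization small.l small.polarization h)+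
  show ?thesis using pair'.sum_incidences by simp
qed

lemma sum_bij_exp: "(\<Sum>u\<in>carrier small.P. f u) = (\<Sum>z\<in>q. f (small.E z))"
  by (rule sum.reindex_bij_betw[OF small.p.bij_exp, symmetric])

text \<open>For given \<open>x\<close> and \<open>u = E z\<close>, the equation
  \<open>u x r = x\<close> has only one solution, the inverse of the conjugate of \<open>u\<close>
  by \<open>x\<close>. Its membership in \<open>P\<close> becomes the indicator of \<open>p\<close>,
  and its inverse the sign of \<open>l\<close>.\<close>

lemma trace_res:
  "(\<Sum>x\<in>carrier big.G. \<Sum>u\<in>carrier small.P. \<Sum>r\<in>carrier big.P. if u * x * r = x then small.xi u * big.xi r else 0)
    = of_nat (card big.rad * card small.rad * incidences)"
proof -
  have inner: "(\<Sum>r\<in>carrier big.P. if small.E z * x * r = x then small.xi (small.E z) * big.xi r else 0)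
      = e (m z) * (if big.cj x z \<in> p then e (- l (big.cj x z)) else 0)"
    if x: "x \<in> carrier big.G" and z: "z \<in> q" for x z
  proof -
    have zg: "z \<in> g" using z small.p_g h_g by blast
    then have Ez: "small.E z \<in> carrier big.G" by (simp add: big.carrier_G)
    have "small.E z * x * r = x \<longleftrightarrow> r = inv\<^bsub>big.G\<^esub> (big.E (big.cj x z))" if r: "r \<in> carrier big.P" for r
      using big.G.conj_right_iff[OF Ez x big.G.below_closed[OF big.P_below r]] big.exp_cj[OF x zg]
      by (simp add: big.cj_def)
    then have "(\<Sum>r\<in>carrier big.P. if small.E z * x * r = x then small.xi (small.E z) * big.xi r else 0)
      = (\<Sum>r\<in>carrier big.P. if r = inv\<^bsub>big.G\<^esub> (big.E (big.cj x z)) then big.xi r * e (m z) else 0)"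
      by (intro sum.cong refl) (simp add: small.xi_exp[OF z] mult.commute)
    also have "\<dots> = (if big.cj x z \<in> p then e (- l (big.cj x z)) * e (m z) else 0)"
      by (rule big.sum_xi_inverse[OF big.cj_in[OF x zg]])
    finally show ?thesis by simp
  qed
  have "(\<Sum>x\<in>carrier big.G. \<Sum>u\<in>carrier small.P. \<Sum>r\<in>carrier big.P. if u * x * r = x then small.xi u * big.xi r else 0)
      = (\<Sum>x\<in>carrier big.G. \<Sum>z\<in>q. e (m z) * (if big.cj x z \<in> p then e (- l (big.cj x z)) else 0))"
    unfolding sum_bij_exp by (intro sum.cong refl inner)
  also have "\<dots> = (\<Sum>z\<in>q. e (m z) * (\<Sum>s\<in>carrier big.G. if big.cj s z \<in> p then e (- l (big.cj s z)) else 0))"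
    unfolding sum_distrib_left by (rule sum.swap)
  finally show ?thesis by (simp only: sum_incidences')
qed

text \<open>The left factor is now the one solved for, so the conjugation is by the inverse of
  \<open>x\<close>; otherwise the count is that of \<open>trace_res\<close>.\<close>

lemma trace_ind:
  "(\<Sum>x\<in>carrier big.G. \<Sum>r\<in>carrier big.P. \<Sum>u\<in>carrier small.P. if r * x * u = x then big.xi r * small.xi u else 0)
    = of_nat (card big.rad * card small.rad * incidences)"
proof -
  have inner: "(\<Sum>r\<in>carrier big.P. if r * x * small.E z = x then big.xi r * small.xi (small.E z) else 0)
      = e (m z) * (if big.cj (inv\<^bsub>big.G\<^esub> x) z \<in> p then e (- l (big.cj (inv\<^bsub>big.G\<^esub> x) z)) else 0)"
    if x: "x \<in> carrier big.G" and z: "z \<in> q" for x z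
  proof -
    have zg: "z \<in> g" using z small.p_g h_g by blast
    then have Ez: "small.E z \<in> carrier big.G" by (simp add: big.carrier_G)
    have ix: "inv\<^bsub>big.G\<^esub> x \<in> carrier big.G" using x by simp
    have "r * x * small.E z = x \<longleftrightarrow> r = inv\<^bsub>big.G\<^esub> (big.E (big.cj (inv\<^bsub>big.G\<^esub> x) z))" if r: "r \<in> carrier big.P" for r
      using big.G.conj_left_iff[OF big.G.below_closed[OF big.P_below r] x Ez] big.exp_cj[OF ix zg] x
      by (simp add: big.cj_def)
    then have "(\<Sum>r\<in>carrier big.P. if r * x * small.E z = x then big.xi r * small.xi (small.E z) else 0)
      = (\<Sum>r\<in>carrier big.P. if r = inv\<^bsub>big.G\<^esub> (big.E (big.cj (inv\<^bsub>big.G\<^esub> x) z)) then big.xi r * e (m z) else 0)"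
      by (intro sum.cong refl) (simp add: small.xi_exp[OF z])
    also have "\<dots> = (if big.cj (inv\<^bsub>big.G\<^esub> x) z \<in> p then e (- l (big.cj (inv\<^bsub>big.G\<^esub> x) z)) * e (m z) else 0)"
      by (rule big.sum_xi_inverse[OF big.cj_in[OF ix zg]])
    finally show ?thesis by simp
  qed
  have "(\<Sum>x\<in>carrier big.G. \<Sum>r\<in>carrier big.P. \<Sum>u\<in>carrier small.P. if r * x * u = x then big.xi r * small.xi u else 0)
      = (\<Sum>x\<in>carrier big.G. \<Sum>z\<in>q. \<Sum>r\<in>carrier big.P. if r * x * small.E z = x then big.xi r * small.xi (small.E z) else 0)"
    unfolding sum_bij_exp by (rule sum.cong[OF refl sum.swap])
  also have "\<dots> = (\<Sum>x\<in>carrier big.G. \<Sum>z\<in>q. e (m z) * (if big.cj (inv\<^bsub>big.G\<^esub> x) z \<in> p then e (- l (big.cj (inv\<^bsub>big.G\<^esub> x) z)) else 0))"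
    by (intro sum.cong refl inner)
  \<comment> \<open>Inversion permutes the group.\<close>
  also have "\<dots> = (\<Sum>x\<in>carrier big.G. \<Sum>z\<in>q. e (m z) * (if big.cj x z \<in> p then e (- l (big.cj x z)) else 0))"
    by (rule sum.reindex_bij_witness[where i = "\<lambda>x. inv\<^bsub>big.G\<^esub> x" and j = "\<lambda>x. inv\<^bsub>big.G\<^esub> x"]) auto
  also have "\<dots> = (\<Sum>z\<in>q. e (m z) * (\<Sum>s\<in>carrier big.G. if big.cj s z \<in> p then e (- l (big.cj s z)) else 0))"
    unfolding sum_distrib_left by (rule sum.swap)
  finally show ?thesis by (simp only: sum_incidences')
qed

lemma multiplicity_value:
  assumes "of_nat (M * (card p * card q)) = (of_nat (card big.rad * card small.rad * incidences) :: complex)"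
  shows "real M = real incidences / sqrt (real (card small.orbit) * real (card big.orbit))"
proof -
  have "M * (card p * card q) = card big.rad * card small.rad * incidences"
    using assms by (simp only: of_nat_eq_iff)
  then have "real M * (real (card p) * real (card q)) = real (card big.rad) * real (card small.rad) * real incidences"
    by (metis of_nat_mult)
  then have "real (card big.rad) * real (card small.rad) *
      (real M * sqrt (real (card small.orbit) * real (card big.orbit)))
    = real (card big.rad) * real (card small.rad) * real incidences"
    unfolding big.sqrt_card_orbit small.sqrt_card_orbit by (simp add: real_sqrt_mult mult_ac)
  then have "real M * sqrt (real (card small.orbit) * real (card big.orbit)) = real incidences"
    using big.card_rad_pos small.card_rad_pos by simp
  moreover have "card small.orbit > 0" "card big.orbit > 0"
    using small.card_orbit big.card_orbit small.g_finite big.g_finite small.g_zero big.g_zero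
    by (metis card_gt_0_iff empty_iff mult_0_right neq0_conv)+
  ultimately show ?thesis by (simp add: field_simps)
qed

end

context polarized_form
begin

text \<open>The form is paired with itself over the same algebra. Restriction is then the identity,
  every point of the orbit is an incidence, and \<open>card rad * card rad * card orbit\<close>
  equals \<open>card p * card p\<close>.\<close>

lemma dim_eigenvectors_xi:
  "complex_vector.dim (eigenvectors (ind_rep (char_rep xi) P G) P xi) = 1"
proof -
  have "lie_subalgebra N g g"
    using mat_subspace_g g_bracket by (simp add: lie_subalgebra_def)
  then interpret self: polarized_pair N g g e l l p p
    by unfold_locales
  let ?d = "complex_vector.dim (G.biequivariant P xi P xi)"
  have "of_nat (?d * (card p * card p)) = (of_nat (card rad * card rad * self.incidences) :: complex)"
    using G.dim_biequivariant[OF P_below linear_character_xi P_below linear_character_xi] self.trace_res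
    by (simp add: p.card_G)
  moreover have "self.incidences = card orbit"
  proof -
    have "dual_proj g \<nu> = \<nu>" if "\<nu> \<in> orbit" for \<nu>
      using dualD(1)[OF orbit_dual[OF that]] by (simp add: dual_proj_def extensional_restrict)
    then have "dual_proj g -` orbit \<inter> orbit = orbit" by auto
    then show ?thesis by (simp add: self.incidences_def)
  qed
  ultimately have "?d * (card p * card p) = card rad * card rad * card orbit"
    by (simp only: of_nat_eq_iff)
  also have "\<dots> = card p * card p"
    unfolding card_polarization card_orbit by simp
  finally have "?d = 1" using card_p_pos by simp
  then show ?thesis
    using G.eigenvectors_induced[OF P_below linear_character_xi P_below linear_character_xi] by simp
qed

end

text \<open>The orbit comes with one base point and the representation with another, together with a
  polarization there. Passing to the second base point does not change the orbit.\<close>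

lemma orbit_repE:
  fixes \<aa> :: "'k::{field,finite} mat set" and T :: "('k mat, 'v::complex_vector) rep"
  assumes "N \<ge> 1" "CHAR('k) \<ge> N" "nontrivial_additive_character e" "lie_subalgebra N \<aa> (ut N)"
    and "\<Omega> \<in> coadjoint_orbits N \<aa>" "orbit_rep N e \<aa> \<Omega> T"
  obtains l p where "polarized_form N \<aa> e l p" "polarized_form.orbit N \<aa> l = \<Omega>"
    "is_rep (exp_group N \<aa>) T" "rep_equiv (exp_group N \<aa>) T (kirillov_rep N e \<aa> l p)"
proof -
  interpret finite_matrix_lie_algebra N \<aa>
    using assms by unfold_locales
  interpret additive_character e using assms by unfold_locales
  obtain l p where lp: "l \<in> \<Omega>" "polarization N \<aa> l p" "is_rep G T" "rep_equiv G T (kirillov_rep N e \<aa> l p)"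
    using assms(6) unfolding orbit_rep_def by blast
  obtain l0 where l0: "l0 \<in> dual \<aa>" "\<Omega> = (\<lambda>s. coadjoint N \<aa> s l0) ` carrier G"
    using assms(5) unfolding coadjoint_orbits_def by blast
  obtain u where u: "u \<in> carrier G" "l = coadjoint N \<aa> u l0" using lp(1) l0(2) by blast
  have l: "l \<in> dual \<aa>" using u coadjoint_in_dual l0(1) by simp
  interpret polarized_form N \<aa> e l p using l lp(2) by unfold_locales
  have "orbit = \<Omega>"
  proof (intro equalityI subsetI)
    fix \<nu> assume "\<nu> \<in> orbit"
    then obtain s where s: "s \<in> carrier G" "\<nu> = coadjoint N \<aa> s l" by (auto simp: orbit_def)
    then have "\<nu> = coadjoint N \<aa> (s * u) l0"
      using u coadjoint_mult by simp
    moreover have "s * u \<in> carrier G" using G.m_closed[OF s(1) u(1)] by simp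
    ultimately show "\<nu> \<in> \<Omega>" unfolding l0(2) by (rule image_eqI)
  next
    fix \<nu> assume "\<nu> \<in> \<Omega>"
    then obtain s where s: "s \<in> carrier G" "\<nu> = coadjoint N \<aa> s l0" by (auto simp: l0(2))
    have iu: "inv\<^bsub>G\<^esub> u \<in> carrier G" using u by simp
    have "coadjoint N \<aa> (s * inv\<^bsub>G\<^esub> u) l = coadjoint N \<aa> s (coadjoint N \<aa> (inv\<^bsub>G\<^esub> u * u) l0)"
      unfolding coadjoint_mult[OF s(1) iu] coadjoint_mult[OF iu u(1)] u(2) ..
    also have "\<dots> = \<nu>" using inv_mult_G(2)[OF u(1)] coadjoint_one[OF l0(1)] s(2) by simp
    finally show "\<nu> \<in> orbit"
      using G.m_closed[OF s(1) iu] by (auto simp: orbit_def intro!: image_eqI)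
  qed
  with that lp polarized_form_axioms show ?thesis by blast
qed

theorem theorem9:
  fixes N :: nat
    and \<gg> \<hh> :: "'k::{field, finite} mat set"
    and e :: "'k \<Rightarrow> complex"
    and \<Omega> \<omega> :: "('k mat \<Rightarrow> 'k) set"
    and T :: "('k mat, 'v::complex_vector) rep"
    and t :: "('k mat, 'w::complex_vector) rep"
  defines "G \<equiv> exp_group N \<gg>"
    and "H \<equiv> exp_group N \<hh>"
  assumes "N \<ge> 1" and "CHAR('k) \<ge> N"
    and "nontrivial_additive_character e"
    and "lie_subalgebra N \<gg> (ut N)"
    and "lie_subalgebra N \<hh> \<gg>"
    and "\<Omega> \<in> coadjoint_orbits N \<gg>"
    and "\<omega> \<in> coadjoint_orbits N \<hh>"
    and "orbit_rep N e \<gg> \<Omega> T"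
    and "orbit_rep N e \<hh> \<omega> t"
  shows "real (rep_mult G T (ind_rep t H G)) =
           real (card (dual_proj \<hh> -` \<omega> \<inter> \<Omega>)) / sqrt (real (card \<omega>) * real (card \<Omega>)) \<and>
         real (rep_mult H t (res_rep T H)) =
           real (card (dual_proj \<hh> -` \<omega> \<inter> \<Omega>)) / sqrt (real (card \<omega>) * real (card \<Omega>))"
proof -
  note cond = assms(3-)
  have hut: "lie_subalgebra N \<hh> (ut N)"
    using cond(4,5) unfolding lie_subalgebra_def by blast
  obtain l p where big: "polarized_form N \<gg> e l p" "polarized_form.orbit N \<gg> l = \<Omega>"
    and T: "is_rep G T" "rep_equiv G T (kirillov_rep N e \<gg> l p)"
    using orbit_repE[OF cond(1-4,6,8)] unfolding G_def by blast
  obtain m q where small: "polarized_form N \<hh> e m q" "polarized_form.orbit N \<hh> m = \<omega>"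
    and t: "is_rep H t" "rep_equiv H t (kirillov_rep N e \<hh> m q)"
    using orbit_repE[OF cond(1-3) hut cond(7,9)] unfolding H_def by blast
  interpret big: polarized_form N \<gg> e l p by (rule big(1))
  interpret small: polarized_form N \<hh> e m q by (rule small(1))
  interpret polarized_pair N \<gg> \<hh> e l m p q by unfold_locales (rule cond(5))
  note T' = T[unfolded G_def big.kirillov_rep_eq] and t' = t[unfolded H_def small.kirillov_rep_eq]
  have "of_nat (rep_mult G T (ind_rep t H G) * (card p * card q))
      = (of_nat (card big.rad * card small.rad * incidences) :: complex)"
    using big.G.rep_mult_ind[OF H_below big.P_below big.linear_character_xi small.P_below
        small.linear_character_xi big.dim_eigenvectors_xi T' t'] trace_ind
    by (simp add: G_def H_def big.p.card_G small.p.card_G)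
  note ind = multiplicity_value[OF this]
  \<comment> \<open>For the restriction it is \<open>t\<close> that is counted, so the
    one-dimensional eigenspace required is that of the small group, in contrast to the induced
    case.\<close>
  have "of_nat (rep_mult H t (res_rep T H) * (card p * card q))
      = (of_nat (card big.rad * card small.rad * incidences) :: complex)"
    using big.G.rep_mult_res[OF H_below big.P_below big.linear_character_xi small.P_below
        small.linear_character_xi small.dim_eigenvectors_xi T' t'] trace_res
    by (simp add: G_def H_def big.p.card_G small.p.card_G mult_ac)
  note res = multiplicity_value[OF this]
  show ?thesis
    using ind res by (simp add: incidences_def big(2) small(2))
qed

end
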